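(* Let $W_q$ be a random variable taking values in $\{0,1,2,\dots\}$ such that, for all $x>0$, \[ P\Big(\tfrac{W_q}{2}\ge x,\ W_q\text{ even}\Big)=h_1(\lceil x\rceil)e^{-\nu\lceil x\rceil},\qquad P\Big(\tfrac{W_q-1}{2}\ge x,\ W_q\text{ odd}\Big)=h_2(\lceil x\rceil)e^{-\nu\lceil x\rceil}, \] where $\nu>0$ and $h_1,h_2$ are positive functions on $(0,\infty)$ such that $h_2(x)/h_1(x)\to c_1$ as $x\to\infty$ for some fixed $c_1\ge 0$, and $h_1(ax)/h_1(x)\to 1$ as $x\to\infty$, $a\to 1$. Let \[ X=L(e^{W_q})\,e^{\beta W_q}(-1)^{W_q}, \] where $\beta>0$ and $L$ is a slowly varying function at $\infty$ such that $n\mapsto L(e^n)$ is ultimately monotonically increasing, and suppose $\alpha:=\nu/(2\beta)<2$. Let $X_1,X_2,\dots$ be i.i.d. copies of $X$, let $F$ be the distribution function of $X$, $Q(s)=\inf\{y: F(y)\ge s\}$ for $0\le s\le 1$, and set \[ k_n=\Big\lceil \frac{e^{(n-1)\nu}}{h_1(n-1)}\Big\rceil,\qquad A_{k_n}=L(e^{2n-2})e^{2\beta(n-1)},\qquad B_{k_n}=k_n\int_{1/k_n}^{1-1/k_n}Q(s)\,ds . \] Then, as $n\to\infty$, \[ \frac{1}{A_{k_n}}\Big\{\sum_{j=1}^{k_n}X_j-B_{k_n}\Big\} \] converges in distribution to a non-Gaussian semi-stable law, namely the semi-stable law characterized (in the sense described in the context) by the index $\alpha=\nu/(2\beta)$ and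 the functions \[ M_L(-x)=c_1\exp\Big(-\nu\Big(\Big[\tfrac12+\tfrac{1}{2\beta}\log x\Big]-\tfrac{1}{2\beta}\log x\Big)\Big),\qquad M_R(x)=\exp\Big(-\nu\Big(\Big\lceil \tfrac{1}{2\beta}\log x\Big\rceil_{+}-\tfrac{1}{2\beta}\log x\Big)\Big),\qquad x>0, \] with location parameter $\eta=\Theta(\psi_1)-\Theta(\psi_2)$.
   Context: Notation: $\lceil x\rceil$ is the smallest integer $\ge x$; $\lceil x\rceil_{+}$ is the smallest integer strictly larger than $x$ (so $\lceil x\rceil_+=[x]+1$); $[x]$ is the integer part (largest integer $\le x$). Semi-stable law characterized by $\alpha\in(0,2)$ and functions $M_L$ on $(-\infty,0)$, $M_R$ on $(0,\infty)$: put $\Lambda_L(x)=M_L(x)/|x|^{\alpha}$ for $x<0$ and $\Lambda_R(x)=-M_R(x)/x^{\alpha}$ for $x>0$. It is the infinitely divisible distribution without Gaussian part whose characteristic function $\hat\mu$ satisfies \[ \log\hat\mu(t)=i\eta t+\int_{-\infty}^0\Big(e^{itx}-1-\frac{itx}{1+x^2}\Big)d\Lambda_L(x)+\int_0^{\infty}\Big(e^{itx}-1-\frac{itx}{1+x^2}\Big)d\Lambda_R(x), \] where the location is $\eta=\Theta(\psi_1)-\Theta(\psi_2)$ with $\Theta(\psi_i)=\int_0^1\frac{\psi_i(s)}{1+\psi_i^2(s)}ds-\int_1^\infty\frac{\psi_i^3(s)}{1+\psi_i^2(s)}ds$, $\psi_1(s)=\inf_{x<0}\{\Lambda_L(x)>s\}$,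 $\psi_2(s)=\inf_{x<0}\{-\Lambda_R(-x)>s\}$. *)

theory Defs
  imports "HOL-Probability.Probability"
begin

definition ceil_plus :: "real \<Rightarrow> int" where
  "ceil_plus x = \<lfloor>x\<rfloor> + 1"

definition slowly_varying :: "(real \<Rightarrow> real) \<Rightarrow> bool" where
  "slowly_varying L \<longleftrightarrow>
     (\<exists>A>0. (\<forall>x\<ge>A. L x > 0) \<and> (\<lambda>x. L x * indicator {A..} x) \<in> borel_measurable borel) \<and>
     (\<forall>c>0. ((\<lambda>x. L (c * x) / L x) \<longlongrightarrow> 1) at_top)"

text \<open>Right limit of a monotone function (used so that d Lambda is the usual Stieltjes measure).\<close>
definition rlim :: "(real \<Rightarrow> real) \<Rightarrow> real \<Rightarrow> real" where
  "rlim F x = Lim (at_right x) F"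

definition stieltjes_neg :: "(real \<Rightarrow> real) \<Rightarrow> real measure \<Rightarrow> bool" where
  "stieltjes_neg Lam \<nu> \<longleftrightarrow> sets \<nu> = sets borel \<and> emeasure \<nu> {0..} = 0 \<and>
     (\<forall>a b. a \<le> b \<and> b < 0 \<longrightarrow> emeasure \<nu> {a<..b} = ennreal (rlim Lam b - rlim Lam a))"

definition stieltjes_pos :: "(real \<Rightarrow> real) \<Rightarrow> real measure \<Rightarrow> bool" where
  "stieltjes_pos Lam \<nu> \<longleftrightarrow> sets \<nu> = sets borel \<and> emeasure \<nu> {..0} = 0 \<and>
     (\<forall>a b. 0 < a \<and> a \<le> b \<longrightarrow> emeasure \<nu> {a<..b} = ennreal (rlim Lam b - rlim Lam a))"

definition LambdaL :: "real \<Rightarrow> (real \<Rightarrow> real) \<Rightarrow> real \<Rightarrow> real" where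
  "LambdaL \<alpha> Mlf x = Mlf x / \<bar>x\<bar> powr \<alpha>"

definition LambdaR :: "real \<Rightarrow> (real \<Rightarrow> real) \<Rightarrow> real \<Rightarrow> real" where
  "LambdaR \<alpha> MR x = - MR x / x powr \<alpha>"

definition psi1 :: "(real \<Rightarrow> real) \<Rightarrow> real \<Rightarrow> real" where
  "psi1 LL s = (if {x. x < 0 \<and> LL x > s} = {} then 0 else Inf {x. x < 0 \<and> LL x > s})"

definition psi2 :: "(real \<Rightarrow> real) \<Rightarrow> real \<Rightarrow> real" where
  "psi2 LR s = (if {x. x < 0 \<and> - LR (- x) > s} = {} then 0 else Inf {x. x < 0 \<and> - LR (- x) > s})"

definition Theta :: "(real \<Rightarrow> real) \<Rightarrow> real" where
  "Theta \<psi> = (LBINT s:{0..1}. \<psi> s / (1 + (\<psi> s)\<^sup>2)) - (LBINT s:{1..}. (\<psi> s) ^ 3 / (1 + (\<psi> s)\<^sup>2))"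

definition levy_integrand :: "real \<Rightarrow> real \<Rightarrow> complex" where
  "levy_integrand t x = iexp (t * x) - 1 - \<i> * complex_of_real (t * x / (1 + x\<^sup>2))"

definition semi_stable_law :: "real \<Rightarrow> (real \<Rightarrow> real) \<Rightarrow> (real \<Rightarrow> real) \<Rightarrow> real measure \<Rightarrow> bool" where
  "semi_stable_law \<alpha> Mlf MR \<mu> \<longleftrightarrow> real_distribution \<mu> \<and>
     (let LL = LambdaL \<alpha> Mlf; LR = LambdaR \<alpha> MR;
          \<eta> = Theta (psi1 LL) - Theta (psi2 LR) in
      \<exists>\<nu>L \<nu>R. stieltjes_neg LL \<nu>L \<and> stieltjes_pos LR \<nu>R \<and>
        (\<forall>t. integrable \<nu>L (levy_integrand t) \<and> integrable \<nu>R (levy_integrand t) \<and>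
             char \<mu> t = exp (\<i> * complex_of_real (\<eta> * t)
                + integral\<^sup>L \<nu>L (levy_integrand t) + integral\<^sup>L \<nu>R (levy_integrand t))))"

definition M_left :: "real \<Rightarrow> real \<Rightarrow> real \<Rightarrow> real \<Rightarrow> real" where
  "M_left c1 \<nu> \<beta> y = (let x = - y in
     c1 * exp (- \<nu> * (of_int \<lfloor>1/2 + ln x / (2 * \<beta>)\<rfloor> - ln x / (2 * \<beta>))))"

definition M_right :: "real \<Rightarrow> real \<Rightarrow> real \<Rightarrow> real" where
  "M_right \<nu> \<beta> x = exp (- \<nu> * (of_int (ceil_plus (ln x / (2 * \<beta>))) - ln x / (2 * \<beta>)))"

end

theory Submission
  imports Defs
begin

text \<open>
  Put \<open>N = n - 1\<close>. Up to the regularly varying factors, \<open>W\<^sub>q = 2N + i\<close> has probability of order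
  \<open>1/k\<close> for every fixed integer \<open>i\<close>, and on that event \<open>X/A\<close> is close to \<open>(-1)\<^sup>i e\<^bsup>\<beta>i\<^esup>\<close>. Hence
  \<open>k\<close> times the law of \<open>Y = X/A\<close> converges to an atomic measure, with geometric weights in
  \<open>i\<close>. Potter-type bounds for \<open>h\<^sub>1\<close> and \<open>L\<close> make \<open>k P(W\<^sub>q = 2N + i) min(1, |Y|)\<^sup>r\<close>, for some
  \<open>r\<close> between \<open>max 1 \<alpha>\<close> and 2, decay exponentially in \<open>|i|\<close> uniformly in \<open>N\<close>, so that every limit
  below is a dominated convergence over the integers.

  Writing the characteristic function of \<open>Y\<close> as \<open>1 + w\<close>, one has \<open>k |w|\<^sup>2 \<longrightarrow> 0\<close>, hence the \<open>k\<close>-th power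
  may be replaced by \<open>exp(k w)\<close>, and \<open>k w\<close> is \<open>k\<close> times the expectation of the Levy integrand plus
  \<open>i t k E(Y/(1 + Y\<^sup>2))\<close>. With \<open>Z(u) = Q(u/k)/A\<close> the difference between \<open>k E(Y/(1 + Y\<^sup>2))\<close> and
  the centring is the integral of \<open>Z/(1 + Z\<^sup>2)\<close> over the two extreme unit intervals of \<open>[0,k]\<close> minus that
  of \<open>Z\<^sup>3/(1 + Z\<^sup>2)\<close> over the rest, and \<open>Z\<close> converges to \<open>\<psi>\<^sub>1\<close> at the left end and, reflected, to
  \<open>\<psi>\<^sub>2\<close> at the right end. This gives the location \<open>\<Theta>(\<psi>\<^sub>1) - \<Theta>(\<psi>\<^sub>2)\<close>.

  The limit law is not known in advance, so Levy's continuity theorem is needed in the form that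
  produces it: tightness follows by averaging the characteristic functions against a Gaussian.
\<close>

text \<open>One exponent \<open>r\<close> serves all the limits. Up to factors exp(e |i|), the
  weight k P(W = 2N + i) has order exp(-\<nu> i / 2) and |Y| has order exp(\<beta> i). For i > 0 the
  cut-off at 1 leaves the decay of the weight. For i < 0 the product has order exp(-(r \<beta> -
  \<nu> / 2) |i|), so decay means r > \<nu> / (2 \<beta>) = \<alpha>, and some r < 2 is available
  because \<alpha> < 2. With r < 2 the Levy integrand is bounded by a multiple of min(1, |y|)^r;
  with r >= 1 as well, k |w|^2 is of order k^(1 - 2/r). The cubic integrand of \<open>Theta\<close>
  is dominated by a multiple of u^(-3/r), integrable at infinity once r < 3. The obstacle is the
  discreteness of the limit: tails converge only away from its atoms, and quantiles only at levels
  that its tail functions do not attain. Both exceptional sets are countable. The first can be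
  avoided when test points are chosen, and the second is a null set in the integrals of
  \<open>Theta\<close>.\<close>

section \<open>Slowly varying sequences\<close>

text \<open>A Potter bound for sequences. Iterating the one-step ratio costs a factor exp(e) per
  step in either direction. The separate sequence \<open>d\<close> is allowed because the bound must
  hold for every \<open>w\<close>, also where \<open>c\<close> is not yet positive.\<close>

lemma slowly_varying_sequence_bound:
  fixes c d :: "nat \<Rightarrow> real"
  assumes ratio: "(\<lambda>n. c (Suc n) / c n) \<longlonglongrightarrow> 1"
    and pos: "eventually (\<lambda>n. c n > 0) sequentially"
    and le: "eventually (\<lambda>n. d n \<le> c n) sequentially"
    and e: "e > 0"
  shows "\<exists>K n0. K > 0 \<and> (\<forall>w. \<forall>N\<ge>n0. d w \<le> K * c N * exp (e * \<bar>real w - real N\<bar>))"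
proof -
  have "eventually (\<lambda>n. c (Suc n) / c n < exp e) sequentially"
    "eventually (\<lambda>n. c (Suc n) / c n > exp (- e)) sequentially"
    using e by (intro order_tendstoD[OF ratio]; simp)+
  then have "eventually (\<lambda>n. c n > 0 \<and> d n \<le> c n \<and> c (Suc n) \<le> exp e * c n \<and> c n \<le> exp e * c (Suc n)) sequentially"
    using pos le by eventually_elim (auto simp: field_simps exp_minus)
  then obtain n0 where n0: "\<And>n. n \<ge> n0 \<Longrightarrow> c n > 0 \<and> d n \<le> c n \<and> c (Suc n) \<le> exp e * c n \<and> c n \<le> exp e * c (Suc n)"
    unfolding eventually_sequentially by blast
  have up: "c (n + j) \<le> c n * exp (e * real j) \<and> c n \<le> c (n + j) * exp (e * real j)" if n: "n \<ge> n0" for n j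
  proof (induction j)
    case (Suc j)
    have a: "c (Suc (n + j)) \<le> exp e * c (n + j)" "c (n + j) \<le> exp e * c (Suc (n + j))"
      using n0[of "n + j"] n by auto
    have E: "exp (e * real (Suc j)) = exp e * exp (e * real j)"
      by (simp add: exp_add[symmetric] algebra_simps)
    have "c (Suc (n + j)) \<le> exp e * (c n * exp (e * real j))"
      by (rule order_trans[OF a(1)], rule mult_left_mono) (use Suc in auto)
    moreover have "c n \<le> exp e * c (Suc (n + j)) * exp (e * real j)"
      by (rule order_trans[OF conjunct2[OF Suc]], rule mult_right_mono) (use a in auto)
    ultimately show ?case unfolding E by (simp add: ac_simps)
  qed simp
  have main: "c w \<le> c N * exp (e * \<bar>real w - real N\<bar>)" if "w \<ge> n0" "N \<ge> n0" for w N
  proof (cases "w \<le> N")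
    case True
    with up[of w "N - w"] that show ?thesis by (simp add: of_nat_diff)
  next
    case False
    with up[of N "w - N"] that show ?thesis by (simp add: of_nat_diff)
  qed
  \<comment> \<open>The finitely many values \<open>d w\<close> with \<open>w < n0\<close> are
    absorbed into the constant: they are compared with \<open>c n0\<close>, and \<open>w\<close> is
    further from \<open>N\<close> than \<open>n0\<close> is.\<close>
  define K where "K = 1 + (\<Sum>w<n0. \<bar>d w\<bar>) / c n0"
  have c0: "c n0 > 0" using n0[of n0] by simp
  have s0: "(\<Sum>w<n0. \<bar>d w\<bar>) \<ge> 0" by (intro sum_nonneg) auto
  have K1: "K \<ge> 1" using c0 s0 by (simp add: K_def)
  have "d w \<le> K * c N * exp (e * \<bar>real w - real N\<bar>)" if N: "N \<ge> n0" for w N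
  proof (cases "w \<ge> n0")
    case True
    have "d w \<le> c w" using n0 True by simp
    also have "\<dots> \<le> 1 * (c N * exp (e * \<bar>real w - real N\<bar>))" using main True N by simp
    also have "\<dots> \<le> K * (c N * exp (e * \<bar>real w - real N\<bar>))"
      using K1 n0[OF N] by (intro mult_right_mono) auto
    finally show ?thesis by (simp add: mult.assoc)
  next
    case False
    have "d w \<le> (\<Sum>w<n0. \<bar>d w\<bar>)"
      using False member_le_sum[of w "{..<n0}" "\<lambda>w. \<bar>d w\<bar>"] by auto
    also have "\<dots> \<le> K * c n0" using c0 by (simp add: K_def field_simps)
    also have "\<dots> \<le> K * (c N * exp (e * \<bar>real n0 - real N\<bar>))"
      using K1 main[of n0 N] N by (intro mult_left_mono) auto
    also have "\<dots> \<le> K * (c N * exp (e * \<bar>real w - real N\<bar>))"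
      using K1 n0[OF N] False N e by (intro mult_left_mono) auto
    finally show ?thesis by (simp add: mult.assoc)
  qed
  with K1 show ?thesis by (intro exI[of _ K] exI[of _ n0]) auto
qed

lemma tendsto_ratio_shift:
  fixes c :: "nat \<Rightarrow> real"
  assumes ratio: "(\<lambda>n. c (Suc n) / c n) \<longlonglongrightarrow> 1" and pos: "eventually (\<lambda>n. c n > 0) sequentially"
  shows "(\<lambda>n. c (nat (int n + i)) / c n) \<longlonglongrightarrow> 1"
proof -
  have shift: "(\<lambda>n. c (n + j) / c n) \<longlonglongrightarrow> 1" for j
  proof (induction j)
    case 0
    have "eventually (\<lambda>n. c (n + 0) / c n = 1) sequentially" using pos by eventually_elim auto
    then show ?case by (rule tendsto_eventually)
  next
    case (Suc j)
    have "(\<lambda>n. c (Suc (n + j)) / c (n + j) * (c (n + j) / c n)) \<longlonglongrightarrow> 1 * 1"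
      by (intro tendsto_mult Suc) (rule LIMSEQ_ignore_initial_segment[OF ratio, of j, simplified])
    moreover have "eventually (\<lambda>n. c (Suc (n + j)) / c (n + j) * (c (n + j) / c n) = c (n + Suc j) / c n) sequentially"
      using eventually_all_ge_at_top[OF pos]
    proof eventually_elim
      case (elim n)
      then have "c (n + j) > 0" by simp
      then show ?case by simp
    qed
    ultimately show ?case by (auto intro: Lim_transform_eventually)
  qed
  show ?thesis
  proof (cases "i \<ge> 0")
    case True
    with shift[of "nat i"] show ?thesis by (simp add: nat_add_distrib)
  next
    case False
    \<comment> \<open>A backward shift at index \<open>n + j\<close> is the reciprocal of the
      forward shift at \<open>n\<close>, and at such an index \<open>nat\<close> truncates
      nothing.\<close>
    define j where "j = nat (- i)"
    have i: "i = - int j" using False by (simp add: j_def)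
    have "(\<lambda>n. inverse (c (n + j) / c n)) \<longlonglongrightarrow> inverse 1"
      by (intro tendsto_inverse shift) simp
    then have "(\<lambda>n. c (nat (int (n + j) + i)) / c (n + j)) \<longlonglongrightarrow> 1"
      by (simp add: i)
    then show ?thesis by (rule LIMSEQ_offset)
  qed
qed

section \<open>Levy continuity without a given limit\<close>

text \<open>Fubini, together with the fact that the standard normal characteristic function is
  itself a Gaussian. The average over frequencies becomes the integral of a positive kernel that is
  concentrated at scale 1/s.\<close>

lemma integral_char_normal:
  assumes "real_distribution M"
  shows "(CLINT t|std_normal_distribution. char M (s * t)) = complex_of_real (LINT x|M. exp (- (s * x)\<^sup>2 / 2))"
proof -
  interpret M: real_distribution M by fact
  interpret N: real_distribution std_normal_distribution by (rule real_dist_normal_dist)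
  interpret P: pair_prob_space M std_normal_distribution ..
  have i: "integrable (M \<Otimes>\<^sub>M std_normal_distribution) (\<lambda>(x, t). iexp (s * t * x))"
    by (rule P.integrable_const_bound[where B=1]) (auto simp: split_beta' simp del: of_real_mult)
  have "(CLINT t|std_normal_distribution. char M (s * t)) =
      (CLINT t|std_normal_distribution. CLINT x|M. iexp (s * t * x))"
    by (simp add: char_def)
  also have "\<dots> = (CLINT x|M. CLINT t|std_normal_distribution. iexp (s * t * x))"
    using P.Fubini_integral[OF i] by simp
  also have "\<dots> = (CLINT x|M. char std_normal_distribution (s * x))"
    by (simp add: char_def ac_simps)
  also have "\<dots> = (CLINT x|M. complex_of_real (exp (- (s * x)\<^sup>2 / 2)))"
    by (simp add: char_std_normal_distribution)
  finally show ?thesis by (simp only: integral_complex_of_real)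
qed

text \<open>Markov's inequality for 1 - exp(-(s x)^2 / 2), which is nonnegative and at least 1 -
  exp(-1/2) where |s x| >= 1.\<close>

lemma char_gaussian_average_bound:
  assumes "real_distribution M" and s: "s > 0"
  shows "(1 - exp (- 1 / 2)) * measure M {x. \<bar>x\<bar> \<ge> 1 / s}
      \<le> 1 - Re (CLINT t|std_normal_distribution. char M (s * t))"
proof -
  interpret M: real_distribution M by fact
  have e: "exp (- (s * x)\<^sup>2 / 2) \<le> exp (- 1 / 2)" if "\<bar>x\<bar> \<ge> 1 / s" for x
  proof -
    have "1 \<le> \<bar>s * x\<bar>" using that s by (simp add: abs_mult field_simps)
    then have "1 \<le> (s * x)\<^sup>2" using abs_le_square_iff[of 1 "s*x"] by simp
    then show ?thesis by simp
  qed
  have i: "integrable M (\<lambda>x. exp (- (s * x)\<^sup>2 / 2))"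
    by (rule M.integrable_const_bound[where B=1]) auto
  have "(1 - exp (- 1 / 2)) * measure M {x. \<bar>x\<bar> \<ge> 1 / s}
      = (LINT x|M. (1 - exp (- 1 / 2)) * indicator {x. \<bar>x\<bar> \<ge> 1 / s} x)"
    by simp
  also have "\<dots> \<le> (LINT x|M. 1 - exp (- (s * x)\<^sup>2 / 2))"
    by (rule integral_mono)
       (use e i in \<open>auto simp: less_top[symmetric] M.emeasure_eq_measure split: split_indicator\<close>)
  also have "\<dots> = 1 - (LINT x|M. exp (- (s * x)\<^sup>2 / 2))"
    using i M.prob_space by (subst Bochner_Integration.integral_diff) auto
  finally show ?thesis by (simp add: integral_char_normal[OF assms(1)])
qed

text \<open>Since \<open>\<phi> 0 = 1\<close> and \<open>\<phi>\<close> is continuous at 0, the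
  Gaussian average of 1 - \<open>\<phi>\<close> is small for small \<open>s\<close>. Dominated
  convergence carries this to the laws of large index at that fixed \<open>s\<close>.\<close>

lemma tight_if_char_tendsto:
  fixes M :: "nat \<Rightarrow> real measure"
  assumes M: "\<And>n. real_distribution (M n)"
    and lim: "\<And>t. (\<lambda>n. char (M n) t) \<longlonglongrightarrow> \<phi> t"
    and cont: "isCont \<phi> 0"
  shows "tight M"
  unfolding tight_def
proof (intro conjI allI impI M)
  fix e :: real assume e: "e > 0"
  interpret Mn: real_distribution "M n" for n by fact
  interpret N: real_distribution std_normal_distribution by (rule real_dist_normal_dist)
  define c where "c = 1 - exp (- 1 / 2 :: real)"
  have c: "c > 0" by (simp add: c_def)
  have [measurable]: "\<phi> \<in> borel_measurable borel"
    by (rule borel_measurable_LIMSEQ_metric[OF _ lim]) simp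
  have bound: "norm (\<phi> t) \<le> 1" for t
    by (rule LIMSEQ_le_const2[OF tendsto_norm[OF lim]]) (auto intro: Mn.cmod_char_le_1)
  have phi0: "\<phi> 0 = 1"
    using LIMSEQ_unique[OF lim[of 0]] by (simp add: Mn.char_zero)
  have "(\<lambda>m. CLINT t|std_normal_distribution. \<phi> (1 / real (Suc m) * t)) \<longlonglongrightarrow>
      (CLINT t|std_normal_distribution. 1)"
  proof (rule integral_dominated_convergence[where w="\<lambda>_. 1"])
    have "(\<lambda>m. \<phi> (1 / real (Suc m) * t)) \<longlonglongrightarrow> \<phi> 0" for t
    proof (rule isCont_tendsto_compose[OF cont])
      show "(\<lambda>m. 1 / real (Suc m) * t) \<longlonglongrightarrow> 0"
        using tendsto_mult_right[OF LIMSEQ_inverse_real_of_nat, of t] by (simp add: inverse_eq_divide)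
    qed
    then show "AE t in std_normal_distribution. (\<lambda>m. \<phi> (1 / real (Suc m) * t)) \<longlonglongrightarrow> 1"
      by (simp add: phi0)
  qed (auto simp: bound)
  then have "(\<lambda>m. 1 - Re (CLINT t|std_normal_distribution. \<phi> (1 / real (Suc m) * t))) \<longlonglongrightarrow> 1 - Re 1"
    using N.prob_space by (intro tendsto_intros) auto
  then have "eventually (\<lambda>m. 1 - Re (CLINT t|std_normal_distribution. \<phi> (1 / real (Suc m) * t)) < c * e) sequentially"
    using c e by (intro order_tendstoD) auto
  then obtain m where m: "1 - Re (CLINT t|std_normal_distribution. \<phi> (1 / real (Suc m) * t)) < c * e"
    by (auto simp: eventually_sequentially)
  define s where "s = 1 / real (Suc m)"
  have s: "s > 0" by (simp add: s_def)
  have "(\<lambda>n. CLINT t|std_normal_distribution. char (M n) (s * t)) \<longlonglongrightarrow>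
      (CLINT t|std_normal_distribution. \<phi> (s * t))"
    by (rule integral_dominated_convergence[where w="\<lambda>_. 1"])
       (auto intro!: lim Mn.cmod_char_le_1 measurable_compose[OF _ Mn.char_measurable])
  then have "(\<lambda>n. 1 - Re (CLINT t|std_normal_distribution. char (M n) (s * t))) \<longlonglongrightarrow>
      1 - Re (CLINT t|std_normal_distribution. \<phi> (s * t))"
    by (intro tendsto_intros)
  then have "eventually (\<lambda>n. 1 - Re (CLINT t|std_normal_distribution. char (M n) (s * t)) < c * e) sequentially"
    using m by (intro order_tendstoD) (auto simp: s_def)
  then have "eventually (\<lambda>n. measure (M n) {x. \<bar>x\<bar> \<ge> 1 / s} < e) sequentially"
  proof eventually_elim
    case (elim n)
    have "c * measure (M n) {x. \<bar>x\<bar> \<ge> 1 / s} < c * e"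
      using char_gaussian_average_bound[OF M s, of n, folded c_def] elim by linarith
    then show ?case using c by simp
  qed
  then obtain N where N: "\<And>n. n \<ge> N \<Longrightarrow> measure (M n) {x. \<bar>x\<bar> \<ge> 1 / s} < e"
    by (auto simp: eventually_sequentially)
  have large: "1 - e < measure (M n) {- (1 / s) <.. 1 / s}" if "n \<ge> N" for n
  proof -
    have "1 - measure (M n) {x. \<bar>x\<bar> \<ge> 1 / s} = measure (M n) (space (M n) - {x. \<bar>x\<bar> \<ge> 1 / s})"
      by (subst Mn.prob_compl) auto
    also have "\<dots> \<le> measure (M n) {- (1 / s) <.. 1 / s}"
      by (rule Mn.finite_measure_mono) auto
    finally show ?thesis using N[OF that] by linarith
  qed
  \<comment> \<open>Each single law is tight; this is needed for the finitely many indices below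
    \<open>N\<close>, whose windows are all contained in the one given by \<open>R\<close>.\<close>
  have "\<exists>K::nat. 1 - e < measure (M n) {- real K <.. real K}" for n
  proof -
    have "(\<lambda>k::nat. measure (M n) {- real k<..real k}) \<longlonglongrightarrow> measure (M n) (\<Union>k::nat. {- real k<..real k})"
      by (rule Mn.finite_Lim_measure_incseq) (auto simp: incseq_def)
    also have "(\<Union>k::nat. {- real k<..real k}) = UNIV"
      by (auto, metis leI le_less_trans less_imp_le minus_less_iff reals_Archimedean2)
    finally have "(\<lambda>k::nat. measure (M n) {- real k<..real k}) \<longlonglongrightarrow> 1"
      using Mn.prob_space by simp
    then have "eventually (\<lambda>k::nat. 1 - e < measure (M n) {- real k<..real k}) sequentially"
      using e by (intro order_tendstoD) auto
    then show ?thesis by (auto simp: eventually_sequentially)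
  qed
  then obtain K :: "nat \<Rightarrow> nat" where K: "\<And>n. 1 - e < measure (M n) {- real (K n) <.. real (K n)}"
    by metis
  define R where "R = 1 / s + real (\<Sum>n<N. K n)"
  have "1 - e < measure (M n) {- R <.. R}" for n
  proof (cases "n \<ge> N")
    case True
    have "1 / s \<le> R" by (simp add: R_def sum_nonneg)
    then have "measure (M n) {- (1 / s) <.. 1 / s} \<le> measure (M n) {- R <.. R}"
      by (intro Mn.finite_measure_mono) auto
    with large[OF True] show ?thesis by linarith
  next
    case False
    then have "K n \<le> (\<Sum>n<N. K n)" by (intro member_le_sum) auto
    then have "real (K n) \<le> real (\<Sum>n<N. K n)" by (rule of_nat_mono)
    then have "real (K n) \<le> R" unfolding R_def by (rule add_increasing[rotated]) (use s in simp)
    then have "measure (M n) {- real (K n) <.. real (K n)} \<le> measure (M n) {- R <.. R}"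
      by (intro Mn.finite_measure_mono) auto
    with K[of n] show ?thesis by linarith
  qed
  moreover have "0 < R" unfolding R_def using s by (intro add_pos_nonneg) (auto intro: sum_nonneg)
  then have "- R < R" by simp
  ultimately show "\<exists>a b. a < b \<and> (\<forall>n. measure (M n) {a<..b} > 1 - e)" by blast
qed

text \<open>Tightness yields a weak limit along a subsequence; its characteristic function must be
  \<open>\<phi>\<close>, so the continuity theorem with a known limit then applies to the whole
  sequence.\<close>

theorem levy_continuity_exists:
  fixes M :: "nat \<Rightarrow> real measure"
  assumes M: "\<And>n. real_distribution (M n)"
    and lim: "\<And>t. (\<lambda>n. char (M n) t) \<longlonglongrightarrow> \<phi> t"
    and cont: "isCont \<phi> 0"
  shows "\<exists>\<mu>. real_distribution \<mu> \<and> char \<mu> = \<phi> \<and> weak_conv_m M \<mu>"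
proof -
  obtain r \<mu> where r: "strict_mono (r :: nat \<Rightarrow> nat)" and \<mu>: "real_distribution \<mu>"
    and w: "weak_conv_m (M \<circ> id \<circ> r) \<mu>"
    using tight_imp_convergent_subsubsequence[OF tight_if_char_tendsto[OF assms] strict_mono_id] by blast
  have w': "weak_conv_m (\<lambda>n. M (r n)) \<mu>" using w by (simp add: comp_def)
  have "char \<mu> t = \<phi> t" for t
    using LIMSEQ_unique[OF levy_continuity1[OF M \<mu> w'] LIMSEQ_subseq_LIMSEQ[OF lim r, unfolded comp_def]] .
  then have c: "char \<mu> = \<phi>" by auto
  with levy_continuity[OF M \<mu>] lim \<mu> show ?thesis by auto
qed

section \<open>Generalised inverses and the functional Theta\<close>

context
  fixes g :: "real \<Rightarrow> real"
  assumes g_mono: "\<And>x y. x \<le> y \<Longrightarrow> y < 0 \<Longrightarrow> g x \<le> g y"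
    and g_bot: "(g \<longlongrightarrow> 0) at_bot"
begin

lemma bdd_below_superlevel:
  assumes "s > 0"
  shows "bdd_below {x. x < 0 \<and> g x > s}"
proof -
  have "eventually (\<lambda>x. g x < s) at_bot" using assms by (rule order_tendstoD(2)[OF g_bot])
  then obtain b where b: "\<And>x. x \<le> b \<Longrightarrow> g x < s" unfolding eventually_at_bot_linorder by blast
  have "b \<le> x" if "s < g x" for x using b[of x] that by linarith
  then show ?thesis by (intro bdd_belowI[of _ b]) auto
qed

lemma psi1_le: "s > 0 \<Longrightarrow> x < 0 \<Longrightarrow> g x > s \<Longrightarrow> psi1 g s \<le> x"
  using cInf_lower[OF _ bdd_below_superlevel, of x s] by (auto simp: psi1_def)

lemma psi1_nonpos: "s > 0 \<Longrightarrow> psi1 g s \<le> 0"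
proof (cases "\<exists>x<0. g x > s")
  case True
  assume "s > 0"
  with True psi1_le[of s] show ?thesis by (meson less_imp_le order_trans)
qed (auto simp: psi1_def)

lemma psi1_mono: "0 < s \<Longrightarrow> s \<le> t \<Longrightarrow> psi1 g s \<le> psi1 g t"
proof (cases "{x. x < 0 \<and> g x > t} = {}")
  case True
  assume "0 < s"
  with True psi1_nonpos[of s] show ?thesis by (simp add: psi1_def)
next
  case False
  assume "0 < s" "s \<le> t"
  have "psi1 g t = Inf {x. x < 0 \<and> g x > t}" unfolding psi1_def using False by (rule if_not_P)
  also have "\<dots> \<ge> psi1 g s"
    using False \<open>0 < s\<close> \<open>s \<le> t\<close> by (intro cInf_greatest psi1_le) auto
  finally show ?thesis .
qed

text \<open>Convergence of monotone functions passes to generalised inverses at levels which the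
  limit does not attain. Of \<open>z n\<close> only the two comparisons \<open>lo\<close> and
  \<open>hi\<close> with \<open>G n\<close> are required, so left and right quantiles can both take
  its place.\<close>

lemma tendsto_psi1:
  fixes G :: "nat \<Rightarrow> real \<Rightarrow> real" and z :: "nat \<Rightarrow> real"
  assumes conv: "\<And>x. x < 0 \<Longrightarrow> x \<notin> D \<Longrightarrow> (\<lambda>n. G n x) \<longlonglongrightarrow> g x" and D: "countable D"
    and u: "u > 0" "u \<notin> g ` {..<0}"
    and lo: "eventually (\<lambda>n. \<forall>x<0. G n x < u \<longrightarrow> x \<le> z n) sequentially"
    and hi: "eventually (\<lambda>n. \<forall>x<0. G n x > u \<longrightarrow> z n \<le> x) sequentially"
    and z: "\<And>n. z n \<le> 0"
  shows "z \<longlonglongrightarrow> psi1 g u"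
proof (rule order_tendstoI)
  fix a assume a: "a < psi1 g u"
  obtain x where x: "a < x" "x < psi1 g u" "x \<notin> D"
    using open_minus_countable[OF D, of "{a<..<psi1 g u}"] a by auto
  have x0: "x < 0" using x psi1_nonpos[OF u(1)] by simp
  \<comment> \<open>Lying below the infimum gives only \<open>g x \<le> u\<close>; equality is
    excluded because \<open>u\<close> is not a value of \<open>g\<close>.\<close>
  have "g x < u" using psi1_le[OF u(1) x0] x u x0 by (force simp: not_less[symmetric])
  then have "eventually (\<lambda>n. G n x < u) sequentially" by (rule order_tendstoD(2)[OF conv[OF x0 x(3)]])
  with lo show "eventually (\<lambda>n. a < z n) sequentially"
    by eventually_elim (use x x0 in \<open>force\<close>)
next
  fix a assume a: "psi1 g u < a"
  show "eventually (\<lambda>n. z n < a) sequentially"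
  proof (cases "a > 0")
    case True
    then show ?thesis using z by (auto intro!: always_eventually intro: le_less_trans)
  next
    case False
    \<comment> \<open>An empty superlevel set would give \<open>psi1\<close> its default value 0,
      contradicting \<open>psi1 g u < a\<close> with \<open>a \<le> 0\<close>.\<close>
    then have ne: "{x. x < 0 \<and> g x > u} \<noteq> {}" using a by (auto simp: psi1_def split: if_splits)
    then have "psi1 g u = Inf {x. x < 0 \<and> g x > u}" unfolding psi1_def by (rule if_not_P)
    then obtain s where s: "s < 0" "g s > u" "s < a"
      using cInf_lessD[OF ne, of a] a by auto
    obtain x where x: "s < x" "x < a" "x \<notin> D"
      using open_minus_countable[OF D, of "{s<..<a}"] s by auto
    have x0: "x < 0" using x False by simp
    have "u < g x" using g_mono[of s x] x x0 s by simp
    then have "eventually (\<lambda>n. G n x > u) sequentially" by (rule order_tendstoD(1)[OF conv[OF x0 x(3)]])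
    with hi show ?thesis by eventually_elim (use x x0 in force)
  qed
qed

text \<open>The restriction to positive levels is where monotonicity is available: at other levels
  the superlevel set may be unbounded below, and its \<open>Inf\<close> carries no
  information.\<close>

lemma measurable_psi1: "(\<lambda>u. indicator {0<..} u * psi1 g u) \<in> borel_measurable borel"
proof -
  have "mono_on {0<..} (psi1 g)" by (auto intro!: mono_onI psi1_mono)
  then have "psi1 g \<in> borel_measurable (restrict_space borel {0<..})" by (rule borel_measurable_mono_on_fnc)
  then show ?thesis by (subst (asm) borel_measurable_restrict_space_iff) auto
qed

end

section \<open>Convergence of the functional Theta along rescaled quantiles\<close>

lemma set_integrable_powr_atLeast:
  assumes "e < - (1::real)"
  shows "set_integrable lborel {1..} (\<lambda>u. u powr e)"
proof -
  have "((\<lambda>u. u powr e) has_integral -(1 powr (e + 1)) / (e + 1)) {1..}"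
    using assms by (intro has_integral_powr_to_inf) auto
  then have "(\<lambda>u. u powr e) absolutely_integrable_on {1..}"
    by (intro nonnegative_absolutely_integrable_1) (auto simp: integrable_on_def)
  then show ?thesis
    unfolding set_integrable_def by (subst (asm) integrable_completion) auto
qed

lemma abs_ratio_le_1: "\<bar>z / (1 + z\<^sup>2)\<bar> \<le> (1::real)"
proof -
  have "\<bar>z\<bar> * 2 \<le> 1 + z\<^sup>2" using sum_squares_ge_zero[of "\<bar>z\<bar> - 1" 0] by (simp add: power2_eq_square algebra_simps)
  moreover have "1 + z\<^sup>2 > 0" by (simp add: add_pos_nonneg)
  ultimately show ?thesis by (simp add: abs_divide)
qed

lemma abs_cube_ratio_le: "\<bar>z ^ 3 / (1 + z\<^sup>2)\<bar> \<le> \<bar>z::real\<bar> ^ 3"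
proof -
  have "\<bar>z\<bar> ^ 3 / (1 + z\<^sup>2) \<le> \<bar>z\<bar> ^ 3 / 1" by (intro divide_left_mono) (auto simp: add_pos_nonneg)
  then show ?thesis by (simp add: abs_divide power_abs)
qed

text \<open>Turns a bound on tail times truncated power into decay of the quantile \<open>q\<close>
  in its level \<open>u\<close>. The a priori bound \<open>R\<close> undoes the truncation, as
  \<open>q \<le> max 1 R * min 1 q\<close>.\<close>

lemma le_if_mult_min_powr_le:
  fixes q u C r R :: real
  assumes "0 \<le> q" "q \<le> R" "u > 0" "r > 0" "u * min 1 q powr r \<le> C"
  shows "q \<le> max 1 R * (C / u) powr (1 / r)"
proof -
  have m: "0 \<le> min 1 q" using assms by simp
  have "min 1 q powr r \<le> C / u" using assms by (simp add: field_simps)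
  then have "(min 1 q powr r) powr (1 / r) \<le> (C / u) powr (1 / r)"
    using assms by (intro powr_mono2) auto
  then have a: "min 1 q \<le> (C / u) powr (1 / r)" using assms m by (simp add: powr_powr)
  have "q \<le> max 1 R * min 1 q"
  proof (cases "q \<le> 1")
    case True
    then show ?thesis using mult_right_mono[of 1 "max 1 R" q] assms by simp
  next
    case False
    then show ?thesis using assms by simp
  qed
  also have "\<dots> \<le> max 1 R * (C / u) powr (1 / r)" using a by (intro mult_left_mono) auto
  finally show ?thesis .
qed

text \<open>Dominated convergence in both integrals. Over the unit interval the integrand is bounded
  by 1; beyond it, \<open>bound\<close> inverted by \<open>le_if_mult_min_powr_le\<close> gives |z|
  of order u^(-1/r), hence the integrable majorant u^(-3/r).\<close>

theorem tendsto_Theta_psi1: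
  fixes G z :: "nat \<Rightarrow> real \<Rightarrow> real" and k :: "nat \<Rightarrow> real" and g :: "real \<Rightarrow> real"
  assumes g_mono: "\<And>x y. x \<le> y \<Longrightarrow> y < 0 \<Longrightarrow> g x \<le> g y"
    and g_bot: "(g \<longlongrightarrow> 0) at_bot" and g_range: "countable (g ` {..<0})"
    and conv: "\<And>x. x < 0 \<Longrightarrow> x \<notin> D \<Longrightarrow> (\<lambda>n. G n x) \<longlonglongrightarrow> g x" and D: "countable D"
    and k: "filterlim k at_top sequentially"
    and z_meas [measurable]: "\<And>n. z n \<in> borel_measurable borel"
    and z_nonpos: "\<And>n u. z n u \<le> 0" and z_ge: "\<And>n u. u \<ge> k n \<Longrightarrow> z n u = 0"
    and lo: "\<And>n u x. 0 < u \<Longrightarrow> u < k n \<Longrightarrow> x < 0 \<Longrightarrow> G n x < u \<Longrightarrow> x \<le> z n u"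
    and hi: "\<And>n u x. 0 < u \<Longrightarrow> u < k n \<Longrightarrow> x < 0 \<Longrightarrow> G n x > u \<Longrightarrow> z n u \<le> x"
    and r: "0 < r" "r < 3"
    and bound: "eventually (\<lambda>n. \<forall>x<0. G n x * min 1 \<bar>x\<bar> powr r \<le> C) sequentially"
  shows "(\<lambda>n. (LBINT u:{0..1}. z n u / (1 + (z n u)\<^sup>2)) - (LBINT u:{1..}. z n u ^ 3 / (1 + (z n u)\<^sup>2)))
      \<longlonglongrightarrow> Theta (psi1 g)"
proof -
  define p where "p u = indicator {0<..} u * psi1 g u" for u :: real
  have p_meas [measurable]: "p \<in> borel_measurable borel"
    unfolding p_def by (rule measurable_psi1[OF g_mono g_bot])
  have nz: "1 + x\<^sup>2 \<noteq> 0" for x :: real by (smt (verit) zero_le_power2)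
  have small: "eventually (\<lambda>n. u < k n) sequentially" for u
    using k by (auto simp: filterlim_at_top_dense)
  have pt: "(\<lambda>n. z n u) \<longlonglongrightarrow> p u" if u: "u > 0" "u \<notin> g ` {..<0}" for u
  proof -
    have "(\<lambda>n. z n u) \<longlonglongrightarrow> psi1 g u"
    proof (rule tendsto_psi1[OF g_mono g_bot conv D u])
      show "eventually (\<lambda>n. \<forall>x<0. G n x < u \<longrightarrow> x \<le> z n u) sequentially"
        using small[of u] by eventually_elim (auto intro: lo u)
      show "eventually (\<lambda>n. \<forall>x<0. u < G n x \<longrightarrow> z n u \<le> x) sequentially"
        using small[of u] by eventually_elim (auto intro: hi u)
    qed (auto intro: z_nonpos)
    then show ?thesis using u by (simp add: p_def)
  qed
  have AE: "AE u in lborel. u \<notin> insert 0 (g ` {..<0})"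
    by (intro AE_not_in countable_imp_null_set_lborel countable_insert g_range)
  have "eventually (\<lambda>x. g x < 1) at_bot" by (rule order_tendstoD(2)[OF g_bot]) simp
  then obtain b where b: "\<And>x. x \<le> b \<Longrightarrow> g x < 1" unfolding eventually_at_bot_linorder by blast
  \<comment> \<open>A point with limiting tail below 1 bounds the quantiles:
    \<open>G n x0 < 1 \<le> u\<close> forces \<open>x0 \<le> z n u\<close> for every level
    \<open>u \<ge> 1\<close> below \<open>k n\<close>. This supplies the \<open>R\<close> needed to
    undo the truncation.\<close>
  obtain x0 where x0: "x0 \<notin> D" "x0 < 0" "x0 < b"
    using open_minus_countable[OF D, of "{min 0 b - 1<..<min 0 b}"] by auto
  have "eventually (\<lambda>n. G n x0 < 1) sequentially"
    using b[of x0] x0 by (intro order_tendstoD(2)[OF conv]) auto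
  define K where "K = (2 * max 1 \<bar>x0\<bar>) ^ 3 * max 0 C powr (3 / r)"
  have K0: "K \<ge> 0" by (simp add: K_def)
  have dom: "eventually (\<lambda>n. \<forall>u\<ge>1. \<bar>z n u ^ 3 / (1 + (z n u)\<^sup>2)\<bar> \<le> K * u powr (- (3 / r))) sequentially"
    using \<open>eventually (\<lambda>n. G n x0 < 1) sequentially\<close> bound
  proof eventually_elim
    case (elim n)
    show ?case
    proof (intro allI impI)
      fix u :: real assume u: "u \<ge> 1"
      show "\<bar>z n u ^ 3 / (1 + (z n u)\<^sup>2)\<bar> \<le> K * u powr (- (3 / r))"
      proof (cases "z n u = 0")
        case True
        then show ?thesis using K0 by simp
      next
        case False
        then have zn: "z n u < 0" using z_nonpos[of n u] by simp
        have uk: "u < k n" using z_ge[of n u] False by force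
        \<comment> \<open>The contrapositive of \<open>lo\<close> gives \<open>G n x \<ge> u\<close>
          only for \<open>x\<close> strictly above \<open>z n u\<close>, so the tail is tested at
          half the distance; this is the factor 2 in \<open>K\<close>.\<close>
        define q where "q = \<bar>z n u\<bar> / 2"
        have q: "q > 0" "z n u < - q" using zn by (auto simp: q_def)
        have "x0 \<le> z n u" using u uk x0 elim by (intro lo) auto
        then have qR: "q \<le> \<bar>x0\<bar>" using zn x0 by (simp add: q_def)
        have "u \<le> G n (- q)" using lo[of u n "- q"] q u uk by force
        then have "u * min 1 q powr r \<le> G n (- q) * min 1 q powr r" by (intro mult_right_mono) auto
        also have "\<dots> \<le> max 0 C" using elim(2)[rule_format, of "- q"] q by simp
        finally have "q \<le> max 1 \<bar>x0\<bar> * (max 0 C / u) powr (1 / r)"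
          using q qR u r by (intro le_if_mult_min_powr_le) auto
        then have "\<bar>z n u\<bar> \<le> 2 * max 1 \<bar>x0\<bar> * (max 0 C / u) powr (1 / r)" by (simp add: q_def)
        then have "\<bar>z n u\<bar> ^ 3 \<le> (2 * max 1 \<bar>x0\<bar> * (max 0 C / u) powr (1 / r)) ^ 3"
          by (intro power_mono) auto
        also have "\<dots> = (2 * max 1 \<bar>x0\<bar>) ^ 3 * (max 0 C / u) powr (3 / r)"
        proof -
          have "((max 0 C / u) powr (1 / r)) ^ 3 = (max 0 C / u) powr (3 / r)"
            by (cases "max 0 C / u = 0") (auto simp: powr_power)
          then show ?thesis by (simp add: power_mult_distrib)
        qed
        also have "\<dots> = K * u powr (- (3 / r))"
        proof -
          have "(max 0 C / u) powr (3 / r) = max 0 C powr (3 / r) / u powr (3 / r)"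
            by (rule powr_divide)
          then show ?thesis by (simp add: K_def powr_minus divide_inverse)
        qed
        finally show ?thesis using abs_cube_ratio_le[of "z n u"] by linarith
      qed
    qed
  qed
  have "(\<lambda>n. LBINT u:{0..1}. z n u / (1 + (z n u)\<^sup>2)) \<longlonglongrightarrow> (LBINT u:{0..1}. p u / (1 + (p u)\<^sup>2))"
    unfolding set_lebesgue_integral_def
  proof (rule integral_dominated_convergence[where w="indicator {0..1}"])
    show "AE u in lborel. (\<lambda>n. indicator {0..1} u *\<^sub>R (z n u / (1 + (z n u)\<^sup>2))) \<longlonglongrightarrow>
        indicator {0..1} u *\<^sub>R (p u / (1 + (p u)\<^sup>2))"
      using AE
    proof eventually_elim
      case (elim u)
      then show ?case by (cases "u > 0") (auto intro!: tendsto_intros pt nz split: split_indicator)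
    qed
    show "AE u in lborel. norm (indicator {0..1} u *\<^sub>R (z n u / (1 + (z n u)\<^sup>2))) \<le> indicat_real {0..1} u" for n
      using abs_ratio_le_1 by (auto split: split_indicator)
  qed (auto simp: emeasure_lborel_Icc_eq)
  moreover have "(LBINT u:{0..1}. p u / (1 + (p u)\<^sup>2)) = (LBINT u:{0..1}. psi1 g u / (1 + (psi1 g u)\<^sup>2))"
    unfolding set_lebesgue_integral_def
    by (rule integral_discrete_difference[where X="{0}"]) (auto simp: p_def split: split_indicator)
  moreover have "(\<lambda>n. LBINT u:{1..}. z n u ^ 3 / (1 + (z n u)\<^sup>2)) \<longlonglongrightarrow> (LBINT u:{1..}. p u ^ 3 / (1 + (p u)\<^sup>2))"
  proof -
    obtain N where N: "\<And>n u. n \<ge> N \<Longrightarrow> u \<ge> 1 \<Longrightarrow> \<bar>z n u ^ 3 / (1 + (z n u)\<^sup>2)\<bar> \<le> K * u powr (- (3 / r))"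
      using dom unfolding eventually_sequentially by blast
    have "(\<lambda>n. LBINT u:{1..}. z (n + N) u ^ 3 / (1 + (z (n + N) u)\<^sup>2)) \<longlonglongrightarrow> (LBINT u:{1..}. p u ^ 3 / (1 + (p u)\<^sup>2))"
      unfolding set_lebesgue_integral_def
    proof (rule integral_dominated_convergence[where w="\<lambda>u. K * (indicator {1..} u * u powr (- (3 / r)))"])
      show "integrable lborel (\<lambda>u. K * (indicator {1..} u * u powr (- (3 / r))))"
        using set_integrable_powr_atLeast[of "- (3 / r)"] r
        by (intro integrable_mult_right) (simp add: set_integrable_def)
      show "AE u in lborel. (\<lambda>n. indicator {1..} u *\<^sub>R (z (n + N) u ^ 3 / (1 + (z (n + N) u)\<^sup>2))) \<longlonglongrightarrow>
          indicator {1..} u *\<^sub>R (p u ^ 3 / (1 + (p u)\<^sup>2))"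
        using AE
      proof eventually_elim
        case (elim u)
        then show ?case
          by (cases "u > 0") (auto intro!: tendsto_intros LIMSEQ_ignore_initial_segment pt nz split: split_indicator)
      qed
      show "AE u in lborel. norm (indicator {1..} u *\<^sub>R (z (n + N) u ^ 3 / (1 + (z (n + N) u)\<^sup>2)))
          \<le> K * (indicat_real {1..} u * u powr (- (3 / r)))" for n
        using N[of "n + N"] by (auto split: split_indicator)
    qed auto
    then show ?thesis by (rule LIMSEQ_offset)
  qed
  moreover have "(LBINT u:{1..}. p u ^ 3 / (1 + (p u)\<^sup>2)) = (LBINT u:{1..}. psi1 g u ^ 3 / (1 + (psi1 g u)\<^sup>2))"
    by (rule set_lebesgue_integral_cong) (auto simp: p_def)
  ultimately show ?thesis unfolding Theta_def by (auto intro: tendsto_diff)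
qed

section \<open>Quantile centring\<close>

text \<open>The quantile function is extended by zero outside the unit interval, so that its integrals
  may be taken over the whole line.\<close>

definition quantile :: "real measure \<Rightarrow> real \<Rightarrow> real" where
  "quantile \<mu> s = indicator {0<..<1} s * Inf {y. s \<le> cdf \<mu> y}"

text \<open>The two tails of the quantile function at scale \<open>1/k\<close>, both made nonpositive so that one
  limit theorem covers \<open>\<psi>\<^sub>1\<close> and \<open>\<psi>\<^sub>2\<close>.\<close>

definition left_quantile :: "real measure \<Rightarrow> real \<Rightarrow> real \<Rightarrow> real" where
  "left_quantile \<mu> k u = min 0 (quantile \<mu> (u / k))"

definition right_quantile :: "real measure \<Rightarrow> real \<Rightarrow> real \<Rightarrow> real" where
  "right_quantile \<mu> k u = min 0 (- quantile \<mu> (1 - u / k))"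

context real_distribution
begin

lemma quantile_le_iff: "0 < s \<Longrightarrow> s < 1 \<Longrightarrow> quantile M s \<le> x \<longleftrightarrow> s \<le> cdf M x"
proof -
  interpret cdf_distribution M ..
  show "0 < s \<Longrightarrow> s < 1 \<Longrightarrow> quantile M s \<le> x \<longleftrightarrow> s \<le> cdf M x"
    using pseudoinverse[of s x] by (simp add: quantile_def)
qed

lemma quantile_mono: "0 < s \<Longrightarrow> s \<le> t \<Longrightarrow> t < 1 \<Longrightarrow> quantile M s \<le> quantile M t"
  using quantile_le_iff[of s "quantile M t"] quantile_le_iff[of t "quantile M t"] by simp

lemma measurable_quantile [measurable]: "quantile M \<in> borel_measurable borel"
proof -
  interpret cdf_distribution M ..
  have "(\<lambda>s. indicator {0<..<1} s *\<^sub>R Inf {y. s \<le> cdf M y}) \<in> borel_measurable borel"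
    using measurable_CI by (subst (asm) borel_measurable_restrict_space_iff) auto
  then show ?thesis by (simp add: quantile_def[abs_def])
qed

lemma measurable_left_right_quantile [measurable]:
  "left_quantile M k \<in> borel_measurable borel" "right_quantile M k \<in> borel_measurable borel"
  unfolding left_quantile_def right_quantile_def by measurable

lemma integral_quantile:
  fixes f :: "real \<Rightarrow> real"
  assumes [measurable]: "f \<in> borel_measurable borel" and f0: "f 0 = 0"
  shows "(LINT x|M. f x) = (LBINT s. f (quantile M s))"
proof -
  interpret cdf_distribution M ..
  have "(LINT x|M. f x) = (LINT s|restrict_space lborel {0<..<1}. f (Inf {y. s \<le> cdf M y}))"
    by (subst distr_I_eq_M[symmetric], subst integral_distr) auto
  also have "\<dots> = (LBINT s:{0<..<1}. f (Inf {y. s \<le> cdf M y}))"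
    by (subst integral_restrict_space) (auto simp: set_lebesgue_integral_def)
  also have "\<dots> = (LBINT s. f (quantile M s))"
    unfolding set_lebesgue_integral_def
    by (rule Bochner_Integration.integral_cong) (auto simp: quantile_def f0 split: split_indicator)
  finally show ?thesis .
qed

text \<open>Together with \<open>left_quantile_le\<close> and the two right-hand counterparts, this
  supplies \<open>lo\<close> and \<open>hi\<close> of \<open>tendsto_Theta_psi1\<close>, with
  \<open>G\<close> equal to \<open>k\<close> times the lower tail at \<open>x\<close> or the closed
  upper tail at \<open>- x\<close>.\<close>

lemma left_quantile_ge:
  assumes "0 < u" "u < k" "k * cdf M x < u" "x < 0"
  shows "x \<le> left_quantile M k u"
  using assms quantile_le_iff[of "u / k" x] by (auto simp: left_quantile_def field_simps)

lemma left_quantile_le: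
  assumes "0 < u" "u < k" "k * cdf M x > u"
  shows "left_quantile M k u \<le> x"
  using assms quantile_le_iff[of "u / k" x] by (auto simp: left_quantile_def field_simps min_le_iff_disj)

lemma measure_atLeast: "measure M {x..} = 1 - measure M {..<x}"
  using prob_compl[of "{..<x}"] by (simp add: Compl_eq_Diff_UNIV[symmetric] Compl_lessThan)

lemma right_quantile_ge:
  assumes "0 < u" "u < k" "k * measure M {- x..} < u" "x < 0"
  shows "x \<le> right_quantile M k u"
proof -
  have "1 - u / k < measure M {..<- x}"
    using assms measure_atLeast[of "- x"] by (simp add: field_simps)
  also have "\<dots> \<le> cdf M (- x)" unfolding cdf_def by (rule finite_measure_mono) auto
  finally have "quantile M (1 - u / k) \<le> - x"
    using assms quantile_le_iff[of "1 - u / k" "- x"] by (simp add: field_simps)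
  then show ?thesis using assms by (simp add: right_quantile_def)
qed

lemma quantile_ge_if_measure_lessThan:
  assumes "0 < s" "s < 1" "measure M {..<x} < s"
  shows "x \<le> quantile M s"
proof (rule ccontr)
  assume a: "\<not> x \<le> quantile M s"
  have "s \<le> cdf M (quantile M s)" using quantile_le_iff[of s "quantile M s"] assms by simp
  also have "\<dots> \<le> measure M {..<x}" unfolding cdf_def using a by (intro finite_measure_mono) auto
  finally show False using assms by simp
qed

lemma right_quantile_le:
  assumes "0 < u" "u < k" "k * measure M {- x..} > u"
  shows "right_quantile M k u \<le> x"
proof -
  have "measure M {..<- x} < 1 - u / k"
    using assms measure_atLeast[of "- x"] by (simp add: field_simps)
  then have "- x \<le> quantile M (1 - u / k)"
    using assms by (intro quantile_ge_if_measure_lessThan) (auto simp: field_simps)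
  then show ?thesis by (simp add: right_quantile_def min_le_iff_disj)
qed

text \<open>The centring stops at level 1 - 1/k, that is at u = k - 1, whereas the integrals over
  \<open>{1..}\<close> run on. Mass at least 1/k on the nonnegative half-line makes the left tail
  vanish on the missing stretch. \<open>right_quantile_eq_0\<close> is the mirror image.\<close>

lemma left_quantile_eq_0:
  assumes "k > 1" "k * measure M {0..} \<ge> 1" "u > k - 1"
  shows "left_quantile M k u = 0"
proof (cases "u < k")
  case True
  have "measure M {..<0} < u / k"
    using assms measure_atLeast[of 0] by (simp add: field_simps)
  then have "0 \<le> quantile M (u / k)"
    using assms True by (intro quantile_ge_if_measure_lessThan) auto
  then show ?thesis by (simp add: left_quantile_def)
qed (use assms in \<open>simp add: left_quantile_def quantile_def\<close>)

lemma right_quantile_eq_0: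
  assumes "k > 1" "k * cdf M 0 \<ge> 1" "u > k - 1"
  shows "right_quantile M k u = 0"
proof (cases "u < k")
  case True
  have "quantile M (1 - u / k) \<le> 0"
    using assms True by (subst quantile_le_iff) (auto simp: field_simps)
  then show ?thesis by (simp add: right_quantile_def)
qed (use assms in \<open>simp add: right_quantile_def quantile_def\<close>)

end

lemma ratio_eq_diff_cube_ratio: "z / (1 + z\<^sup>2) = z - z ^ 3 / (1 + z\<^sup>2)" for z :: real
proof -
  have "1 + z\<^sup>2 \<noteq> 0" using zero_le_power2[of z] by linarith
  then show ?thesis by (simp add: divide_simps power2_eq_square power3_eq_cube algebra_simps)
qed

text \<open>The identity z/(1 + z^2) = z - z^3/(1 + z^2) is applied only on \<open>{1..}\<close>.
  Near \<open>u = 0\<close> only the bounded quotient is integrated, so \<open>z\<close> need not be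
  integrable there.\<close>

lemma truncation_split:
  fixes z :: "real \<Rightarrow> real"
  assumes [measurable]: "z \<in> borel_measurable borel"
    and z0: "\<And>u. u \<le> 0 \<Longrightarrow> z u = 0" "\<And>u. u \<ge> k \<Longrightarrow> z u = 0"
    and i: "set_integrable lborel {1..} z"
  shows "integrable lborel (\<lambda>u. z u / (1 + (z u)\<^sup>2))"
    and "(LBINT u. z u / (1 + (z u)\<^sup>2)) - (LBINT u:{1..}. z u) =
      (LBINT u:{0..1}. z u / (1 + (z u)\<^sup>2)) - (LBINT u:{1..}. z u ^ 3 / (1 + (z u)\<^sup>2))"
proof -
  let ?f = "\<lambda>u. z u / (1 + (z u)\<^sup>2)"
  show f: "integrable lborel ?f"
  proof (rule Bochner_Integration.integrable_bound)
    show "integrable lborel (indicator {0..k} :: real \<Rightarrow> real)"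
      by (simp add: emeasure_lborel_Icc_eq)
    show "AE u in lborel. norm (?f u) \<le> norm (indicat_real {0..k} u)"
    proof (rule AE_I2)
      fix u
      show "norm (?f u) \<le> norm (indicat_real {0..k} u)"
        using abs_ratio_le_1[of "z u"] z0[of u] by (cases "0 \<le> u \<and> u \<le> k") auto
    qed
  qed simp
  have "(LBINT u. ?f u) = (LBINT u. indicator {0..1} u *\<^sub>R ?f u + indicator {1..} u *\<^sub>R ?f u)"
    by (rule integral_discrete_difference[where X="{1}"]) (auto simp: z0 split: split_indicator)
  also have "\<dots> = (LBINT u:{0..1}. ?f u) + (LBINT u:{1..}. ?f u)"
    unfolding set_lebesgue_integral_def
    by (intro Bochner_Integration.integral_add integrable_mult_indicator f) auto
  also have "(LBINT u:{1..}. ?f u) = (LBINT u:{1..}. z u - z u ^ 3 / (1 + (z u)\<^sup>2))"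
    by (simp only: ratio_eq_diff_cube_ratio)
  also have "\<dots> = (LBINT u:{1..}. z u) - (LBINT u:{1..}. z u ^ 3 / (1 + (z u)\<^sup>2))"
  proof (rule set_integral_diff(2)[OF i])
    have "set_integrable lborel {1..} (\<lambda>u. z u - ?f u)"
      by (rule set_integral_diff(1)[OF i]) (unfold set_integrable_def, intro integrable_mult_indicator f, simp)
    also have "(\<lambda>u. z u - ?f u) = (\<lambda>u. z u ^ 3 / (1 + (z u)\<^sup>2))"
      by (simp add: fun_eq_iff ratio_eq_diff_cube_ratio)
    finally show "set_integrable lborel {1..} (\<lambda>u. z u ^ 3 / (1 + (z u)\<^sup>2))" .
  qed
  finally show "(LBINT u. ?f u) - (LBINT u:{1..}. z u) =
      (LBINT u:{0..1}. ?f u) - (LBINT u:{1..}. z u ^ 3 / (1 + (z u)\<^sup>2))" by simp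
qed


context real_distribution
begin

text \<open>An odd function satisfies f(q) = f(min 0 q) - f(min 0 (-q)). The expectation and the
  centring are therefore differences of a left and a right part, in the variables s = u/k and s = 1
  - u/k, and \<open>truncation_split\<close> treats each part.\<close>

lemma quantile_centring_eq:
  assumes k: "k > 2" and left: "k * cdf M 0 \<ge> 1" and right: "k * measure M {0..} \<ge> 1"
  shows "k * (LINT y|M. y / (1 + y\<^sup>2)) - k * (LBINT s:{1 / k..1 - 1 / k}. Inf {y. s \<le> cdf M y}) =
      ((LBINT u:{0..1}. left_quantile M k u / (1 + (left_quantile M k u)\<^sup>2)) -
        (LBINT u:{1..}. left_quantile M k u ^ 3 / (1 + (left_quantile M k u)\<^sup>2))) -
      ((LBINT u:{0..1}. right_quantile M k u / (1 + (right_quantile M k u)\<^sup>2)) -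
        (LBINT u:{1..}. right_quantile M k u ^ 3 / (1 + (right_quantile M k u)\<^sup>2)))"
proof -
  let ?l = "left_quantile M k" and ?r = "right_quantile M k" and ?q = "quantile M"
  define f where "f y = y / (1 + y\<^sup>2)" for y :: real
  have f_meas [measurable]: "f \<in> borel_measurable borel" unfolding f_def by measurable
  have k1: "1 / k > 0" "1 - 1 / k < 1" "1 / k < 1 - 1 / k" using k by (auto simp: field_simps)
  have l0: "?l u = 0" "?r u = 0" if "u \<le> 0 \<or> u \<ge> k" for u
    using that k by (auto simp: left_quantile_def right_quantile_def quantile_def field_simps split: split_indicator)
  have bl: "\<bar>?l u\<bar> \<le> \<bar>?q (1 / k)\<bar>" if "u \<ge> 1" for u
  proof (cases "u < k")
    case True
    then have "?q (1 / k) \<le> ?q (u / k)" using that k by (intro quantile_mono) (auto simp: field_simps)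
    then show ?thesis by (auto simp: left_quantile_def)
  qed (use l0 in simp)
  have br: "\<bar>?r u\<bar> \<le> \<bar>?q (1 - 1 / k)\<bar>" if "u \<ge> 1" for u
  proof (cases "u < k")
    case True
    then have "?q (1 - u / k) \<le> ?q (1 - 1 / k)" using that k by (intro quantile_mono) (auto simp: field_simps)
    then show ?thesis by (auto simp: right_quantile_def)
  qed (use l0 in simp)
  have il: "set_integrable lborel {1..} ?l"
    unfolding set_integrable_def
  proof (rule Bochner_Integration.integrable_bound)
    show "integrable lborel (\<lambda>u. \<bar>?q (1 / k)\<bar> * indicator {1..k} u)"
      by (intro integrable_mult_right) (simp add: emeasure_lborel_Icc_eq)
    show "AE u in lborel. norm (indicat_real {1..} u *\<^sub>R ?l u) \<le> norm (\<bar>?q (1 / k)\<bar> * indicator {1..k} u)"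
      using bl l0 by (auto split: split_indicator)
  qed simp
  have ir: "set_integrable lborel {1..} ?r"
    unfolding set_integrable_def
  proof (rule Bochner_Integration.integrable_bound)
    show "integrable lborel (\<lambda>u. \<bar>?q (1 - 1 / k)\<bar> * indicator {1..k} u)"
      by (intro integrable_mult_right) (simp add: emeasure_lborel_Icc_eq)
    show "AE u in lborel. norm (indicat_real {1..} u *\<^sub>R ?r u) \<le> norm (\<bar>?q (1 - 1 / k)\<bar> * indicator {1..k} u)"
      using br l0 by (auto split: split_indicator)
  qed simp
  note L = truncation_split[of ?l k, OF _ l0(1) l0(1) il, simplified]
  note R = truncation_split[of ?r k, OF _ l0(2) l0(2) ir, simplified]
  have aff: "k * (LBINT s. h s) = (LBINT u. h (u / k))" "k * (LBINT s. h s) = (LBINT u. h (1 - u / k))"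
    for h :: "real \<Rightarrow> real"
    using k lborel_integral_real_affine[of "1 / k" h 0] lborel_integral_real_affine[of "- 1 / k" h 1] by auto
  have iaff: "integrable lborel (\<lambda>u. h (u / k)) = integrable lborel h"
    "integrable lborel (\<lambda>u. h (1 - u / k)) = integrable lborel h" for h :: "real \<Rightarrow> real"
    using k lborel_integrable_real_affine_iff[of "1 / k" h 0] lborel_integrable_real_affine_iff[of "- 1 / k" h 1] by auto
  have split: "h y = h (min 0 y) - h (min 0 (- y))" if "\<And>y. h (- y) = - h y" "h 0 = 0"
    for h :: "real \<Rightarrow> real" and y
    using that by (cases "y \<le> 0") (auto simp: min_def)
  have "k * (LINT y|M. f y) = k * (LBINT s. f (min 0 (?q s)) - f (min 0 (- ?q s)))"
    by (subst integral_quantile, simp, simp add: f_def, subst split[of f]) (auto simp: f_def)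
  also have "\<dots> = k * (LBINT s. f (min 0 (?q s))) - k * (LBINT s. f (min 0 (- ?q s)))"
    using L(1) R(1) iaff(1)[of "\<lambda>s. f (min 0 (?q s))"] iaff(2)[of "\<lambda>s. f (min 0 (- ?q s))"]
    by (subst Bochner_Integration.integral_diff)
       (auto simp: left_quantile_def right_quantile_def f_def right_diff_distrib)
  also have "\<dots> = (LBINT u. f (?l u)) - (LBINT u. f (?r u))"
    unfolding aff(1)[of "\<lambda>s. f (min 0 (?q s))"] aff(2)[of "\<lambda>s. f (min 0 (- ?q s))"]
    by (simp add: left_quantile_def right_quantile_def)
  finally have E: "k * (LINT y|M. f y) = (LBINT u. f (?l u)) - (LBINT u. f (?r u))" .
  let ?J = "{1 / k..1 - 1 / k}"
  have J: "1 / k \<le> s \<Longrightarrow> 0 < s" "s \<le> 1 - 1 / k \<Longrightarrow> s < 1" for s using k1 by linarith+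
  \<comment> \<open>Level \<open>u / k\<close> lies in \<open>?J\<close> exactly for
    \<open>1 \<le> u \<le> k - 1\<close>; past \<open>k - 1\<close> both sides are 0 by
    \<open>left_quantile_eq_0\<close>.\<close>
  have Jl: "indicat_real ?J (u / k) * min 0 (?q (u / k)) = indicat_real {1..} u * ?l u" for u
    using left_quantile_eq_0[of k u] right k by (auto simp: left_quantile_def field_simps split: split_indicator)
  have Jr: "indicat_real ?J (1 - u / k) * min 0 (- ?q (1 - u / k)) = indicat_real {1..} u * ?r u" for u
    using right_quantile_eq_0[of k u] left k by (auto simp: right_quantile_def field_simps split: split_indicator)
  have "k * (LBINT s:?J. Inf {y. s \<le> cdf M y}) = k * (LBINT s. indicat_real ?J s * min 0 (?q s) - indicat_real ?J s * min 0 (- ?q s))"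
    unfolding set_lebesgue_integral_def
    by (intro arg_cong2[where f="(*)"] refl Bochner_Integration.integral_cong)
       (auto simp: quantile_def min_def dest: J split: split_indicator)
  also have "\<dots> = k * (LBINT s. indicat_real ?J s * min 0 (?q s)) - k * (LBINT s. indicat_real ?J s * min 0 (- ?q s))"
    using il ir iaff(1)[of "\<lambda>s. indicat_real ?J s * min 0 (?q s)"] iaff(2)[of "\<lambda>s. indicat_real ?J s * min 0 (- ?q s)"]
    unfolding Jl Jr by (subst Bochner_Integration.integral_diff) (auto simp: set_integrable_def right_diff_distrib)
  also have "\<dots> = (LBINT u:{1..}. ?l u) - (LBINT u:{1..}. ?r u)"
    unfolding aff(1)[of "\<lambda>s. indicat_real ?J s * min 0 (?q s)"] aff(2)[of "\<lambda>s. indicat_real ?J s * min 0 (- ?q s)"] Jl Jr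
    by (simp add: set_lebesgue_integral_def)
  finally show ?thesis using E L(2) R(2) by (simp add: f_def)
qed

lemma integrable_min_powr [simp]: "r > 0 \<Longrightarrow> integrable M (\<lambda>y. min 1 \<bar>y\<bar> powr r)"
  by (rule integrable_const_bound[where B=1]) (auto intro!: powr_le1)

text \<open>Markov's inequality for the truncated moment; it provides the tail bound that
  \<open>tendsto_Theta_psi1\<close> asks for.\<close>

lemma measure_mult_min_powr_le:
  assumes [measurable]: "A \<in> sets borel" and A: "\<And>y. y \<in> A \<Longrightarrow> \<bar>x\<bar> \<le> \<bar>y\<bar>" and r: "r > 0"
  shows "measure M A * min 1 \<bar>x\<bar> powr r \<le> (LINT y|M. min 1 \<bar>y\<bar> powr r)"
proof -
  have "measure M A * min 1 \<bar>x\<bar> powr r = (LINT y|M. indicator A y * min 1 \<bar>x\<bar> powr r)"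
    by simp
  also have "\<dots> \<le> (LINT y|M. min 1 \<bar>y\<bar> powr r)"
  proof (rule integral_mono)
    show "indicator A y * min 1 \<bar>x\<bar> powr r \<le> min 1 \<bar>y\<bar> powr r" for y
      using A[of y] r by (auto split: split_indicator intro!: powr_mono2)
  qed (use r in \<open>auto simp: emeasure_eq_measure\<close>)
  finally show ?thesis .
qed

end

lemma left_quantile_nonpos: "left_quantile \<mu> k u \<le> 0"
  by (simp add: left_quantile_def)

lemma right_quantile_nonpos: "right_quantile \<mu> k u \<le> 0"
  by (simp add: right_quantile_def)

theorem tendsto_quantile_centring:
  fixes \<mu> :: "nat \<Rightarrow> real measure" and k :: "nat \<Rightarrow> real"
  assumes \<mu>: "\<And>n. real_distribution (\<mu> n)" and k: "filterlim k at_top sequentially"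
    and k0: "\<And>n. k n \<ge> 0" and D: "countable D"
    and l_mono: "\<And>x y. x \<le> y \<Longrightarrow> y < 0 \<Longrightarrow> gl x \<le> gl y"
    and l_bot: "(gl \<longlongrightarrow> 0) at_bot" and l_range: "countable (gl ` {..<0})"
    and l_conv: "\<And>x. x < 0 \<Longrightarrow> x \<notin> D \<Longrightarrow> (\<lambda>n. k n * cdf (\<mu> n) x) \<longlonglongrightarrow> gl x"
    and r_mono: "\<And>x y. x \<le> y \<Longrightarrow> y < 0 \<Longrightarrow> gr x \<le> gr y"
    and r_bot: "(gr \<longlongrightarrow> 0) at_bot" and r_range: "countable (gr ` {..<0})"
    and r_conv: "\<And>x. x < 0 \<Longrightarrow> x \<notin> D \<Longrightarrow> (\<lambda>n. k n * measure (\<mu> n) {- x..}) \<longlonglongrightarrow> gr x"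
    and r: "0 < r" "r < 3"
    and bound: "eventually (\<lambda>n. k n * (LINT y|\<mu> n. min 1 \<bar>y\<bar> powr r) \<le> C) sequentially"
    and left: "eventually (\<lambda>n. k n * cdf (\<mu> n) 0 \<ge> 1) sequentially"
    and right: "eventually (\<lambda>n. k n * measure (\<mu> n) {0..} \<ge> 1) sequentially"
  shows "(\<lambda>n. k n * (LINT y|\<mu> n. y / (1 + y\<^sup>2)) -
      k n * (LBINT s:{1 / k n..1 - 1 / k n}. Inf {y. s \<le> cdf (\<mu> n) y})) \<longlonglongrightarrow> Theta (psi1 gl) - Theta (psi1 gr)"
proof -
  interpret \<mu>: real_distribution "\<mu> n" for n by fact
  have k2: "eventually (\<lambda>n. k n > 2) sequentially" using k by (auto simp: filterlim_at_top_dense)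
  have l: "(\<lambda>n. (LBINT u:{0..1}. left_quantile (\<mu> n) (k n) u / (1 + (left_quantile (\<mu> n) (k n) u)\<^sup>2)) -
        (LBINT u:{1..}. left_quantile (\<mu> n) (k n) u ^ 3 / (1 + (left_quantile (\<mu> n) (k n) u)\<^sup>2)))
      \<longlonglongrightarrow> Theta (psi1 gl)"
  proof (rule tendsto_Theta_psi1[OF l_mono l_bot l_range l_conv D k _ _ _ _ _ r])
    show "eventually (\<lambda>n. \<forall>x<0. k n * cdf (\<mu> n) x * min 1 \<bar>x\<bar> powr r \<le> C) sequentially"
      using bound k2
    proof eventually_elim
      case (elim n)
      have "cdf (\<mu> n) x * min 1 \<bar>x\<bar> powr r \<le> (LINT y|\<mu> n. min 1 \<bar>y\<bar> powr r)" if "x < 0" for x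
        unfolding cdf_def by (rule \<mu>.measure_mult_min_powr_le) (use that r in auto)
      then have "k n * (cdf (\<mu> n) x * min 1 \<bar>x\<bar> powr r) \<le> k n * (LINT y|\<mu> n. min 1 \<bar>y\<bar> powr r)" if "x < 0" for x
        using elim that by (simp add: mult_left_mono)
      with elim(1) have "k n * (cdf (\<mu> n) x * min 1 \<bar>x\<bar> powr r) \<le> C" if "x < 0" for x
        using that order_trans by blast
      then show ?case by (simp add: mult.assoc)
    qed
    show "left_quantile (\<mu> n) (k n) u = 0" if "u \<ge> k n" for n u
      using that k0[of n]
      by (cases "k n = 0") (auto simp: left_quantile_def quantile_def field_simps split: split_indicator)
    show "x \<le> left_quantile (\<mu> n) (k n) u" if "0 < u" "u < k n" "x < 0" "k n * cdf (\<mu> n) x < u" for n u x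
      using that by (intro \<mu>.left_quantile_ge)
    show "left_quantile (\<mu> n) (k n) u \<le> x" if "0 < u" "u < k n" "x < 0" "u < k n * cdf (\<mu> n) x" for n u x
      using that by (intro \<mu>.left_quantile_le)
  qed (simp_all add: left_quantile_nonpos)
  have r: "(\<lambda>n. (LBINT u:{0..1}. right_quantile (\<mu> n) (k n) u / (1 + (right_quantile (\<mu> n) (k n) u)\<^sup>2)) -
        (LBINT u:{1..}. right_quantile (\<mu> n) (k n) u ^ 3 / (1 + (right_quantile (\<mu> n) (k n) u)\<^sup>2)))
      \<longlonglongrightarrow> Theta (psi1 gr)"
  proof (rule tendsto_Theta_psi1[OF r_mono r_bot r_range r_conv D k _ _ _ _ _ r])
    show "eventually (\<lambda>n. \<forall>x<0. k n * measure (\<mu> n) {- x..} * min 1 \<bar>x\<bar> powr r \<le> C) sequentially"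
      using bound k2
    proof eventually_elim
      case (elim n)
      have "measure (\<mu> n) {- x..} * min 1 \<bar>x\<bar> powr r \<le> (LINT y|\<mu> n. min 1 \<bar>y\<bar> powr r)" if "x < 0" for x
        by (rule \<mu>.measure_mult_min_powr_le) (use that r in auto)
      then have "k n * (measure (\<mu> n) {- x..} * min 1 \<bar>x\<bar> powr r) \<le> k n * (LINT y|\<mu> n. min 1 \<bar>y\<bar> powr r)" if "x < 0" for x
        using elim that by (simp add: mult_left_mono)
      with elim(1) have "k n * (measure (\<mu> n) {- x..} * min 1 \<bar>x\<bar> powr r) \<le> C" if "x < 0" for x
        using that order_trans by blast
      then show ?case by (simp add: mult.assoc)
    qed
    show "right_quantile (\<mu> n) (k n) u = 0" if "u \<ge> k n" for n u
      using that k0[of n]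
      by (cases "k n = 0") (auto simp: right_quantile_def quantile_def field_simps split: split_indicator)
    show "x \<le> right_quantile (\<mu> n) (k n) u" if "0 < u" "u < k n" "x < 0" "k n * measure (\<mu> n) {- x..} < u" for n u x
      using that by (intro \<mu>.right_quantile_ge)
    show "right_quantile (\<mu> n) (k n) u \<le> x" if "0 < u" "u < k n" "x < 0" "u < k n * measure (\<mu> n) {- x..}" for n u x
      using that by (intro \<mu>.right_quantile_le)
  qed (simp_all add: right_quantile_nonpos)
  have "eventually (\<lambda>n. k n * (LINT y|\<mu> n. y / (1 + y\<^sup>2)) -
      k n * (LBINT s:{1 / k n..1 - 1 / k n}. Inf {y. s \<le> cdf (\<mu> n) y}) =
      ((LBINT u:{0..1}. left_quantile (\<mu> n) (k n) u / (1 + (left_quantile (\<mu> n) (k n) u)\<^sup>2)) -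
        (LBINT u:{1..}. left_quantile (\<mu> n) (k n) u ^ 3 / (1 + (left_quantile (\<mu> n) (k n) u)\<^sup>2))) -
      ((LBINT u:{0..1}. right_quantile (\<mu> n) (k n) u / (1 + (right_quantile (\<mu> n) (k n) u)\<^sup>2)) -
        (LBINT u:{1..}. right_quantile (\<mu> n) (k n) u ^ 3 / (1 + (right_quantile (\<mu> n) (k n) u)\<^sup>2)))) sequentially"
    using k2 left right by eventually_elim (rule \<mu>.quantile_centring_eq)
  from tendsto_cong[OF this] tendsto_diff[OF l r] show ?thesis by (rule iffD2)
qed

section \<open>Powers of characteristic functions\<close>

lemma norm_levy_integrand_le:
  "norm (levy_integrand t x) \<le> (2 + 3 * \<bar>t\<bar> + t\<^sup>2) * min 1 (x\<^sup>2)"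
proof (cases "\<bar>x\<bar> \<le> 1")
  case True
  have 1: "cmod (iexp (t * x) - 1 - \<i> * (t * x)) \<le> (t * x)\<^sup>2 / 2"
    using iexp_approx1[of "t * x" 1] by (simp add: power2_eq_square algebra_simps)
  \<comment> \<open>The compensator differs from the linear Taylor term only by a cubic one, so the
    second-order Taylor estimate survives near 0.\<close>
  have 2: "t * x / (1 + x\<^sup>2) = t * x - t * (x ^ 3 / (1 + x\<^sup>2))"
    using arg_cong[OF ratio_eq_diff_cube_ratio[of x], of "\<lambda>y. t * y"] by (simp add: right_diff_distrib)
  have "levy_integrand t x = (iexp (t * x) - 1 - \<i> * (t * x)) + \<i> * complex_of_real (t * (x ^ 3 / (1 + x\<^sup>2)))"
    unfolding levy_integrand_def 2 by (simp add: algebra_simps)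
  then have "cmod (levy_integrand t x) \<le> (t * x)\<^sup>2 / 2 + \<bar>t\<bar> * \<bar>x ^ 3 / (1 + x\<^sup>2)\<bar>"
    using norm_triangle_ineq[of "iexp (t * x) - 1 - \<i> * (t * x)" "\<i> * complex_of_real (t * (x ^ 3 / (1 + x\<^sup>2)))"] 1
    by (simp only: norm_mult norm_ii norm_of_real abs_mult)
  also have "\<dots> \<le> (t * x)\<^sup>2 / 2 + \<bar>t\<bar> * x\<^sup>2"
  proof -
    have "\<bar>x\<bar> ^ 3 \<le> x\<^sup>2" using True power_decreasing[of 2 3 "\<bar>x\<bar>"] by simp
    then have "\<bar>x ^ 3 / (1 + x\<^sup>2)\<bar> \<le> x\<^sup>2" using abs_cube_ratio_le[of x] by linarith
    then show ?thesis by (intro add_left_mono mult_left_mono) auto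
  qed
  also have "\<dots> = (t\<^sup>2 / 2 + \<bar>t\<bar>) * x\<^sup>2" by (simp add: power_mult_distrib algebra_simps)
  also have "\<dots> \<le> (2 + 3 * \<bar>t\<bar> + t\<^sup>2) * x\<^sup>2"
    using zero_le_power2[of t] by (intro mult_right_mono) (linarith, simp)
  also have "x\<^sup>2 = min 1 (x\<^sup>2)" using True abs_le_square_iff[of x 1] by simp
  finally show ?thesis .
next
  case False
  have "cmod (levy_integrand t x) \<le> cmod (iexp (t * x)) + cmod 1 + cmod (\<i> * complex_of_real (t * x / (1 + x\<^sup>2)))"
    unfolding levy_integrand_def
    by (rule order_trans[OF norm_triangle_ineq4]) (intro add_right_mono norm_triangle_ineq4)
  also have "\<dots> = 2 + \<bar>t\<bar> * \<bar>x / (1 + x\<^sup>2)\<bar>" 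
    by (simp only: norm_exp_i_times norm_mult norm_ii norm_of_real norm_one abs_mult times_divide_eq_right[symmetric])
  also have "\<dots> \<le> 2 + \<bar>t\<bar> * 1" using abs_ratio_le_1[of x] by (intro add_left_mono mult_left_mono) auto
  also have "\<dots> \<le> 2 + 3 * \<bar>t\<bar> + t\<^sup>2" using zero_le_power2[of t] by linarith
  also have "min 1 (x\<^sup>2) = 1" using False abs_le_square_iff[of 1 x] by simp
  then have "2 + 3 * \<bar>t\<bar> + t\<^sup>2 = (2 + 3 * \<bar>t\<bar> + t\<^sup>2) * min 1 (x\<^sup>2)" by simp
  finally show ?thesis .
qed

lemma measurable_levy_integrand [measurable]: "levy_integrand t \<in> borel_measurable borel"
  unfolding levy_integrand_def by measurable

text \<open>Above the threshold \<open>d\<close> the first power is traded for the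
  \<open>r\<close>-th, since m^(1 - r) <= d^(1 - r) there. The threshold is left free and chosen
  later.\<close>

lemma le_powr_split:
  fixes m d r :: real
  assumes "m \<ge> 0" "d > 0" "r \<ge> 1"
  shows "m \<le> d + d powr (1 - r) * m powr r"
proof (cases "m \<le> d")
  case True
  then show ?thesis by (simp add: add_increasing2)
next
  case False
  have "m = m powr (1 - r) * m powr r" using False assms by (simp add: powr_add[symmetric])
  also have "\<dots> \<le> d powr (1 - r) * m powr r"
    using False assms powr_mono2'[of "1 - r" d m] by (intro mult_right_mono) auto
  finally show ?thesis using assms by linarith
qed


lemma cmod_exp_minus_linear_le:
  fixes w :: complex
  assumes "cmod w \<le> 2"
  shows "cmod (1 + w - exp w) \<le> exp 2 * (cmod w)\<^sup>2"
proof -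
  have "cmod (exp w - (\<Sum>k\<le>1. w ^ k / fact k)) \<le> exp \<bar>Re w\<bar> * (cmod w) ^ Suc 1 / fact 1"
    by (rule Taylor_exp)
  also have "\<dots> \<le> exp 2 * (cmod w)\<^sup>2"
    using abs_Re_le_cmod[of w] assms by (auto simp: power2_eq_square intro!: mult_right_mono)
  finally show ?thesis by (simp add: norm_minus_commute)
qed

text \<open>|iexp(t y) - 1| is of first order in y, whereas the moment under control has order
  \<open>r \<ge> 1\<close>; the free threshold \<open>d\<close> bridges the gap.\<close>

lemma (in real_distribution) cmod_char_minus_1_le:
  assumes r: "r \<ge> 1" and d: "d > 0"
  shows "cmod (char M t - 1) \<le> (2 + \<bar>t\<bar>) * (d + d powr (1 - r) * (LINT y|M. min 1 \<bar>y\<bar> powr r))"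
proof -
  have i: "integrable M (\<lambda>y. iexp (t * y))" by (rule integrable_const_bound[where B=1]) auto
  have "char M t - 1 = (CLINT y|M. iexp (t * y) - 1)"
    unfolding char_def using i prob_space by (subst Bochner_Integration.integral_diff) (auto simp del: of_real_mult)
  also have "cmod \<dots> \<le> (LINT y|M. (2 + \<bar>t\<bar>) * (d + d powr (1 - r) * min 1 \<bar>y\<bar> powr r))"
  proof (rule Bochner_Integration.integral_norm_bound_integral)
    show "cmod (iexp (t * y) - 1) \<le> (2 + \<bar>t\<bar>) * (d + d powr (1 - r) * min 1 \<bar>y\<bar> powr r)" for y
    proof -
      have a: "cmod (iexp (t * y) - 1) \<le> 2"
        using iexp_approx2[of "t * y" 0] by simp
      have b: "cmod (iexp (t * y) - 1) \<le> \<bar>t\<bar> * \<bar>y\<bar>"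
        using iexp_approx1[of "t * y" 0] by (simp add: abs_mult)
      have "cmod (iexp (t * y) - 1) \<le> (2 + \<bar>t\<bar>) * min 1 \<bar>y\<bar>"
      proof (cases "\<bar>y\<bar> \<le> 1")
        case True
        have "\<bar>t\<bar> * \<bar>y\<bar> \<le> (2 + \<bar>t\<bar>) * \<bar>y\<bar>" by (intro mult_right_mono) auto
        then show ?thesis using b True by (simp only: min_absorb2)
      next
        case False
        then show ?thesis using a by (simp add: min_absorb1)
      qed
      also have "\<dots> \<le> (2 + \<bar>t\<bar>) * (d + d powr (1 - r) * min 1 \<bar>y\<bar> powr r)"
        by (intro mult_left_mono le_powr_split) (use r d in auto)
      finally show ?thesis .
    qed
  qed (use i r in auto)
  also have "\<dots> = (2 + \<bar>t\<bar>) * (d + d powr (1 - r) * (LINT y|M. min 1 \<bar>y\<bar> powr r))"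
    using r prob_space by (simp add: integral_mult_right_zero)
  finally show ?thesis .
qed

lemma tendsto_mult_char_minus_1_square:
  fixes \<mu> :: "nat \<Rightarrow> real measure" and k :: "nat \<Rightarrow> real"
  assumes \<mu>: "\<And>n. real_distribution (\<mu> n)" and k: "filterlim k at_top sequentially"
    and r: "1 \<le> r" "r < 2"
    and bound: "eventually (\<lambda>n. k n * (LINT y|\<mu> n. min 1 \<bar>y\<bar> powr r) \<le> C) sequentially"
  shows "(\<lambda>n. k n * (cmod (char (\<mu> n) t - 1))\<^sup>2) \<longlonglongrightarrow> 0"
proof -
  interpret \<mu>: real_distribution "\<mu> n" for n by fact
  define c where "c = (2 + \<bar>t\<bar>) * (1 + C)"
  have k0: "eventually (\<lambda>n. k n > 0) sequentially" using k by (auto simp: filterlim_at_top_dense)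
  have ev: "eventually (\<lambda>n. norm (k n * (cmod (char (\<mu> n) t - 1))\<^sup>2) \<le> c\<^sup>2 * k n powr (1 - 2 / r)) sequentially"
    using bound k0
  proof eventually_elim
    case (elim n)
    \<comment> \<open>This threshold balances the two terms: the moment is at most
      \<open>C / k n\<close>, and \<open>d powr (1 - r) / k n = d\<close>. Hence |char - 1| is of
      order k^(-1/r).\<close>
    define d where "d = k n powr (- (1 / r))"
    have d0: "d > 0" using elim by (simp add: d_def)
    have dr: "d powr (1 - r) / k n = d"
    proof -
      have "d powr (1 - r) / k n = k n powr (- (1 / r) * (1 - r)) * k n powr (- 1)"
        using elim unfolding d_def powr_powr by (simp add: powr_minus divide_inverse)
      also have "\<dots> = k n powr (- (1 / r) * (1 - r) + - 1)" by (simp only: powr_add)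
      also have "- (1 / r) * (1 - r) + - 1 = - (1 / r)" using r by (simp add: field_simps)
      finally show ?thesis by (simp add: d_def)
    qed
    have "d powr (1 - r) * (LINT y|\<mu> n. min 1 \<bar>y\<bar> powr r) \<le> d powr (1 - r) * (C / k n)"
      using elim by (intro mult_left_mono) (auto simp: field_simps)
    also have "\<dots> = C * (d powr (1 - r) / k n)" by simp
    also have "\<dots> = C * d" by (simp only: dr)
    finally have "d + d powr (1 - r) * (LINT y|\<mu> n. min 1 \<bar>y\<bar> powr r) \<le> (1 + C) * d"
      by (simp add: algebra_simps)
    then have "cmod (char (\<mu> n) t - 1) \<le> c * d"
      unfolding c_def mult.assoc
      by (intro order_trans[OF \<mu>.cmod_char_minus_1_le[OF r(1) d0]] mult_left_mono) auto
    then have "(cmod (char (\<mu> n) t - 1))\<^sup>2 \<le> (c * d)\<^sup>2" by (intro power_mono) auto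
    then have "k n * (cmod (char (\<mu> n) t - 1))\<^sup>2 \<le> k n * (c * d)\<^sup>2" using elim by (intro mult_left_mono) auto
    also have "\<dots> = c\<^sup>2 * (k n powr 1 * k n powr (- (2 / r)))"
      using elim by (simp add: d_def power_mult_distrib powr_power)
    also have "k n powr 1 * k n powr (- (2 / r)) = k n powr (1 - 2 / r)" by (simp only: powr_add[symmetric]) simp
    finally show ?case using elim by simp
  qed
  have "((\<lambda>x. x powr (1 - 2 / r)) \<longlongrightarrow> 0) at_top"
    using r by (intro tendsto_neg_powr filterlim_ident) (auto simp: field_simps)
  from filterlim_compose[OF this k] have "(\<lambda>n. c\<^sup>2 * k n powr (1 - 2 / r)) \<longlonglongrightarrow> 0"
    by (rule tendsto_mult_right_zero)
  then show ?thesis by (rule Lim_null_comparison[OF ev])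
qed

theorem tendsto_centred_char_power:
  fixes \<mu> :: "nat \<Rightarrow> real measure" and k :: "nat \<Rightarrow> nat"
  assumes \<mu>: "\<And>n. real_distribution (\<mu> n)" and k: "filterlim k at_top sequentially"
    and r: "1 \<le> r" "r < 2"
    and bound: "eventually (\<lambda>n. real (k n) * (LINT y|\<mu> n. min 1 \<bar>y\<bar> powr r) \<le> C) sequentially"
    and levy: "(\<lambda>n. of_nat (k n) * (CLINT y|\<mu> n. levy_integrand t y)) \<longlonglongrightarrow> l"
    and centre: "(\<lambda>n. real (k n) * (LINT y|\<mu> n. y / (1 + y\<^sup>2)) - b n) \<longlonglongrightarrow> \<eta>"
  shows "(\<lambda>n. char (\<mu> n) t ^ k n * iexp (- (t * b n))) \<longlonglongrightarrow> exp (\<i> * complex_of_real (\<eta> * t) + l)"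
proof -
  interpret \<mu>: real_distribution "\<mu> n" for n by fact
  define w where "w n = char (\<mu> n) t - 1" for n
  have w2: "cmod (w n) \<le> 2" for n
    using norm_triangle_ineq4[of "char (\<mu> n) t" 1] \<mu>.cmod_char_le_1[of n t] by (simp add: w_def)
  \<comment> \<open>This makes |exp(w)| at most 1, as \<open>norm_power_diff\<close> requires for
    comparing the two \<open>k n\<close>-th powers.\<close>
  have Rew: "Re (w n) \<le> 0" for n
    using complex_Re_le_cmod[of "char (\<mu> n) t"] \<mu>.cmod_char_le_1[of n t] by (simp add: w_def)
  have i1: "integrable (\<mu> n) (\<lambda>y. y / (1 + y\<^sup>2))" for n
    by (rule \<mu>.integrable_const_bound[where B=1]) (use abs_ratio_le_1 in auto)
  have L: "(CLINT y|\<mu> n. levy_integrand t y) = w n - \<i> * complex_of_real (t * (LINT y|\<mu> n. y / (1 + y\<^sup>2)))" for n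
  proof -
    have i2: "integrable (\<mu> n) (\<lambda>y. iexp (t * y))" by (rule \<mu>.integrable_const_bound[where B=1]) auto
    have i3: "integrable (\<mu> n) (\<lambda>y. \<i> * complex_of_real (t * y / (1 + y\<^sup>2)))"
      using integrable_mult_right[OF i1[of n], of t] by (intro integrable_mult_right integrable_of_real) simp
    have "(CLINT y|\<mu> n. levy_integrand t y) = (CLINT y|\<mu> n. iexp (t * y)) - 1 - (CLINT y|\<mu> n. \<i> * complex_of_real (t * y / (1 + y\<^sup>2)))"
      unfolding levy_integrand_def using i2 i3 \<mu>.prob_space[of n]
      by (subst Bochner_Integration.integral_diff, simp, simp, subst Bochner_Integration.integral_diff) (auto simp del: of_real_mult)
    also have "(CLINT y|\<mu> n. \<i> * complex_of_real (t * y / (1 + y\<^sup>2))) = \<i> * complex_of_real (LINT y|\<mu> n. t * (y / (1 + y\<^sup>2)))"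
      by (simp only: integral_mult_right_zero integral_complex_of_real times_divide_eq_right)
    also have "(LINT y|\<mu> n. t * (y / (1 + y\<^sup>2))) = t * (LINT y|\<mu> n. y / (1 + y\<^sup>2))"
      by (rule integral_mult_right_zero)
    finally show ?thesis by (simp add: w_def char_def)
  qed
  have eq: "of_nat (k n) * w n - \<i> * complex_of_real (t * b n) =
      of_nat (k n) * (CLINT y|\<mu> n. levy_integrand t y) +
      \<i> * complex_of_real ((real (k n) * (LINT y|\<mu> n. y / (1 + y\<^sup>2)) - b n) * t)" for n
    unfolding L by (simp add: algebra_simps)
  have "(\<lambda>n. of_nat (k n) * w n - \<i> * complex_of_real (t * b n)) \<longlonglongrightarrow> l + \<i> * complex_of_real (\<eta> * t)"
    unfolding eq by (intro tendsto_intros levy centre)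
  then have e: "(\<lambda>n. exp (of_nat (k n) * w n - \<i> * complex_of_real (t * b n))) \<longlonglongrightarrow> exp (\<i> * complex_of_real (\<eta> * t) + l)"
    by (subst add.commute) (rule tendsto_exp)
  have kr: "filterlim (\<lambda>n. real (k n)) at_top sequentially"
    using filterlim_compose[OF filterlim_real_sequentially k] .
  have z: "(\<lambda>n. exp 2 * (real (k n) * (cmod (w n))\<^sup>2)) \<longlonglongrightarrow> 0"
    unfolding w_def by (intro tendsto_mult_right_zero tendsto_mult_char_minus_1_square[OF \<mu> kr r bound])
  have "(\<lambda>n. char (\<mu> n) t ^ k n * iexp (- (t * b n)) - exp (of_nat (k n) * w n - \<i> * complex_of_real (t * b n))) \<longlonglongrightarrow> 0"
  proof (rule Lim_null_comparison[OF always_eventually z], intro allI)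
    fix n
    have "exp (of_nat (k n) * w n - \<i> * complex_of_real (t * b n)) = exp (w n) ^ k n * iexp (- (t * b n))"
      by (simp add: exp_of_nat_mult exp_diff exp_minus divide_inverse)
    then have "cmod (char (\<mu> n) t ^ k n * iexp (- (t * b n)) - exp (of_nat (k n) * w n - \<i> * complex_of_real (t * b n)))
        = cmod ((char (\<mu> n) t ^ k n - exp (w n) ^ k n) * iexp (- (t * b n)))"
      by (simp only: left_diff_distrib)
    also have "\<dots> = cmod (char (\<mu> n) t ^ k n - exp (w n) ^ k n)"
      by (simp only: norm_mult norm_exp_i_times mult_1_right)
    also have "\<dots> \<le> real (k n) * cmod (char (\<mu> n) t - exp (w n))"
      by (rule norm_power_diff) (auto simp: \<mu>.cmod_char_le_1 Rew)
    also have "\<dots> \<le> real (k n) * (exp 2 * (cmod (w n))\<^sup>2)"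
      using cmod_exp_minus_linear_le[OF w2[of n]] by (intro mult_left_mono) (auto simp: w_def)
    finally show "cmod (char (\<mu> n) t ^ k n * iexp (- (t * b n)) - exp (of_nat (k n) * w n - \<i> * complex_of_real (t * b n)))
        \<le> exp 2 * (real (k n) * (cmod (w n))\<^sup>2)" by (simp add: ac_simps)
  qed
  from tendsto_add[OF this e] show ?thesis by simp
qed

section \<open>Arrays indexed by the integers\<close>

lemma integrable_exp_minus_abs_int:
  assumes "d > (0::real)"
  shows "integrable (count_space (UNIV :: int set)) (\<lambda>i. exp (- d * \<bar>real_of_int i\<bar>))"
proof -
  have s: "Infinite_Set_Sum.abs_summable_on (\<lambda>n::nat. exp (- d * real n)) UNIV"
  proof -
    have "summable (\<lambda>n. exp (- d) ^ n)" using assms by (intro summable_geometric) auto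
    then have "summable (\<lambda>n::nat. norm (exp (- d * real n)))"
      by (simp only: exp_of_nat2_mult real_norm_def abs_of_nonneg[OF zero_le_power[OF exp_ge_zero]])
    then show ?thesis by (simp add: Infinite_Set_Sum.abs_summable_on_nat_iff')
  qed
  have "Infinite_Set_Sum.abs_summable_on (\<lambda>i. exp (- d * \<bar>real_of_int i\<bar>)) (range int)"
    using s by (subst Infinite_Set_Sum.abs_summable_on_reindex_iff[symmetric]) auto
  moreover have "Infinite_Set_Sum.abs_summable_on (\<lambda>i. exp (- d * \<bar>real_of_int i\<bar>)) (range (\<lambda>n. - int n))"
    using s by (subst Infinite_Set_Sum.abs_summable_on_reindex_iff[symmetric]) (auto simp: inj_def)
  ultimately have "Infinite_Set_Sum.abs_summable_on (\<lambda>i. exp (- d * \<bar>real_of_int i\<bar>)) (range int \<union> range (\<lambda>n. - int n))"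
    by (rule Infinite_Set_Sum.abs_summable_on_union)
  also have "range int \<union> range (\<lambda>n. - int n) = UNIV"
    by (auto simp: image_def) (metis int_cases2)
  finally show ?thesis by (simp add: Infinite_Set_Sum.abs_summable_on_def)
qed

text \<open>Even indices carry the positive atoms and odd ones the negative atoms, so this split
  produces the two separate Levy integrals and tails.\<close>

lemma integral_int_even_odd:
  fixes f :: "int \<Rightarrow> 'b :: {banach, second_countable_topology}"
  assumes f: "integrable (count_space UNIV) f"
  shows "integrable (count_space UNIV) (\<lambda>j. f (2 * j))" "integrable (count_space UNIV) (\<lambda>j. f (2 * j + 1))"
    "(\<integral>i. f i \<partial>count_space UNIV) = (\<integral>j. f (2 * j) \<partial>count_space UNIV) + (\<integral>j. f (2 * j + 1) \<partial>count_space UNIV)"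
proof -
  let ?E = "range (\<lambda>j::int. 2 * j)" and ?O = "range (\<lambda>j::int. 2 * j + 1)"
  have inj: "inj (\<lambda>j::int. 2 * j)" "inj (\<lambda>j::int. 2 * j + 1)" by (auto simp: inj_def)
  have "i = 2 * (i div 2) \<or> i = 2 * (i div 2) + 1" for i :: int by presburger
  then have "i \<in> ?E \<union> ?O" for i by (metis UnCI rangeI)
  then have U: "?E \<union> ?O = UNIV" by auto
  have "2 * i \<noteq> 2 * j + 1" for i j :: int by presburger
  then have dis: "?E \<inter> ?O = {}" by auto
  have s: "Infinite_Set_Sum.abs_summable_on f UNIV" using f unfolding Infinite_Set_Sum.abs_summable_on_def .
  have sE: "Infinite_Set_Sum.abs_summable_on f ?E" and sO: "Infinite_Set_Sum.abs_summable_on f ?O"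
    by (rule Infinite_Set_Sum.abs_summable_on_subset[OF s], simp)+
  show "integrable (count_space UNIV) (\<lambda>j. f (2 * j))" "integrable (count_space UNIV) (\<lambda>j. f (2 * j + 1))"
    using iffD2[OF Infinite_Set_Sum.abs_summable_on_reindex_iff[OF inj(1)] sE]
      iffD2[OF Infinite_Set_Sum.abs_summable_on_reindex_iff[OF inj(2)] sO]
    unfolding Infinite_Set_Sum.abs_summable_on_def .
  have "infsetsum f UNIV = infsetsum f ?E + infsetsum f ?O"
    using infsetsum_Un_disjoint[OF sE sO dis] unfolding U .
  also have "infsetsum f ?E = infsetsum (\<lambda>j. f (2 * j)) UNIV"
    by (rule infsetsum_reindex[OF inj(1)])
  also have "infsetsum f ?O = infsetsum (\<lambda>j. f (2 * j + 1)) UNIV"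
    by (rule infsetsum_reindex[OF inj(2)])
  finally show "(\<integral>i. f i \<partial>count_space UNIV) = (\<integral>j. f (2 * j) \<partial>count_space UNIV) + (\<integral>j. f (2 * j + 1) \<partial>count_space UNIV)"
    unfolding infsetsum_def .
qed

lemma (in prob_space) expectation_int_valued:
  fixes g :: "int \<Rightarrow> 'b :: {banach, second_countable_topology}"
  assumes [measurable]: "J \<in> measurable M (count_space UNIV)"
  shows "(\<integral>\<omega>. g (J \<omega>) \<partial>M) = (\<integral>i. prob {\<omega> \<in> space M. J \<omega> = i} *\<^sub>R g i \<partial>count_space UNIV)"
proof -
  have distr: "distr M (count_space UNIV) J = density (count_space UNIV) (\<lambda>i. ennreal (prob {\<omega> \<in> space M. J \<omega> = i}))"
  proof (rule measure_eqI_countable[where A=UNIV])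
    fix i :: int
    have "emeasure (density (count_space UNIV) (\<lambda>i. ennreal (prob {\<omega> \<in> space M. J \<omega> = i}))) {i}
        = (\<integral>\<^sup>+x. ennreal (prob {\<omega> \<in> space M. J \<omega> = x}) * indicator {i} x \<partial>count_space UNIV)"
      by (rule emeasure_density) auto
    also have "\<dots> = ennreal (prob {\<omega> \<in> space M. J \<omega> = i})"
      by (subst nn_integral_indicator_singleton) auto
    also have "\<dots> = emeasure (distr M (count_space UNIV) J) {i}"
    proof -
      have "J -` {i} \<inter> space M = {\<omega> \<in> space M. J \<omega> = i}" by auto
      then show ?thesis by (simp add: emeasure_distr emeasure_eq_measure)
    qed
    finally show "emeasure (distr M (count_space UNIV) J) {i} =
        emeasure (density (count_space UNIV) (\<lambda>i. ennreal (prob {\<omega> \<in> space M. J \<omega> = i}))) {i}" ..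
  qed auto
  have "(\<integral>\<omega>. g (J \<omega>) \<partial>M) = (\<integral>i. g i \<partial>distr M (count_space UNIV) J)"
    by (rule integral_distr[symmetric]) auto
  also have "\<dots> = (\<integral>i. prob {\<omega> \<in> space M. J \<omega> = i} *\<^sub>R g i \<partial>count_space UNIV)"
    unfolding distr by (rule integral_density) auto
  finally show ?thesis .
qed

text \<open>\<open>J n\<close> stands for \<open>W - 2 n\<close>, \<open>y n i\<close> for the
  rescaled value of X at \<open>W = 2 n + i\<close>, and \<open>b\<close>, \<open>z\<close> for the
  limiting weights and atoms. By \<open>dom\<close>, test functions that are continuous at all the
  atoms and bounded by a multiple of min(1, |x|)^r pass to the limit.\<close>

locale int_array = prob_space P for P :: "'a measure" +
  fixes J :: "nat \<Rightarrow> 'a \<Rightarrow> int" and k :: "nat \<Rightarrow> nat" and y :: "nat \<Rightarrow> int \<Rightarrow> real"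
    and b z :: "int \<Rightarrow> real" and r C d :: real
  assumes J_meas [measurable]: "\<And>n. J n \<in> measurable P (count_space UNIV)"
    and k_at_top: "filterlim k at_top sequentially"
    and weight_conv: "\<And>i. (\<lambda>n. real (k n) * prob {\<omega> \<in> space P. J n \<omega> = i}) \<longlonglongrightarrow> b i"
    and y_conv: "\<And>i. (\<lambda>n. y n i) \<longlonglongrightarrow> z i"
    and r: "1 \<le> r" "r < 2" and d: "d > 0"
    and dom: "eventually (\<lambda>n. \<forall>i. real (k n) * prob {\<omega> \<in> space P. J n \<omega> = i} * min 1 \<bar>y n i\<bar> powr r
        \<le> C * exp (- d * \<bar>real_of_int i\<bar>)) sequentially"
begin

definition \<mu> :: "nat \<Rightarrow> real measure" where
  "\<mu> n = distr P borel (\<lambda>\<omega>. y n (J n \<omega>))"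

lemma y_J_meas [measurable]: "(\<lambda>\<omega>. y n (J n \<omega>)) \<in> borel_measurable P"
  by (rule measurable_compose[OF J_meas]) simp

lemma real_distribution_\<mu>: "real_distribution (\<mu> n)"
  unfolding \<mu>_def by (rule real_distribution_distr) simp

lemma mult_integral_\<mu>:
  fixes f :: "real \<Rightarrow> 'b :: {banach, second_countable_topology}"
  assumes [measurable]: "f \<in> borel_measurable borel"
  shows "real (k n) *\<^sub>R (\<integral>x. f x \<partial>\<mu> n) =
    (\<integral>i. (real (k n) * prob {\<omega> \<in> space P. J n \<omega> = i}) *\<^sub>R f (y n i) \<partial>count_space UNIV)"
  unfolding \<mu>_def
  by (subst integral_distr, simp, simp, subst expectation_int_valued[where g="\<lambda>i. f (y n i)"], simp)
     (simp flip: integral_scaleR_right)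

lemma limit_weight_bound: "b i * min 1 \<bar>z i\<bar> powr r \<le> C * exp (- d * \<bar>real_of_int i\<bar>)"
proof (rule tendsto_upperbound)
  show "(\<lambda>n. real (k n) * prob {\<omega> \<in> space P. J n \<omega> = i} * min 1 \<bar>y n i\<bar> powr r) \<longlonglongrightarrow> b i * min 1 \<bar>z i\<bar> powr r"
    using r by (intro tendsto_intros weight_conv y_conv) auto
  show "eventually (\<lambda>n. real (k n) * prob {\<omega> \<in> space P. J n \<omega> = i} * min 1 \<bar>y n i\<bar> powr r
      \<le> C * exp (- d * \<bar>real_of_int i\<bar>)) sequentially"
    using dom by eventually_elim auto
qed simp

lemma limit_weight_nonneg: "b i \<ge> 0"
  by (rule tendsto_lowerbound[OF weight_conv]) auto

lemma C_nonneg: "C \<ge> 0"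
proof -
  have "0 \<le> C * exp (- d * \<bar>real_of_int 0\<bar>)"
    by (rule order_trans[OF _ limit_weight_bound]) (intro mult_nonneg_nonneg limit_weight_nonneg powr_ge_zero)
  then show ?thesis by simp
qed

lemma integrable_dominating: "integrable (count_space UNIV) (\<lambda>i. K * (C * exp (- d * \<bar>real_of_int i\<bar>)))"
  by (intro integrable_mult_right integrable_exp_minus_abs_int d)

lemma integrable_limit:
  fixes f :: "real \<Rightarrow> 'b :: {banach, second_countable_topology}"
  assumes f: "\<And>x. norm (f x) \<le> K * min 1 \<bar>x\<bar> powr r" and K: "K \<ge> 0"
  shows "integrable (count_space UNIV) (\<lambda>i. b i *\<^sub>R f (z i))"
    and "norm (b i *\<^sub>R f (z i)) \<le> K * (C * exp (- d * \<bar>real_of_int i\<bar>))"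
proof -
  show n: "norm (b i *\<^sub>R f (z i)) \<le> K * (C * exp (- d * \<bar>real_of_int i\<bar>))" for i
  proof -
    have "norm (b i *\<^sub>R f (z i)) \<le> b i * (K * min 1 \<bar>z i\<bar> powr r)"
      using f limit_weight_nonneg by (simp add: mult_left_mono)
    also have "\<dots> = K * (b i * min 1 \<bar>z i\<bar> powr r)" by simp
    also have "\<dots> \<le> K * (C * exp (- d * \<bar>real_of_int i\<bar>))"
      using limit_weight_bound K by (intro mult_left_mono)
    finally show ?thesis .
  qed
  show "integrable (count_space UNIV) (\<lambda>i. b i *\<^sub>R f (z i))"
  proof (rule Bochner_Integration.integrable_bound[OF integrable_dominating[of K]])
    show "AE i in count_space UNIV. norm (b i *\<^sub>R f (z i)) \<le> norm (K * (C * exp (- d * \<bar>real_of_int i\<bar>)))"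
      unfolding real_norm_def by (intro AE_I2 order_trans[OF n abs_ge_self])
  qed simp
qed

lemma tendsto_mult_integral:
  fixes f :: "real \<Rightarrow> 'b :: {banach, second_countable_topology}"
  assumes [measurable]: "f \<in> borel_measurable borel"
    and f: "\<And>x. norm (f x) \<le> K * min 1 \<bar>x\<bar> powr r" and K: "K \<ge> 0"
    and cont: "\<And>i. isCont f (z i)"
  shows "(\<lambda>n. real (k n) *\<^sub>R (\<integral>x. f x \<partial>\<mu> n)) \<longlonglongrightarrow> (\<integral>i. b i *\<^sub>R f (z i) \<partial>count_space UNIV)"
proof -
  let ?a = "\<lambda>n i. real (k n) * prob {\<omega> \<in> space P. J n \<omega> = i}"
  obtain n0 where n0: "\<And>n i. n \<ge> n0 \<Longrightarrow> ?a n i * min 1 \<bar>y n i\<bar> powr r \<le> C * exp (- d * \<bar>real_of_int i\<bar>)"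
    using dom unfolding eventually_sequentially by blast
  have "(\<lambda>n. \<integral>i. ?a (n + n0) i *\<^sub>R f (y (n + n0) i) \<partial>count_space UNIV) \<longlonglongrightarrow> (\<integral>i. b i *\<^sub>R f (z i) \<partial>count_space UNIV)"
  proof (rule integral_dominated_convergence[OF _ _ integrable_dominating[of K]])
    show "AE i in count_space UNIV. (\<lambda>n. ?a (n + n0) i *\<^sub>R f (y (n + n0) i)) \<longlonglongrightarrow> b i *\<^sub>R f (z i)"
      by (intro AE_I2 tendsto_scaleR isCont_tendsto_compose[OF cont]
            LIMSEQ_ignore_initial_segment[OF weight_conv] LIMSEQ_ignore_initial_segment[OF y_conv])
    show "AE i in count_space UNIV. norm (?a (n + n0) i *\<^sub>R f (y (n + n0) i)) \<le> K * (C * exp (- d * \<bar>real_of_int i\<bar>))" for n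
    proof (intro AE_I2)
      fix i
      have "norm (?a (n + n0) i *\<^sub>R f (y (n + n0) i)) \<le> ?a (n + n0) i * (K * min 1 \<bar>y (n + n0) i\<bar> powr r)"
        using f by (simp add: mult_left_mono)
      also have "\<dots> = K * (?a (n + n0) i * min 1 \<bar>y (n + n0) i\<bar> powr r)" by simp
      also have "\<dots> \<le> K * (C * exp (- d * \<bar>real_of_int i\<bar>))"
        using n0[of "n + n0" i] K by (intro mult_left_mono) auto
      finally show "norm (?a (n + n0) i *\<^sub>R f (y (n + n0) i)) \<le> K * (C * exp (- d * \<bar>real_of_int i\<bar>))" .
    qed
  qed auto
  then have "(\<lambda>n. \<integral>i. ?a n i *\<^sub>R f (y n i) \<partial>count_space UNIV) \<longlonglongrightarrow> (\<integral>i. b i *\<^sub>R f (z i) \<partial>count_space UNIV)"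
    by (rule LIMSEQ_offset)
  then show ?thesis by (simp add: mult_integral_\<mu>)
qed

lemma moment_bound:
  "eventually (\<lambda>n. real (k n) * (LINT x|\<mu> n. min 1 \<bar>x\<bar> powr r)
      \<le> (\<integral>i. C * exp (- d * \<bar>real_of_int i\<bar>) \<partial>count_space (UNIV :: int set))) sequentially"
  using dom
proof eventually_elim
  case (elim n)
  have "real (k n) * (LINT x|\<mu> n. min 1 \<bar>x\<bar> powr r) =
      (\<integral>i. (real (k n) * prob {\<omega> \<in> space P. J n \<omega> = i}) * min 1 \<bar>y n i\<bar> powr r \<partial>count_space UNIV)"
    using mult_integral_\<mu>[of "\<lambda>x. min 1 \<bar>x\<bar> powr r" n] by simp
  also have "\<dots> \<le> (\<integral>i. C * exp (- d * \<bar>real_of_int i\<bar>) \<partial>count_space (UNIV :: int set))"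
    by (rule integral_mono')
       (use integrable_dominating[of 1] elim C_nonneg in auto)
  finally show ?case .
qed

text \<open>A set that keeps distance |x0| > 0 from the origin is an admissible test set, although
  \<open>k n\<close> times the law may have exploding mass near 0.\<close>

lemma norm_indicator_le:
  assumes A: "\<And>x. x \<in> A \<Longrightarrow> \<bar>x0\<bar> \<le> \<bar>x\<bar>" and "x0 \<noteq> 0"
  shows "norm (indicat_real A x) \<le> (1 / min 1 \<bar>x0\<bar> powr r) * min 1 \<bar>x\<bar> powr r"
proof (cases "x \<in> A")
  case True
  have "min 1 \<bar>x0\<bar> powr r \<le> min 1 \<bar>x\<bar> powr r" using A[OF True] r by (intro powr_mono2) auto
  moreover have "min 1 \<bar>x0\<bar> powr r > 0" using assms by simp
  ultimately show ?thesis using True by (simp add: field_simps)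
qed simp

lemma tendsto_mult_measure:
  assumes "A \<in> sets borel" "\<And>x. x \<in> A \<Longrightarrow> \<bar>x0\<bar> \<le> \<bar>x\<bar>" "x0 \<noteq> 0" "\<And>i. z i \<notin> frontier A"
  shows "(\<lambda>n. real (k n) * measure (\<mu> n) A) \<longlonglongrightarrow> (\<integral>i. b i * indicator A (z i) \<partial>count_space UNIV)"
proof -
  interpret \<mu>: real_distribution "\<mu> n" for n by (rule real_distribution_\<mu>)
  show ?thesis
    using tendsto_mult_integral[of "indicat_real A", OF _ norm_indicator_le[OF assms(2,3)]] assms
    by (simp add: isCont_indicator)
qed

lemma levy_integrand_bound: "norm (levy_integrand t x) \<le> (2 + 3 * \<bar>t\<bar> + t\<^sup>2) * min 1 \<bar>x\<bar> powr r"
proof -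
  have "min 1 (x\<^sup>2) = min 1 \<bar>x\<bar> powr 2"
  proof (cases "\<bar>x\<bar> \<le> 1")
    case True
    then have "x\<^sup>2 \<le> 1" by (simp add: abs_square_le_1)
    with True show ?thesis by (cases "x = 0") auto
  next
    case False
    then have "\<not> x\<^sup>2 \<le> 1" by (simp add: abs_square_le_1)
    with False show ?thesis by simp
  qed
  also have "\<dots> \<le> min 1 \<bar>x\<bar> powr r" using r by (intro powr_mono') auto
  finally have "(2 + 3 * \<bar>t\<bar> + t\<^sup>2) * min 1 (x\<^sup>2) \<le> (2 + 3 * \<bar>t\<bar> + t\<^sup>2) * min 1 \<bar>x\<bar> powr r"
    by (intro mult_left_mono) (auto intro: add_nonneg_nonneg)
  with norm_levy_integrand_le[of t x] show ?thesis by linarith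
qed

lemma integrable_levy: "integrable (count_space UNIV) (\<lambda>i. b i *\<^sub>R levy_integrand t (z i))"
  by (rule integrable_limit(1)[OF levy_integrand_bound]) (auto intro: add_nonneg_nonneg)

lemma tendsto_levy:
  "(\<lambda>n. of_nat (k n) * (CLINT x|\<mu> n. levy_integrand t x)) \<longlonglongrightarrow> (\<integral>i. b i *\<^sub>R levy_integrand t (z i) \<partial>count_space UNIV)"
proof -
  have "1 + x\<^sup>2 \<noteq> 0" for x :: real using zero_le_power2[of x] by linarith
  then have "isCont (levy_integrand t) x" for x
    unfolding levy_integrand_def by (intro continuous_intros) auto
  from tendsto_mult_integral[OF measurable_levy_integrand levy_integrand_bound _ this]
  show ?thesis by (auto simp: scaleR_conv_of_real intro: add_nonneg_nonneg)
qed

text \<open>Continuity at 0 is what \<open>levy_continuity_exists\<close> demands. Along a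
  convergent sequence the arguments stay below some \<open>K\<close>, which makes the quadratic
  factor of the majorant uniform.\<close>

lemma isCont_levy_exponent: "isCont (\<lambda>t. \<integral>i. b i *\<^sub>R levy_integrand t (z i) \<partial>count_space UNIV) 0"
  unfolding continuous_at_sequentially comp_def
proof (intro allI impI)
  fix t :: "nat \<Rightarrow> real" assume t: "t \<longlonglongrightarrow> 0"
  then obtain K where K: "\<And>n. \<bar>t n\<bar> \<le> K" "K > 0"
    using convergent_imp_Bseq[of t] by (auto simp: convergent_def Bseq_def)
  show "(\<lambda>n. \<integral>i. b i *\<^sub>R levy_integrand (t n) (z i) \<partial>count_space UNIV)
      \<longlonglongrightarrow> (\<integral>i. b i *\<^sub>R levy_integrand 0 (z i) \<partial>count_space UNIV)"
  proof (rule integral_dominated_convergence[OF _ _ integrable_dominating[of "2 + 3 * K + K\<^sup>2"]])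
    show "AE i in count_space UNIV. (\<lambda>n. b i *\<^sub>R levy_integrand (t n) (z i)) \<longlonglongrightarrow> b i *\<^sub>R levy_integrand 0 (z i)"
    proof (intro AE_I2)
      fix i
      have "1 + (z i)\<^sup>2 \<noteq> 0" using zero_le_power2[of "z i"] by linarith
      then show "(\<lambda>n. b i *\<^sub>R levy_integrand (t n) (z i)) \<longlonglongrightarrow> b i *\<^sub>R levy_integrand 0 (z i)"
        unfolding levy_integrand_def by (intro tendsto_intros t) auto
    qed
    show "AE i in count_space UNIV. norm (b i *\<^sub>R levy_integrand (t n) (z i))
        \<le> (2 + 3 * K + K\<^sup>2) * (C * exp (- d * \<bar>real_of_int i\<bar>))" for n
    proof (intro AE_I2 integrable_limit(2))
      fix x
      have "(t n)\<^sup>2 \<le> K\<^sup>2" using K by (simp add: abs_le_square_iff[symmetric])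
      then have "2 + 3 * \<bar>t n\<bar> + (t n)\<^sup>2 \<le> 2 + 3 * K + K\<^sup>2" using K(1)[of n] by linarith
      then show "norm (levy_integrand (t n) x) \<le> (2 + 3 * K + K\<^sup>2) * min 1 \<bar>x\<bar> powr r"
        by (intro order_trans[OF levy_integrand_bound] mult_right_mono) auto
    qed (use K in \<open>auto intro: add_nonneg_nonneg\<close>)
  qed auto
qed

end

section \<open>The atomic Levy measures\<close>

text \<open>The difference of consecutive terms of j -> c exp(-\<nu> j). For \<nu> > 0 the half-line
  \<open>{m..}\<close> thus carries mass c exp(-\<nu> m), and the total mass over all integers is
  infinite when c > 0.\<close>

definition geom_weight :: "real \<Rightarrow> real \<Rightarrow> int \<Rightarrow> real" where
  "geom_weight c \<nu> j = c * exp (- \<nu> * of_int j) * (1 - exp (- \<nu>))"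

definition geom_int :: "real \<Rightarrow> real \<Rightarrow> int measure" where
  "geom_int c \<nu> = density (count_space UNIV) (\<lambda>j. ennreal (geom_weight c \<nu> j))"

context
  fixes c \<nu> :: real
  assumes c: "c \<ge> 0" and \<nu>: "\<nu> > 0"
begin

lemma geom_weight_nonneg: "geom_weight c \<nu> j \<ge> 0"
  using c \<nu> by (simp add: geom_weight_def)

lemma sets_geom_int [measurable_cong]: "sets (geom_int c \<nu>) = sets (count_space UNIV)"
  by (simp add: geom_int_def)

lemma emeasure_geom_int_atLeast: "emeasure (geom_int c \<nu>) {m..} = ennreal (c * exp (- \<nu> * of_int m))"
proof -
  have bij: "bij_betw (\<lambda>n. m + int n) UNIV {m..}"
    by (rule bij_betwI[where g="\<lambda>j. nat (j - m)"]) auto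
  have "emeasure (geom_int c \<nu>) {m..} = (\<integral>\<^sup>+j. ennreal (geom_weight c \<nu> j) * indicator {m..} j \<partial>count_space UNIV)"
    unfolding geom_int_def by (rule emeasure_density) auto
  also have "\<dots> = (\<integral>\<^sup>+j. ennreal (geom_weight c \<nu> j) \<partial>count_space {m..})"
    by (subst nn_integral_count_space_indicator) auto
  also have "\<dots> = (\<integral>\<^sup>+n. ennreal (geom_weight c \<nu> (m + int n)) \<partial>count_space UNIV)"
    by (rule nn_integral_bij_count_space[OF bij, symmetric])
  also have "\<dots> = (\<Sum>n. ennreal (geom_weight c \<nu> (m + int n)))"
    by (rule nn_integral_count_space_nat)
  also have "\<dots> = ennreal (c * exp (- \<nu> * of_int m))"
  proof (rule suminf_ennreal_eq[OF geom_weight_nonneg])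
    have "(\<lambda>n. exp (- \<nu>) ^ n) sums (1 / (1 - exp (- \<nu>)))"
      using \<nu> by (intro geometric_sums) simp
    then have "(\<lambda>n. c * exp (- \<nu> * of_int m) * (1 - exp (- \<nu>)) * exp (- \<nu>) ^ n) sums
        (c * exp (- \<nu> * of_int m) * (1 - exp (- \<nu>)) * (1 / (1 - exp (- \<nu>))))"
      by (rule sums_mult)
    moreover have "c * exp (- \<nu> * of_int m) * (1 - exp (- \<nu>)) * (1 / (1 - exp (- \<nu>))) = c * exp (- \<nu> * of_int m)"
      using \<nu> by simp
    moreover have "c * exp (- \<nu> * of_int m) * (1 - exp (- \<nu>)) * exp (- \<nu>) ^ n = geom_weight c \<nu> (m + int n)" for n
    proof -
      have "exp (- \<nu> * of_int (m + int n)) = exp (- \<nu> * of_int m) * exp (- \<nu>) ^ n"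
        by (simp only: exp_of_nat2_mult[symmetric] exp_add[symmetric]) (simp add: algebra_simps)
      then show ?thesis by (simp add: geom_weight_def)
    qed
    ultimately show "(\<lambda>n. geom_weight c \<nu> (m + int n)) sums (c * exp (- \<nu> * of_int m))" by simp
  qed
  finally show ?thesis .
qed

lemma emeasure_geom_int_Diff:
  assumes "m \<le> m'"
  shows "emeasure (geom_int c \<nu>) ({m..} - {m'..}) = ennreal (c * exp (- \<nu> * of_int m) - c * exp (- \<nu> * of_int m'))"
  using assms c by (subst emeasure_Diff) (auto simp: emeasure_geom_int_atLeast sets_geom_int ennreal_minus)

lemma integral_geom_int:
  fixes f :: "int \<Rightarrow> 'b :: {banach, second_countable_topology}"
  shows "integral\<^sup>L (geom_int c \<nu>) f = (\<integral>j. geom_weight c \<nu> j *\<^sub>R f j \<partial>count_space UNIV)"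
  unfolding geom_int_def by (rule integral_density) (auto simp: geom_weight_nonneg)

lemma integrable_geom_int:
  fixes f :: "int \<Rightarrow> 'b :: {banach, second_countable_topology}"
  shows "integrable (geom_int c \<nu>) f \<longleftrightarrow> integrable (count_space UNIV) (\<lambda>j. geom_weight c \<nu> j *\<^sub>R f j)"
  unfolding geom_int_def by (rule integrable_density) (auto simp: geom_weight_nonneg)

lemma integral_distr_geom_int:
  fixes f :: "real \<Rightarrow> 'b :: {banach, second_countable_topology}"
  assumes [measurable]: "f \<in> borel_measurable borel"
  shows "integral\<^sup>L (distr (geom_int c \<nu>) borel z) f = (\<integral>j. geom_weight c \<nu> j *\<^sub>R f (z j) \<partial>count_space UNIV)"
    and "integrable (distr (geom_int c \<nu>) borel z) f \<longleftrightarrow>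
      integrable (count_space UNIV) (\<lambda>j. geom_weight c \<nu> j *\<^sub>R f (z j))"
  by (subst integral_distr, simp, simp, rule integral_geom_int)
     (subst integrable_distr_eq, simp, simp, rule integrable_geom_int)

lemma integral_geom_weight_atLeast:
  "(\<integral>j. geom_weight c \<nu> j * indicator {m..} j \<partial>count_space UNIV) = c * exp (- \<nu> * of_int m)"
proof -
  have "(\<integral>j. geom_weight c \<nu> j * indicator {m..} j \<partial>count_space UNIV) = measure (geom_int c \<nu>) {m..}"
    using integral_geom_int[of "indicat_real {m..}"] by (simp add: geom_int_def)
  also have "\<dots> = c * exp (- \<nu> * of_int m)"
    using c by (simp add: measure_def emeasure_geom_int_atLeast)
  finally show ?thesis .
qed

end

lemma rlim_eq_if_eventually:
  assumes "eventually (\<lambda>y. F y = l) (at_right x)"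
  shows "rlim F x = l"
  unfolding rlim_def by (rule tendsto_Lim[OF _ tendsto_eventually[OF assms]]) simp

context
  fixes c \<nu> \<beta> :: real
  assumes \<nu>: "\<nu> > 0" and \<beta>: "\<beta> > 0"
begin

text \<open>With u = ln |x| / (2 \<beta>), the factor |x|^\<alpha> equals exp(\<nu> u) and cancels
  the u in the exponent of \<open>M_left\<close>. What remains is a step function that jumps exactly
  at the atoms.\<close>

lemma LambdaL_M_left:
  assumes "x < 0"
  shows "LambdaL (\<nu> / (2 * \<beta>)) (M_left c \<nu> \<beta>) x = c * exp (- \<nu> * of_int \<lfloor>1 / 2 + ln (- x) / (2 * \<beta>)\<rfloor>)"
proof -
  have "\<bar>x\<bar> powr (\<nu> / (2 * \<beta>)) = exp (\<nu> * (ln (- x) / (2 * \<beta>)))"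
    using assms by (simp add: powr_def)
  moreover have "exp (- \<nu> * (m - u)) / exp (\<nu> * u) = exp (- \<nu> * m)" for m u
    by (simp only: exp_diff[symmetric]) (simp add: algebra_simps)
  ultimately show ?thesis
    by (simp only: LambdaL_def M_left_def Let_def times_divide_eq_right[symmetric])
qed

lemma LambdaR_M_right:
  assumes "x > 0"
  shows "LambdaR (\<nu> / (2 * \<beta>)) (M_right \<nu> \<beta>) x = - exp (- \<nu> * of_int (\<lfloor>ln x / (2 * \<beta>)\<rfloor> + 1))"
proof -
  have "x powr (\<nu> / (2 * \<beta>)) = exp (\<nu> * (ln x / (2 * \<beta>)))"
    using assms by (simp add: powr_def)
  then show ?thesis
    by (simp add: LambdaR_def M_right_def ceil_plus_def exp_diff[symmetric]) (simp add: algebra_simps)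
qed

lemma left_atom_le_iff:
  assumes "x < 0"
  shows "- exp (\<beta> * of_int (2 * j + 1)) \<le> x \<longleftrightarrow> \<lceil>ln (- x) / (2 * \<beta>) - 1 / 2\<rceil> \<le> j"
proof -
  have "- exp (\<beta> * of_int (2 * j + 1)) \<le> x \<longleftrightarrow> ln (- x) \<le> \<beta> * of_int (2 * j + 1)"
    using assms ln_le_cancel_iff[of "- x" "exp (\<beta> * of_int (2 * j + 1))"] by auto
  also have "\<dots> \<longleftrightarrow> ln (- x) / (2 * \<beta>) - 1 / 2 \<le> of_int j" using \<beta> by (simp add: field_simps)
  finally show ?thesis by (simp add: ceiling_le_iff)
qed

lemma right_atom_gt_iff:
  assumes "x > 0"
  shows "x < exp (\<beta> * of_int (2 * j)) \<longleftrightarrow> \<lfloor>ln x / (2 * \<beta>)\<rfloor> + 1 \<le> j"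
proof -
  have "x < exp (\<beta> * of_int (2 * j)) \<longleftrightarrow> ln x < \<beta> * of_int (2 * j)"
    using assms ln_less_cancel_iff[of x "exp (\<beta> * of_int (2 * j))"] by auto
  also have "\<dots> \<longleftrightarrow> ln x / (2 * \<beta>) < of_int j" using \<beta> by (simp add: field_simps)
  also have "\<dots> \<longleftrightarrow> \<lfloor>ln x / (2 * \<beta>)\<rfloor> < j" by (simp add: floor_less_iff)
  finally show ?thesis by linarith
qed

lemma right_atom_ge_iff:
  assumes "x > 0"
  shows "x \<le> exp (\<beta> * of_int (2 * j)) \<longleftrightarrow> \<lceil>ln x / (2 * \<beta>)\<rceil> \<le> j"
proof -
  have "x \<le> exp (\<beta> * of_int (2 * j)) \<longleftrightarrow> ln x \<le> \<beta> * of_int (2 * j)"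
    using assms ln_le_cancel_iff[of x "exp (\<beta> * of_int (2 * j))"] by auto
  also have "\<dots> \<longleftrightarrow> ln x / (2 * \<beta>) \<le> of_int j" using \<beta> by (simp add: field_simps)
  finally show ?thesis by (simp add: ceiling_le_iff)
qed

text \<open>At an atom -exp(\<beta> (2m + 1)) the floor equals m + 1, but immediately to the right
  |x| is smaller and the floor is m. The right limit replaces the floor by a ceiling, which agrees
  with it away from the atoms.\<close>

lemma rlim_LambdaL:
  assumes x: "x < 0"
  shows "rlim (LambdaL (\<nu> / (2 * \<beta>)) (M_left c \<nu> \<beta>)) x = c * exp (- \<nu> * of_int \<lceil>ln (- x) / (2 * \<beta>) - 1 / 2\<rceil>)"
proof (rule rlim_eq_if_eventually)
  define v where "v y = ln (- y) / (2 * \<beta>)" for y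
  define m where "m = \<lceil>v x - 1 / 2\<rceil>"
  have m: "of_int m - 1 < v x - 1 / 2" "v x - 1 / 2 \<le> of_int m" unfolding m_def by linarith+
  have "(v \<longlongrightarrow> v x) (at_right x)"
    unfolding v_def using x \<beta> by (intro tendsto_intros) auto
  then have "eventually (\<lambda>y. of_int m - 1 / 2 < v y) (at_right x)" using m by (intro order_tendstoD) auto
  moreover have "eventually (\<lambda>y. y \<in> {x<..<0}) (at_right x)" using x by (rule eventually_at_right_real)
  ultimately show "eventually (\<lambda>y. LambdaL (\<nu> / (2 * \<beta>)) (M_left c \<nu> \<beta>) y =
      c * exp (- \<nu> * of_int \<lceil>ln (- x) / (2 * \<beta>) - 1 / 2\<rceil>)) (at_right x)"
  proof eventually_elim
    case (elim y)
    have "v y < v x" using elim x \<beta> by (simp add: v_def divide_strict_right_mono)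
    then have "\<lfloor>1 / 2 + v y\<rfloor> = m" using elim m by (intro floor_unique) auto
    then show ?case using elim by (simp add: LambdaL_M_left v_def m_def)
  qed
qed

text \<open>The floor of an increasing continuous function is right-continuous, so on this side the
  right limit is the value itself.\<close>

lemma rlim_LambdaR:
  assumes x: "x > 0"
  shows "rlim (LambdaR (\<nu> / (2 * \<beta>)) (M_right \<nu> \<beta>)) x = - exp (- \<nu> * of_int (\<lfloor>ln x / (2 * \<beta>)\<rfloor> + 1))"
proof (rule rlim_eq_if_eventually)
  define v where "v y = ln y / (2 * \<beta>)" for y
  have "(v \<longlongrightarrow> v x) (at_right x)"
    unfolding v_def using x \<beta> by (intro tendsto_intros) auto
  then have "eventually (\<lambda>y. v y < of_int \<lfloor>v x\<rfloor> + 1) (at_right x)" by (rule order_tendstoD(2)) linarith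
  moreover have "eventually (\<lambda>y. y \<in> {x<..<x + 1}) (at_right x)" by (rule eventually_at_right_real) simp
  ultimately show "eventually (\<lambda>y. LambdaR (\<nu> / (2 * \<beta>)) (M_right \<nu> \<beta>) y =
      - exp (- \<nu> * of_int (\<lfloor>ln x / (2 * \<beta>)\<rfloor> + 1))) (at_right x)"
  proof eventually_elim
    case (elim y)
    have "v x \<le> v y" using elim x \<beta> by (simp add: v_def divide_right_mono)
    then have "\<lfloor>v y\<rfloor> = \<lfloor>v x\<rfloor>" using elim by (intro floor_unique) linarith+
    then show ?case using elim x by (subst LambdaR_M_right) (simp_all add: v_def)
  qed
qed

lemma stieltjes_neg_atoms:
  assumes c: "c \<ge> 0"
  shows "stieltjes_neg (LambdaL (\<nu> / (2 * \<beta>)) (M_left c \<nu> \<beta>))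
    (distr (geom_int c \<nu>) borel (\<lambda>j. - exp (\<beta> * of_int (2 * j + 1))))"
proof -
  let ?z = "\<lambda>j::int. - exp (\<beta> * of_int (2 * j + 1))"
  note [measurable_cong] = sets_geom_int[OF c \<nu>]
  have em: "emeasure (distr (geom_int c \<nu>) borel ?z) A = emeasure (geom_int c \<nu>) {j. ?z j \<in> A}" if "A \<in> sets borel" for A
    using that by (subst emeasure_distr) (auto simp: vimage_def geom_int_def)
  have "emeasure (distr (geom_int c \<nu>) borel ?z) {0..} = 0"
  proof -
    have "{j. ?z j \<in> {0..}} = {}" by (auto simp: not_le)
    then show ?thesis by (subst em) (simp_all del: atLeast_iff)
  qed
  moreover have "emeasure (distr (geom_int c \<nu>) borel ?z) {a<..b} =
      ennreal (rlim (LambdaL (\<nu> / (2 * \<beta>)) (M_left c \<nu> \<beta>)) b - rlim (LambdaL (\<nu> / (2 * \<beta>)) (M_left c \<nu> \<beta>)) a)"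
    if "a \<le> b" "b < 0" for a b
  proof -
    have a: "a < 0" using that by simp
    \<comment> \<open>The atoms decrease as \<open>j\<close> grows, so lying at or below a point
      means belonging to an upper half-line of indices; the geometric masses then telescope.\<close>
    have "{j. ?z j \<in> {a<..b}} = {\<lceil>ln (- b) / (2 * \<beta>) - 1 / 2\<rceil>..} - {\<lceil>ln (- a) / (2 * \<beta>) - 1 / 2\<rceil>..}"
      using left_atom_le_iff[OF a] left_atom_le_iff[OF that(2)] by (auto simp: not_le[symmetric])
    moreover have "ln (- b) / (2 * \<beta>) - 1 / 2 \<le> ln (- a) / (2 * \<beta>) - 1 / 2"
      using that a \<beta> by (intro diff_right_mono divide_right_mono) auto
    then have "\<lceil>ln (- b) / (2 * \<beta>) - 1 / 2\<rceil> \<le> \<lceil>ln (- a) / (2 * \<beta>) - 1 / 2\<rceil>" by (rule ceiling_mono)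
    ultimately show ?thesis
      using that a by (simp only: em greaterThanAtMost_borel emeasure_geom_int_Diff[OF c \<nu>] rlim_LambdaL)
  qed
  ultimately show ?thesis by (simp add: stieltjes_neg_def)
qed

lemma stieltjes_pos_atoms:
  "stieltjes_pos (LambdaR (\<nu> / (2 * \<beta>)) (M_right \<nu> \<beta>))
    (distr (geom_int 1 \<nu>) borel (\<lambda>j. exp (\<beta> * of_int (2 * j))))"
proof -
  let ?z = "\<lambda>j::int. exp (\<beta> * of_int (2 * j))"
  note [measurable_cong] = sets_geom_int[of 1 \<nu>]
  have em: "emeasure (distr (geom_int 1 \<nu>) borel ?z) A = emeasure (geom_int 1 \<nu>) {j. ?z j \<in> A}" if "A \<in> sets borel" for A
    using that by (subst emeasure_distr) (auto simp: vimage_def geom_int_def)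
  have "emeasure (distr (geom_int 1 \<nu>) borel ?z) {..0} = 0"
  proof -
    have "{j. ?z j \<in> {..0}} = {}" by (auto simp: not_le)
    then show ?thesis by (subst em) (simp_all del: atMost_iff)
  qed
  moreover have "emeasure (distr (geom_int 1 \<nu>) borel ?z) {a<..b} =
      ennreal (rlim (LambdaR (\<nu> / (2 * \<beta>)) (M_right \<nu> \<beta>)) b - rlim (LambdaR (\<nu> / (2 * \<beta>)) (M_right \<nu> \<beta>)) a)"
    if "0 < a" "a \<le> b" for a b
  proof -
    have b: "b > 0" using that by simp
    have "{j. ?z j \<in> {a<..b}} = {\<lfloor>ln a / (2 * \<beta>)\<rfloor> + 1..} - {\<lfloor>ln b / (2 * \<beta>)\<rfloor> + 1..}"
      using right_atom_gt_iff[OF that(1)] right_atom_gt_iff[OF b] by (auto simp: not_less[symmetric])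
    moreover have "ln a / (2 * \<beta>) \<le> ln b / (2 * \<beta>)"
      using that b \<beta> by (intro divide_right_mono) auto
    then have "\<lfloor>ln a / (2 * \<beta>)\<rfloor> + 1 \<le> \<lfloor>ln b / (2 * \<beta>)\<rfloor> + 1" by (simp add: floor_mono)
    ultimately have "emeasure (distr (geom_int 1 \<nu>) borel ?z) {a<..b} =
        ennreal (1 * exp (- \<nu> * of_int (\<lfloor>ln a / (2 * \<beta>)\<rfloor> + 1)) - 1 * exp (- \<nu> * of_int (\<lfloor>ln b / (2 * \<beta>)\<rfloor> + 1)))"
      using emeasure_geom_int_Diff[OF zero_le_one \<nu>] by (simp only: em greaterThanAtMost_borel)
    then show ?thesis using that b by (simp only: rlim_LambdaR) simp
  qed
  ultimately show ?thesis by (simp add: stieltjes_pos_def)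
qed

end

section \<open>Regularity of the tail functions of the limit measures\<close>

context
  fixes c \<nu> \<beta> :: real
  assumes c: "c \<ge> 0" and \<nu>: "\<nu> > 0" and \<beta>: "\<beta> > 0"
begin

text \<open>The slack of 1 in \<open>f\<close> covers both exponents that occur, floor(1/2 + u) on
  the left and floor(u) + 1 on the right, with u = ln(-x) / (2 \<beta>).\<close>

lemma geometric_step_at_bot:
  fixes f :: "real \<Rightarrow> int"
  assumes f: "\<And>x. x < 0 \<Longrightarrow> ln (- x) / (2 * \<beta>) - 1 \<le> of_int (f x)"
  shows "((\<lambda>x. c * exp (- \<nu> * of_int (f x))) \<longlongrightarrow> 0) at_bot"
proof (rule tendsto_sandwich[OF _ _ tendsto_const])
  have "filterlim (\<lambda>x::real. ln (- x)) at_top at_bot"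
    by (rule filterlim_compose[OF ln_at_top filterlim_uminus_at_top_at_bot])
  then have "filterlim (\<lambda>x. - 1 + 1 / (2 * \<beta>) * ln (- x)) at_top at_bot"
    using \<beta> by (intro filterlim_tendsto_add_at_top[OF tendsto_const]
      filterlim_tendsto_pos_mult_at_top[OF tendsto_const]) auto
  then have "filterlim (\<lambda>x. ln (- x) / (2 * \<beta>) - 1) at_top at_bot" by simp
  then have "filterlim (\<lambda>x. - (\<nu> * (ln (- x) / (2 * \<beta>) - 1))) at_bot at_bot"
    unfolding filterlim_uminus_at_top[symmetric]
    using \<nu> by (intro filterlim_tendsto_pos_mult_at_top[OF tendsto_const])
  then have "((\<lambda>x. exp (- (\<nu> * (ln (- x) / (2 * \<beta>) - 1)))) \<longlongrightarrow> 0) at_bot"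
    by (rule filterlim_compose[OF exp_at_bot])
  then show "((\<lambda>x. c * exp (- (\<nu> * (ln (- x) / (2 * \<beta>) - 1)))) \<longlongrightarrow> 0) at_bot"
    by (rule tendsto_mult_right_zero)
  show "eventually (\<lambda>x. c * exp (- \<nu> * of_int (f x)) \<le> c * exp (- (\<nu> * (ln (- x) / (2 * \<beta>) - 1)))) at_bot"
    using eventually_gt_at_bot[of 0]
    by eventually_elim (use c \<nu> f in \<open>auto intro!: mult_left_mono\<close>)
qed (use c in auto)

lemma LambdaL_at_bot: "(LambdaL (\<nu> / (2 * \<beta>)) (M_left c \<nu> \<beta>) \<longlongrightarrow> 0) at_bot"
proof -
  have "((\<lambda>x. c * exp (- \<nu> * of_int \<lfloor>1 / 2 + ln (- x) / (2 * \<beta>)\<rfloor>)) \<longlongrightarrow> 0) at_bot"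
    by (rule geometric_step_at_bot) linarith
  moreover have "eventually (\<lambda>x. c * exp (- \<nu> * of_int \<lfloor>1 / 2 + ln (- x) / (2 * \<beta>)\<rfloor>) =
      LambdaL (\<nu> / (2 * \<beta>)) (M_left c \<nu> \<beta>) x) at_bot"
    using eventually_gt_at_bot[of 0] by eventually_elim (simp only: LambdaL_M_left[OF \<nu> \<beta>])
  ultimately show ?thesis by (rule Lim_transform_eventually)
qed

lemma LambdaL_mono:
  assumes "x \<le> y" "y < 0"
  shows "LambdaL (\<nu> / (2 * \<beta>)) (M_left c \<nu> \<beta>) x \<le> LambdaL (\<nu> / (2 * \<beta>)) (M_left c \<nu> \<beta>) y"
proof -
  have "ln (- y) / (2 * \<beta>) \<le> ln (- x) / (2 * \<beta>)" using assms \<beta> by (intro divide_right_mono) auto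
  then have "\<lfloor>1 / 2 + ln (- y) / (2 * \<beta>)\<rfloor> \<le> \<lfloor>1 / 2 + ln (- x) / (2 * \<beta>)\<rfloor>" by (intro floor_mono) linarith
  then show ?thesis using assms c \<nu> by (simp add: LambdaL_M_left[OF \<nu> \<beta>] mult_left_mono)
qed

lemma countable_LambdaL: "countable (LambdaL (\<nu> / (2 * \<beta>)) (M_left c \<nu> \<beta>) ` {..<0})"
proof (rule countable_subset)
  show "LambdaL (\<nu> / (2 * \<beta>)) (M_left c \<nu> \<beta>) ` {..<0} \<subseteq> range (\<lambda>j::int. c * exp (- \<nu> * of_int j))"
    using LambdaL_M_left[OF \<nu> \<beta>] by auto
qed simp

text \<open>Counting the atoms in \<open>{..x}\<close> produces a ceiling while
  \<open>LambdaL\<close> contains a floor; the two values differ only when \<open>x\<close> is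
  itself an atom.\<close>

lemma LambdaL_eq_ceiling:
  assumes "x < 0" "\<And>j. x \<noteq> - exp (\<beta> * of_int (2 * j + 1))"
  shows "LambdaL (\<nu> / (2 * \<beta>)) (M_left c \<nu> \<beta>) x = c * exp (- \<nu> * of_int \<lceil>ln (- x) / (2 * \<beta>) - 1 / 2\<rceil>)"
proof -
  define m where "m = \<lceil>ln (- x) / (2 * \<beta>) - 1 / 2\<rceil>"
  have "ln (- x) / (2 * \<beta>) - 1 / 2 \<noteq> of_int m"
  proof
    assume "ln (- x) / (2 * \<beta>) - 1 / 2 = of_int m"
    then have "ln (- x) = \<beta> * of_int (2 * m + 1)" using \<beta> by (simp add: field_simps)
    then have "x = - exp (\<beta> * of_int (2 * m + 1))" using assms(1) exp_ln[of "- x"] by simp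
    then show False using assms(2) by blast
  qed
  then have "\<lfloor>1 / 2 + ln (- x) / (2 * \<beta>)\<rfloor> = m"
    unfolding m_def by linarith
  then show ?thesis using assms(1) by (simp only: LambdaL_M_left[OF \<nu> \<beta>] m_def)
qed

end

context
  fixes \<nu> \<beta> :: real
  assumes \<nu>: "\<nu> > 0" and \<beta>: "\<beta> > 0"
begin

lemma LambdaR_at_bot: "((\<lambda>x. - LambdaR (\<nu> / (2 * \<beta>)) (M_right \<nu> \<beta>) (- x)) \<longlongrightarrow> 0) at_bot"
proof -
  have "((\<lambda>x. 1 * exp (- \<nu> * of_int (\<lfloor>ln (- x) / (2 * \<beta>)\<rfloor> + 1))) \<longlongrightarrow> 0) at_bot"
    by (rule geometric_step_at_bot[OF zero_le_one \<nu> \<beta>]) linarith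
  moreover have "eventually (\<lambda>x. 1 * exp (- \<nu> * of_int (\<lfloor>ln (- x) / (2 * \<beta>)\<rfloor> + 1)) =
      - LambdaR (\<nu> / (2 * \<beta>)) (M_right \<nu> \<beta>) (- x)) at_bot"
    using eventually_gt_at_bot[of 0]
  proof eventually_elim
    case (elim x)
    then show ?case using LambdaR_M_right[OF \<nu> \<beta>, of "- x"] by simp
  qed
  ultimately show ?thesis by (rule Lim_transform_eventually)
qed

lemma LambdaR_mono:
  assumes "x \<le> y" "y < 0"
  shows "- LambdaR (\<nu> / (2 * \<beta>)) (M_right \<nu> \<beta>) (- x) \<le> - LambdaR (\<nu> / (2 * \<beta>)) (M_right \<nu> \<beta>) (- y)"
proof -
  have "ln (- y) / (2 * \<beta>) \<le> ln (- x) / (2 * \<beta>)" using assms \<beta> by (intro divide_right_mono) auto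
  then have "\<lfloor>ln (- y) / (2 * \<beta>)\<rfloor> \<le> \<lfloor>ln (- x) / (2 * \<beta>)\<rfloor>" by (rule floor_mono)
  then show ?thesis using assms \<nu> by (simp add: LambdaR_M_right[OF \<nu> \<beta>])
qed

lemma countable_LambdaR: "countable ((\<lambda>x. - LambdaR (\<nu> / (2 * \<beta>)) (M_right \<nu> \<beta>) (- x)) ` {..<0})"
proof (rule countable_subset)
  show "(\<lambda>x. - LambdaR (\<nu> / (2 * \<beta>)) (M_right \<nu> \<beta>) (- x)) ` {..<0} \<subseteq> range (\<lambda>j::int. exp (- \<nu> * of_int j))"
  proof safe
    fix x :: real assume "x < 0"
    then have "- LambdaR (\<nu> / (2 * \<beta>)) (M_right \<nu> \<beta>) (- x) = exp (- \<nu> * of_int (\<lfloor>ln (- x) / (2 * \<beta>)\<rfloor> + 1))"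
      using LambdaR_M_right[OF \<nu> \<beta>, of "- x"] by simp
    then show "- LambdaR (\<nu> / (2 * \<beta>)) (M_right \<nu> \<beta>) (- x) \<in> range (\<lambda>j::int. exp (- \<nu> * of_int j))"
      by (rule range_eqI)
  qed
qed simp

lemma LambdaR_eq_ceiling:
  assumes "x < 0" "\<And>j. - x \<noteq> exp (\<beta> * of_int (2 * j))"
  shows "- LambdaR (\<nu> / (2 * \<beta>)) (M_right \<nu> \<beta>) (- x) = exp (- \<nu> * of_int \<lceil>ln (- x) / (2 * \<beta>)\<rceil>)"
proof -
  define m where "m = \<lceil>ln (- x) / (2 * \<beta>)\<rceil>"
  have "ln (- x) / (2 * \<beta>) \<noteq> of_int m"
  proof
    assume "ln (- x) / (2 * \<beta>) = of_int m"
    then have "ln (- x) = \<beta> * of_int (2 * m)" using \<beta> by (simp add: field_simps)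
    then have "- x = exp (\<beta> * of_int (2 * m))" using assms(1) exp_ln[of "- x"] by simp
    then show False using assms(2) by blast
  qed
  then have "\<lfloor>ln (- x) / (2 * \<beta>)\<rfloor> + 1 = m"
    unfolding m_def by linarith
  then show ?thesis using assms(1) LambdaR_M_right[OF \<nu> \<beta>, of "- x"] by (simp add: m_def)
qed

end

section \<open>Identification of the limit law of an integer array\<close>

lemma psi2_eq_psi1: "psi2 LR = psi1 (\<lambda>x. - LR (- x))"
  by (simp add: psi2_def psi1_def fun_eq_iff)

text \<open>The normalised sums \<open>S\<close> enter only through their characteristic functions,
  and only for large index, because the scale of the array is known to be positive only
  eventually.\<close>

theorem (in int_array) exists_semi_stable_limit:
  assumes c: "c \<ge> 0" and \<nu>: "\<nu> > 0" and \<beta>: "\<beta> > 0"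
    and b: "\<And>j. b (2 * j) = geom_weight 1 \<nu> j" "\<And>j. b (2 * j + 1) = geom_weight c \<nu> j"
    and z: "\<And>j. z (2 * j) = exp (\<beta> * of_int (2 * j))" "\<And>j. z (2 * j + 1) = - exp (\<beta> * of_int (2 * j + 1))"
    and left: "eventually (\<lambda>n. real (k n) * cdf (\<mu> n) 0 \<ge> 1) sequentially"
    and right: "eventually (\<lambda>n. real (k n) * measure (\<mu> n) {0..} \<ge> 1) sequentially"
    and S: "\<And>n. real_distribution (S n)"
    and char_S: "eventually (\<lambda>n. \<forall>t. char (S n) t = char (\<mu> n) t ^ k n *
      iexp (- (t * (real (k n) * (LBINT s:{1 / real (k n)..1 - 1 / real (k n)}. Inf {y. s \<le> cdf (\<mu> n) y}))))) sequentially"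
  shows "\<exists>m. semi_stable_law (\<nu> / (2 * \<beta>)) (M_left c \<nu> \<beta>) (M_right \<nu> \<beta>) m \<and> weak_conv_m S m"
proof -
  define gl where "gl = LambdaL (\<nu> / (2 * \<beta>)) (M_left c \<nu> \<beta>)"
  define gr where "gr x = - LambdaR (\<nu> / (2 * \<beta>)) (M_right \<nu> \<beta>) (- x)" for x
  \<comment> \<open>Both signs are excluded, since the right tail is evaluated at
    \<open>- x\<close>.\<close>
  define D where "D = range z \<union> uminus ` range z"
  define \<eta> where "\<eta> = Theta (psi1 gl) - Theta (psi1 gr)"
  have zpos: "z (2 * j) > 0" "z (2 * j + 1) < 0" for j by (simp_all only: z, simp_all)
  have kr: "filterlim (\<lambda>n. real (k n)) at_top sequentially"
    using filterlim_compose[OF filterlim_real_sequentially k_at_top] .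
  have fi: "integrable (count_space UNIV) (\<lambda>i. b i * indicator A (z i))"
    if "\<And>x. x \<in> A \<Longrightarrow> \<bar>x0\<bar> \<le> \<bar>x\<bar>" "x0 \<noteq> 0" for A :: "real set" and x0
    using integrable_limit(1)[of "indicat_real A", OF norm_indicator_le[OF that]] by simp
  have l_conv: "(\<lambda>n. real (k n) * cdf (\<mu> n) x) \<longlonglongrightarrow> gl x" if x: "x < 0" "x \<notin> D" for x
  proof -
    have lim: "(\<lambda>n. real (k n) * measure (\<mu> n) {..x}) \<longlonglongrightarrow> (\<integral>i. b i * indicator {..x} (z i) \<partial>count_space UNIV)"
      by (rule tendsto_mult_measure[of _ x]) (use x in \<open>auto simp: D_def frontier_def interior_Iic\<close>)
    have "integrable (count_space UNIV) (\<lambda>i. b i * indicator {..x} (z i))"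
      by (rule fi[of _ x]) (use x in auto)
    then have "(\<integral>i. b i * indicator {..x} (z i) \<partial>count_space UNIV) =
        (\<integral>j. b (2 * j) * indicator {..x} (z (2 * j)) \<partial>count_space UNIV) +
        (\<integral>j. b (2 * j + 1) * indicator {..x} (z (2 * j + 1)) \<partial>count_space UNIV)"
      by (rule integral_int_even_odd(3))
    also have "(\<lambda>j. b (2 * j) * indicator {..x} (z (2 * j))) = (\<lambda>_. 0)"
    proof
      fix j show "b (2 * j) * indicator {..x} (z (2 * j)) = 0" using zpos(1)[of j] x by simp
    qed
    also have "(\<lambda>j. b (2 * j + 1) * indicator {..x} (z (2 * j + 1))) =
        (\<lambda>j. geom_weight c \<nu> j * indicator {\<lceil>ln (- x) / (2 * \<beta>) - 1 / 2\<rceil>..} j)"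
      unfolding b z using left_atom_le_iff[OF \<nu> \<beta> x(1)] by (auto simp: fun_eq_iff indicator_def)
    also have "(\<integral>j. geom_weight c \<nu> j * indicator {\<lceil>ln (- x) / (2 * \<beta>) - 1 / 2\<rceil>..} j \<partial>count_space UNIV) = gl x"
    proof -
      have "x \<noteq> - exp (\<beta> * of_int (2 * j + 1))" for j
        using x(2) z(2)[of j, symmetric] by (auto simp: D_def)
      from LambdaL_eq_ceiling[OF c \<nu> \<beta> x(1) this] show ?thesis
        by (simp only: integral_geom_weight_atLeast[OF c \<nu>] gl_def)
    qed
    finally show ?thesis using lim by (simp add: cdf_def)
  qed
  have r_conv: "(\<lambda>n. real (k n) * measure (\<mu> n) {- x..}) \<longlonglongrightarrow> gr x" if x: "x < 0" "x \<notin> D" for x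
  proof -
    have x': "- x > 0" using x by simp
    have nz: "z i \<noteq> - x" for i
    proof
      assume "z i = - x"
      then have "x = - z i" by simp
      then show False using x(2) by (auto simp: D_def)
    qed
    have lim: "(\<lambda>n. real (k n) * measure (\<mu> n) {- x..}) \<longlonglongrightarrow> (\<integral>i. b i * indicator {- x..} (z i) \<partial>count_space UNIV)"
    proof (rule tendsto_mult_measure[of _ x])
      have "frontier {- x..} = {- x}" by (auto simp: frontier_def interior_Ici)
      then show "z i \<notin> frontier {- x..}" for i using nz[of i] by simp
    qed (use x in auto)
    have "integrable (count_space UNIV) (\<lambda>i. b i * indicator {- x..} (z i))"
      by (rule fi[of _ x]) (use x in auto)
    then have "(\<integral>i. b i * indicator {- x..} (z i) \<partial>count_space UNIV) =
        (\<integral>j. b (2 * j) * indicator {- x..} (z (2 * j)) \<partial>count_space UNIV) +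
        (\<integral>j. b (2 * j + 1) * indicator {- x..} (z (2 * j + 1)) \<partial>count_space UNIV)"
      by (rule integral_int_even_odd(3))
    also have "(\<lambda>j. b (2 * j + 1) * indicator {- x..} (z (2 * j + 1))) = (\<lambda>_. 0)"
    proof
      fix j show "b (2 * j + 1) * indicator {- x..} (z (2 * j + 1)) = 0" using zpos(2)[of j] x by simp
    qed
    also have "(\<lambda>j. b (2 * j) * indicator {- x..} (z (2 * j))) =
        (\<lambda>j. geom_weight 1 \<nu> j * indicator {\<lceil>ln (- x) / (2 * \<beta>)\<rceil>..} j)"
      unfolding b z using right_atom_ge_iff[OF \<nu> \<beta> x'] by (auto simp: fun_eq_iff indicator_def)
    also have "(\<integral>j. geom_weight 1 \<nu> j * indicator {\<lceil>ln (- x) / (2 * \<beta>)\<rceil>..} j \<partial>count_space UNIV) = gr x"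
    proof -
      have "- x \<noteq> exp (\<beta> * of_int (2 * j))" for j
        using nz[of "2 * j"] z(1)[of j] by metis
      from LambdaR_eq_ceiling[OF \<nu> \<beta> x(1) this] show ?thesis
        by (simp only: integral_geom_weight_atLeast[OF zero_le_one \<nu>] gr_def mult_1)
    qed
    finally show ?thesis using lim by simp
  qed
  have centre: "(\<lambda>n. real (k n) * (LINT y|\<mu> n. y / (1 + y\<^sup>2)) -
      real (k n) * (LBINT s:{1 / real (k n)..1 - 1 / real (k n)}. Inf {y. s \<le> cdf (\<mu> n) y})) \<longlonglongrightarrow> \<eta>"
    unfolding \<eta>_def
  proof (rule tendsto_quantile_centring[OF real_distribution_\<mu> kr _ _ _ _ _ l_conv _ _ _ r_conv _ _ moment_bound left right])
    show "countable D" by (simp add: D_def)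
    show "gl x \<le> gl y" if "x \<le> y" "y < 0" for x y
      unfolding gl_def by (rule LambdaL_mono[OF c \<nu> \<beta> that])
    show "gr x \<le> gr y" if "x \<le> y" "y < 0" for x y
      unfolding gr_def by (rule LambdaR_mono[OF \<nu> \<beta> that])
    show "(gl \<longlongrightarrow> 0) at_bot" unfolding gl_def by (rule LambdaL_at_bot[OF c \<nu> \<beta>])
    show "(gr \<longlongrightarrow> 0) at_bot" unfolding gr_def by (rule LambdaR_at_bot[OF \<nu> \<beta>])
    show "countable (gl ` {..<0})" unfolding gl_def by (rule countable_LambdaL[OF c \<nu> \<beta>])
    show "countable (gr ` {..<0})" unfolding gr_def by (rule countable_LambdaR[OF \<nu> \<beta>])
  qed (use r in auto)
  define l where "l t = (\<integral>i. b i *\<^sub>R levy_integrand t (z i) \<partial>count_space UNIV)" for t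
  define \<phi> where "\<phi> t = exp (\<i> * complex_of_real (\<eta> * t) + l t)" for t
  have lim: "(\<lambda>n. char (S n) t) \<longlonglongrightarrow> \<phi> t" for t
  proof -
    have "(\<lambda>n. char (\<mu> n) t ^ k n * iexp (- (t * (real (k n) *
        (LBINT s:{1 / real (k n)..1 - 1 / real (k n)}. Inf {y. s \<le> cdf (\<mu> n) y}))))) \<longlonglongrightarrow> \<phi> t"
      unfolding \<phi>_def l_def
      by (rule tendsto_centred_char_power[OF real_distribution_\<mu> k_at_top r moment_bound tendsto_levy centre])
    then show ?thesis
      by (rule Lim_transform_eventually) (use char_S in \<open>eventually_elim, simp\<close>)
  qed
  have "isCont \<phi> 0"
    unfolding \<phi>_def l_def by (intro continuous_intros isCont_levy_exponent)
  from levy_continuity_exists[OF S lim this] obtain m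
    where m: "real_distribution m" "char m = \<phi>" "weak_conv_m S m" by blast
  let ?L = "distr (geom_int c \<nu>) borel (\<lambda>j. - exp (\<beta> * of_int (2 * j + 1)))"
  let ?R = "distr (geom_int 1 \<nu>) borel (\<lambda>j. exp (\<beta> * of_int (2 * j)))"
  note split = integral_int_even_odd[OF integrable_levy, unfolded b z]
  have "integrable ?L (levy_integrand t)" "integrable ?R (levy_integrand t)"
    "char m t = exp (\<i> * complex_of_real (\<eta> * t) + integral\<^sup>L ?L (levy_integrand t) + integral\<^sup>L ?R (levy_integrand t))" for t
  proof -
    show "integrable ?L (levy_integrand t)" "integrable ?R (levy_integrand t)"
      using split(1,2)[of t] unfolding integral_distr_geom_int[OF c \<nu> measurable_levy_integrand]
        integral_distr_geom_int[OF zero_le_one \<nu> measurable_levy_integrand] by simp_all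
    have "l t = integral\<^sup>L ?R (levy_integrand t) + integral\<^sup>L ?L (levy_integrand t)"
      using split(3)[of t] unfolding l_def integral_distr_geom_int[OF c \<nu> measurable_levy_integrand]
        integral_distr_geom_int[OF zero_le_one \<nu> measurable_levy_integrand] .
    then show "char m t = exp (\<i> * complex_of_real (\<eta> * t) + integral\<^sup>L ?L (levy_integrand t) + integral\<^sup>L ?R (levy_integrand t))"
      by (simp add: m(2) \<phi>_def add.commute add.left_commute)
  qed
  moreover have "\<eta> = Theta (psi1 gl) - Theta (psi2 (LambdaR (\<nu> / (2 * \<beta>)) (M_right \<nu> \<beta>)))"
    by (simp add: \<eta>_def psi2_eq_psi1 gr_def[abs_def])
  ultimately have "semi_stable_law (\<nu> / (2 * \<beta>)) (M_left c \<nu> \<beta>) (M_right \<nu> \<beta>) m"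
    unfolding semi_stable_law_def Let_def gl_def
    using m(1) stieltjes_neg_atoms[OF \<nu> \<beta> c] stieltjes_pos_atoms[OF \<nu> \<beta>] by blast
  with m(3) show ?thesis by blast
qed

section \<open>Tails split by parity\<close>

lemma filterlim_nat_add: "filterlim (\<lambda>N. nat (int N + j)) at_top sequentially" for j :: int
  unfolding filterlim_at_top
proof
  fix Z
  show "eventually (\<lambda>N. Z \<le> nat (int N + j)) sequentially"
    using eventually_ge_at_top[of "Z + nat \<bar>j\<bar>"] by eventually_elim linarith
qed

locale parity_tails = prob_space M for M :: "'a measure" +
  fixes W :: "'a \<Rightarrow> nat" and \<nu> \<beta> c1 :: real and h1 h2 L :: "real \<Rightarrow> real"
  assumes W_meas [measurable]: "W \<in> measurable M (count_space UNIV)"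
    and \<nu>: "\<nu> > 0" and \<beta>: "\<beta> > 0" and c1: "c1 \<ge> 0"
    and h1_pos: "\<forall>x>0. h1 x > 0" and h2_pos: "\<forall>x>0. h2 x > 0"
    and h2_h1: "((\<lambda>x. h2 x / h1 x) \<longlongrightarrow> c1) at_top"
    and h1_ratio: "((\<lambda>(a, x). h1 (a * x) / h1 x) \<longlongrightarrow> 1) (at 1 \<times>\<^sub>F at_top)"
    and even_tail: "\<forall>x>0. measure M {\<omega>\<in>space M. real (W \<omega>) / 2 \<ge> x \<and> even (W \<omega>)}
              = h1 (of_int \<lceil>x\<rceil>) * exp (- \<nu> * of_int \<lceil>x\<rceil>)"
    and odd_tail: "\<forall>x>0. measure M {\<omega>\<in>space M. (real (W \<omega>) - 1) / 2 \<ge> x \<and> odd (W \<omega>)}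
              = h2 (of_int \<lceil>x\<rceil>) * exp (- \<nu> * of_int \<lceil>x\<rceil>)"
    and L_slow: "slowly_varying L"
    and index: "\<nu> / (2 * \<beta>) < 2"
begin

definition p :: "nat \<Rightarrow> real" where "p w = prob {\<omega> \<in> space M. W \<omega> = w}"
definition H1 :: "nat \<Rightarrow> real" where "H1 m = h1 (real m) * exp (- \<nu> * real m)"
definition H2 :: "nat \<Rightarrow> real" where "H2 m = h2 (real m) * exp (- \<nu> * real m)"
text \<open>This is \<open>1 / H1 N\<close> rounded up, so \<open>k N\<close> times the probability
  that W is even and at least 2N tends to 1.\<close>

definition k :: "nat \<Rightarrow> nat" where "k N = nat \<lceil>exp (real N * \<nu>) / h1 (real N)\<rceil>"

lemma prob_even_ge: "m > 0 \<Longrightarrow> prob {\<omega> \<in> space M. 2 * m \<le> W \<omega> \<and> even (W \<omega>)} = H1 m"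
proof -
  assume m: "m > 0"
  have "2 * m \<le> w \<longleftrightarrow> real w / 2 \<ge> real m" for w
  proof -
    have "2 * m \<le> w \<longleftrightarrow> real (2 * m) \<le> real w" by (simp only: of_nat_le_iff)
    then show ?thesis by (simp add: field_simps)
  qed
  then have "{\<omega> \<in> space M. 2 * m \<le> W \<omega> \<and> even (W \<omega>)} = {\<omega>\<in>space M. real (W \<omega>) / 2 \<ge> real m \<and> even (W \<omega>)}"
    by simp
  then show ?thesis using even_tail[rule_format, of "real m"] m by (simp add: H1_def)
qed

lemma prob_odd_ge: "m > 0 \<Longrightarrow> prob {\<omega> \<in> space M. 2 * m + 1 \<le> W \<omega> \<and> odd (W \<omega>)} = H2 m"
proof -
  assume m: "m > 0"
  have "2 * m + 1 \<le> w \<longleftrightarrow> (real w - 1) / 2 \<ge> real m" for w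
  proof -
    have "2 * m + 1 \<le> w \<longleftrightarrow> real (2 * m + 1) \<le> real w" by (simp only: of_nat_le_iff)
    then show ?thesis by (simp add: field_simps)
  qed
  then have "{\<omega> \<in> space M. 2 * m + 1 \<le> W \<omega> \<and> odd (W \<omega>)} = {\<omega>\<in>space M. (real (W \<omega>) - 1) / 2 \<ge> real m \<and> odd (W \<omega>)}"
    by simp
  then show ?thesis using odd_tail[rule_format, of "real m"] m by (simp add: H2_def)
qed

lemma p_nonneg: "p w \<ge> 0" by (simp add: p_def)

lemma p_even: "m > 0 \<Longrightarrow> p (2 * m) = H1 m - H1 (Suc m)"
proof -
  assume m: "m > 0"
  have "{\<omega> \<in> space M. W \<omega> = 2 * m} =
      {\<omega> \<in> space M. 2 * m \<le> W \<omega> \<and> even (W \<omega>)} - {\<omega> \<in> space M. 2 * Suc m \<le> W \<omega> \<and> even (W \<omega>)}"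
    by (auto; presburger)
  also have "prob \<dots> = H1 m - H1 (Suc m)"
    using m prob_even_ge[of m] prob_even_ge[of "Suc m"] by (subst finite_measure_Diff) auto
  finally show ?thesis by (simp add: p_def)
qed

lemma p_odd: "m > 0 \<Longrightarrow> p (2 * m + 1) = H2 m - H2 (Suc m)"
proof -
  assume m: "m > 0"
  have "{\<omega> \<in> space M. W \<omega> = 2 * m + 1} =
      {\<omega> \<in> space M. 2 * m + 1 \<le> W \<omega> \<and> odd (W \<omega>)} - {\<omega> \<in> space M. 2 * Suc m + 1 \<le> W \<omega> \<and> odd (W \<omega>)}"
    by (auto; presburger)
  also have "prob \<dots> = H2 m - H2 (Suc m)"
    using m prob_odd_ge[of m] prob_odd_ge[of "Suc m"] by (subst finite_measure_Diff) auto
  finally show ?thesis by (simp add: p_def)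
qed

lemma H1_pos: "m > 0 \<Longrightarrow> H1 m > 0" and H2_pos: "m > 0 \<Longrightarrow> H2 m > 0"
  using h1_pos h2_pos by (auto simp: H1_def H2_def)

lemma p_even_le: "m > 0 \<Longrightarrow> p (2 * m) \<le> H1 m" and p_odd_le: "m > 0 \<Longrightarrow> p (2 * m + 1) \<le> H2 m"
  using p_even[of m] p_odd[of m] H1_pos[of "Suc m"] H2_pos[of "Suc m"] by auto

text \<open>Read off from the probabilities: the tail events decrease to the empty set. It sends
  \<open>k N\<close> to infinity and makes the rounding in \<open>k N\<close> negligible.\<close>

lemma H1_tendsto_0: "H1 \<longlonglongrightarrow> 0"
proof -
  have "(\<lambda>m. prob {\<omega> \<in> space M. 2 * m \<le> W \<omega> \<and> even (W \<omega>)}) \<longlonglongrightarrow> prob (\<Inter>m. {\<omega> \<in> space M. 2 * m \<le> W \<omega> \<and> even (W \<omega>)})"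
    by (rule finite_Lim_measure_decseq) (auto simp: decseq_def)
  moreover have "(\<Inter>m. {\<omega> \<in> space M. 2 * m \<le> W \<omega> \<and> even (W \<omega>)}) = {}"
  proof -
    have "\<not> 2 * Suc (W \<omega>) \<le> W \<omega>" for \<omega> by simp
    then show ?thesis by fastforce
  qed
  ultimately have "(\<lambda>m. prob {\<omega> \<in> space M. 2 * m \<le> W \<omega> \<and> even (W \<omega>)}) \<longlonglongrightarrow> 0" by simp
  moreover have "eventually (\<lambda>m. prob {\<omega> \<in> space M. 2 * m \<le> W \<omega> \<and> even (W \<omega>)} = H1 m) sequentially"
    using eventually_gt_at_top[of 0] by eventually_elim (rule prob_even_ge)
  ultimately show ?thesis by (rule Lim_transform_eventually)
qed

lemma inverse_H1: "exp (real N * \<nu>) / h1 (real N) = inverse (H1 N)"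
  by (simp add: H1_def exp_minus mult.commute divide_inverse)

lemma k_bounds: "N > 0 \<Longrightarrow> inverse (H1 N) \<le> real (k N) \<and> real (k N) < inverse (H1 N) + 1"
  using H1_pos[of N] unfolding k_def inverse_H1 by (auto simp: of_nat_nat) linarith+

lemma k_at_top: "filterlim k at_top sequentially"
proof -
  have "filterlim (\<lambda>N. inverse (H1 N)) at_top sequentially"
  proof (rule filterlim_inverse_at_top[OF H1_tendsto_0])
    show "eventually (\<lambda>N. 0 < H1 N) sequentially"
      using eventually_gt_at_top[of 0] by eventually_elim (rule H1_pos)
  qed
  then have "filterlim (\<lambda>N. real (k N)) at_top sequentially"
  proof (rule filterlim_at_top_mono)
    show "eventually (\<lambda>N. inverse (H1 N) \<le> real (k N)) sequentially"
      using eventually_gt_at_top[of 0] by eventually_elim (use k_bounds in blast)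
  qed
  then show ?thesis by (simp add: filterlim_sequentially_iff_filterlim_real)
qed

lemma k_H1: "(\<lambda>N. real (k N) * H1 N) \<longlonglongrightarrow> 1"
proof (rule tendsto_sandwich[OF _ _ tendsto_const])
  show "eventually (\<lambda>N. 1 \<le> real (k N) * H1 N) sequentially"
    using eventually_gt_at_top[of 0]
  proof eventually_elim
    case (elim N)
    then have "inverse (H1 N) * H1 N \<le> real (k N) * H1 N"
      using k_bounds[OF elim] H1_pos[OF elim] by (intro mult_right_mono) auto
    then show ?case using H1_pos[OF elim] by simp
  qed
  show "eventually (\<lambda>N. real (k N) * H1 N \<le> 1 + H1 N) sequentially"
    using eventually_gt_at_top[of 0]
  proof eventually_elim
    case (elim N)
    then have "real (k N) * H1 N \<le> (inverse (H1 N) + 1) * H1 N"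
      using k_bounds[OF elim] H1_pos[OF elim] by (intro mult_right_mono) auto
    then show ?case using H1_pos[OF elim] by (simp add: distrib_right)
  qed
  show "(\<lambda>N. 1 + H1 N) \<longlonglongrightarrow> 1" using tendsto_add[OF tendsto_const H1_tendsto_0, of 1] by simp
qed

text \<open>The hypothesis on \<open>h1\<close> along a = (n + 1)/n, x = n; this a differs from 1,
  as the punctured filter \<open>at 1\<close> demands.\<close>

lemma h1_Suc_ratio: "(\<lambda>n. h1 (real (Suc n)) / h1 (real n)) \<longlonglongrightarrow> 1"
proof -
  have "filterlim (\<lambda>n. (real (Suc n) / real n, real n)) (at 1 \<times>\<^sub>F at_top) sequentially"
  proof (rule filterlim_Pair)
    have "(\<lambda>n. real (Suc n) / real n) \<longlonglongrightarrow> 1" by (rule LIMSEQ_Suc_n_over_n)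
    moreover have "eventually (\<lambda>n. real (Suc n) / real n \<noteq> 1) sequentially"
      using eventually_gt_at_top[of 0] by eventually_elim simp
    ultimately show "filterlim (\<lambda>n. real (Suc n) / real n) (at 1) sequentially"
      by (simp add: filterlim_at)
    show "filterlim real at_top sequentially" by (rule filterlim_real_sequentially)
  qed
  from filterlim_compose[OF h1_ratio this]
  have "(\<lambda>n. h1 (real (Suc n) / real n * real n) / h1 (real n)) \<longlonglongrightarrow> 1" by simp
  moreover have "eventually (\<lambda>n. h1 (real (Suc n) / real n * real n) / h1 (real n) = h1 (real (Suc n)) / h1 (real n)) sequentially"
    using eventually_gt_at_top[of 0] by eventually_elim simp
  ultimately show ?thesis by (rule Lim_transform_eventually)
qed

lemma h1_eventually_pos: "eventually (\<lambda>n. h1 (real n) > 0) sequentially"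
  using eventually_gt_at_top[of 0] by eventually_elim (use h1_pos in simp)

lemma k_H1_shift: "(\<lambda>N. real (k N) * H1 (nat (int N + j))) \<longlonglongrightarrow> exp (- \<nu> * of_int j)"
proof -
  have "(\<lambda>N. real (k N) * H1 N * (h1 (real (nat (int N + j))) / h1 (real N)) * exp (- \<nu> * of_int j)) \<longlonglongrightarrow> 1 * 1 * exp (- \<nu> * of_int j)"
    by (intro tendsto_mult tendsto_const k_H1
        tendsto_ratio_shift[where c="\<lambda>n. h1 (real n)", OF h1_Suc_ratio h1_eventually_pos])
  moreover have "eventually (\<lambda>N. real (k N) * H1 N * (h1 (real (nat (int N + j))) / h1 (real N)) * exp (- \<nu> * of_int j)
      = real (k N) * H1 (nat (int N + j))) sequentially"
    using eventually_gt_at_top[of "nat \<bar>j\<bar>"]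
  proof eventually_elim
    case (elim N)
    then have N: "N > 0" "real (nat (int N + j)) = real N + of_int j" by linarith+
    have "h1 (real N) > 0" using N h1_pos by simp
    moreover have "exp (- \<nu> * (real N + of_int j)) = exp (- \<nu> * real N) * exp (- \<nu> * of_int j)"
      by (simp only: exp_add[symmetric]) (simp add: algebra_simps)
    ultimately show ?case unfolding H1_def N(2) by simp
  qed
  ultimately show ?thesis by (auto intro: Lim_transform_eventually)
qed

lemma k_H2_shift: "(\<lambda>N. real (k N) * H2 (nat (int N + j))) \<longlonglongrightarrow> c1 * exp (- \<nu> * of_int j)"
proof -
  have "(\<lambda>N. h2 (real (nat (int N + j))) / h1 (real (nat (int N + j)))) \<longlonglongrightarrow> c1"
    by (rule filterlim_compose[OF h2_h1 filterlim_compose[OF filterlim_real_sequentially filterlim_nat_add]])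
  from tendsto_mult[OF this k_H1_shift[of j]]
  have "(\<lambda>N. h2 (real (nat (int N + j))) / h1 (real (nat (int N + j))) * (real (k N) * H1 (nat (int N + j)))) \<longlonglongrightarrow> c1 * exp (- \<nu> * of_int j)" .
  moreover have "eventually (\<lambda>N. h2 (real (nat (int N + j))) / h1 (real (nat (int N + j))) * (real (k N) * H1 (nat (int N + j)))
      = real (k N) * H2 (nat (int N + j))) sequentially"
    using eventually_gt_at_top[of "nat \<bar>j\<bar>"]
  proof eventually_elim
    case (elim N)
    then have "real (nat (int N + j)) > 0" by linarith
    then have "h1 (real (nat (int N + j))) > 0" using h1_pos by blast
    then show ?case unfolding H1_def H2_def by simp
  qed
  ultimately show ?thesis by (rule Lim_transform_eventually)
qed

lemma exp_minus_mult_add_one: "exp (- \<nu> * of_int (j + 1)) = exp (- \<nu> * of_int j) * exp (- \<nu>)"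
  by (simp only: exp_add[symmetric]) (simp add: algebra_simps)

definition b :: "int \<Rightarrow> real" where
  "b i = geom_weight (if even i then 1 else c1) \<nu> (i div 2)"

lemma weight_tendsto: "(\<lambda>N. real (k N) * p (nat (2 * int N + i))) \<longlonglongrightarrow> b i"
proof (cases "even i")
  case True
  define j where "j = i div 2"
  have i: "i = 2 * j" using True by (simp add: j_def)
  have "(\<lambda>N. real (k N) * H1 (nat (int N + j)) - real (k N) * H1 (nat (int N + (j + 1)))) \<longlonglongrightarrow>
      exp (- \<nu> * of_int j) - exp (- \<nu> * of_int (j + 1))"
    by (intro tendsto_diff k_H1_shift)
  moreover have "exp (- \<nu> * of_int j) - exp (- \<nu> * of_int (j + 1)) = b i"
    unfolding exp_minus_mult_add_one by (simp add: b_def geom_weight_def i right_diff_distrib)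
  moreover have "eventually (\<lambda>N. real (k N) * H1 (nat (int N + j)) - real (k N) * H1 (nat (int N + (j + 1)))
      = real (k N) * p (nat (2 * int N + i))) sequentially"
    using eventually_gt_at_top[of "nat \<bar>j\<bar>"]
  proof eventually_elim
    case (elim N)
    then have "nat (2 * int N + i) = 2 * nat (int N + j)" "nat (int N + (j + 1)) = Suc (nat (int N + j))" "nat (int N + j) > 0"
      unfolding i by linarith+
    then show ?case by (simp add: p_even right_diff_distrib)
  qed
  ultimately show ?thesis by (auto intro: Lim_transform_eventually)
next
  case False
  define j where "j = i div 2"
  have i: "i = 2 * j + 1" using False by (simp add: j_def)
  have "(\<lambda>N. real (k N) * H2 (nat (int N + j)) - real (k N) * H2 (nat (int N + (j + 1)))) \<longlonglongrightarrow>
      c1 * exp (- \<nu> * of_int j) - c1 * exp (- \<nu> * of_int (j + 1))"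
    by (intro tendsto_diff k_H2_shift)
  moreover have "c1 * exp (- \<nu> * of_int j) - c1 * exp (- \<nu> * of_int (j + 1)) = b i"
    unfolding exp_minus_mult_add_one by (simp add: b_def geom_weight_def i right_diff_distrib)
  moreover have "eventually (\<lambda>N. real (k N) * H2 (nat (int N + j)) - real (k N) * H2 (nat (int N + (j + 1)))
      = real (k N) * p (nat (2 * int N + i))) sequentially"
    using eventually_gt_at_top[of "nat \<bar>j\<bar>"]
  proof eventually_elim
    case (elim N)
    then have "nat (2 * int N + i) = 2 * nat (int N + j) + 1" "nat (int N + (j + 1)) = Suc (nat (int N + j))" "nat (int N + j) > 0"
      unfolding i by linarith+
    then show ?case using p_odd[of "nat (int N + j)"] by (simp add: right_diff_distrib)
  qed
  ultimately show ?thesis by (auto intro: Lim_transform_eventually)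
qed

end

section \<open>Uniform domination of the rescaled weights and values\<close>

lemma weighted_min_powr_bound:
  fixes a y i \<nu> \<beta> r e d K1 K2 :: real
  assumes a: "0 \<le> a" "a \<le> K1 * exp (- (\<nu> / 2) * i + e * \<bar>i\<bar>)"
    and y: "\<bar>y\<bar> \<le> K2 * exp (\<beta> * i + e * \<bar>i\<bar>)"
    and K: "K1 \<ge> 0" "K2 \<ge> 0" and r: "0 < r" "r \<le> 2"
    and e: "e \<ge> 0" "d \<le> \<nu> / 2 - e" "d \<le> r * \<beta> - \<nu> / 2 - 3 * e"
  shows "a * min 1 \<bar>y\<bar> powr r \<le> K1 * (1 + K2 powr r) * exp (- d * \<bar>i\<bar>)"
proof (cases "i \<ge> 0")
  case True
  have "a * min 1 \<bar>y\<bar> powr r \<le> a * 1"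
    using a r by (intro mult_left_mono powr_le1) auto
  also have "\<dots> \<le> K1 * exp (- (\<nu> / 2) * i + e * \<bar>i\<bar>)" using a by simp
  also have "\<dots> \<le> K1 * exp (- d * \<bar>i\<bar>)"
  proof -
    have "- (\<nu> / 2) * i + e * \<bar>i\<bar> \<le> - d * \<bar>i\<bar>"
      using mult_right_mono[OF e(2) True] True by (simp add: algebra_simps)
    then show ?thesis using K by (intro mult_left_mono) auto
  qed
  also have "\<dots> \<le> K1 * (1 + K2 powr r) * exp (- d * \<bar>i\<bar>)"
    using K by (intro mult_right_mono) (auto simp: algebra_simps)
  finally show ?thesis .
next
  case False
  have "min 1 \<bar>y\<bar> powr r \<le> (K2 * exp (\<beta> * i + e * \<bar>i\<bar>)) powr r"
    using y r by (intro powr_mono2) auto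
  also have "\<dots> = K2 powr r * exp (r * (\<beta> * i + e * \<bar>i\<bar>))"
  proof -
    have "exp x powr r = exp (r * x)" for x by (simp add: powr_def)
    then show ?thesis using K by (simp add: powr_mult)
  qed
  finally have "a * min 1 \<bar>y\<bar> powr r \<le> (K1 * exp (- (\<nu> / 2) * i + e * \<bar>i\<bar>)) * (K2 powr r * exp (r * (\<beta> * i + e * \<bar>i\<bar>)))"
    using a K by (intro mult_mono) auto
  also have "\<dots> = K1 * K2 powr r * exp ((- (\<nu> / 2) * i + e * \<bar>i\<bar>) + r * (\<beta> * i + e * \<bar>i\<bar>))"
    by (simp only: exp_add mult.assoc mult.left_commute)
  also have "\<dots> \<le> K1 * K2 powr r * exp (- d * \<bar>i\<bar>)"
  proof -
    define q where "q = - i"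
    have q: "q > 0" "i = - q" using False by (auto simp: q_def)
    \<comment> \<open>For negative \<open>i\<close> the loss \<open>e\<close> occurs once in the
      weight and \<open>r \<le> 2\<close> times in the power of the value, whence the
      \<open>3 * e\<close> allowed for in the hypothesis on \<open>d\<close>.\<close>
    have "e * (1 + r) \<le> 3 * e" using e r mult_left_mono[of "1 + r" 3 e] by simp
    then have "\<nu> / 2 + e * (1 + r) - r * \<beta> \<le> - d" using e(3) by linarith
    from mult_right_mono[OF this, of q] q
    have "(- (\<nu> / 2) * i + e * \<bar>i\<bar>) + r * (\<beta> * i + e * \<bar>i\<bar>) \<le> - d * \<bar>i\<bar>"
      by (simp add: algebra_simps)
    then show ?thesis using K by (intro mult_left_mono) auto
  qed
  also have "\<dots> \<le> K1 * (1 + K2 powr r) * exp (- d * \<bar>i\<bar>)"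
    using K by (intro mult_right_mono) (auto simp: algebra_simps)
  finally show ?thesis .
qed

context parity_tails
begin

lemma weight_bound:
  assumes e: "e > 0"
  shows "\<exists>K\<ge>0. eventually (\<lambda>N. \<forall>w. real (k N) * p w \<le>
      K * exp (- (\<nu> / 2) * (real w - 2 * real N) + e * \<bar>real w - 2 * real N\<bar>)) sequentially"
proof -
  \<comment> \<open>One slowly varying sequence \<open>c\<close> must dominate both parities.
    Eventually \<open>h2\<close> is below (c1 + 1) \<open>h1\<close>, and an odd index 2m + 1 leaves
    an extra exp(\<nu>/2) once the geometric factor is removed. With \<open>w div 2\<close> the
    sequence is constant from 2m to 2m + 1, so its ratio still tends to 1.\<close>
  define C where "C = 1 + exp (\<nu> / 2) * (c1 + 1)"
  define c where "c w = C * h1 (real (w div 2))" for w :: nat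
  define d where "d w = p w * exp (\<nu> / 2 * real w)" for w
  have C: "C \<ge> 1" "exp (\<nu> / 2) * (c1 + 1) \<le> C" "C > 0" using c1 by (auto simp: C_def intro!: add_pos_nonneg)
  have ratio: "(\<lambda>w. c (Suc w) / c w) \<longlonglongrightarrow> 1"
  proof (rule limseq_even_odd)
    have "eventually (\<lambda>n. c (Suc (2 * n)) / c (2 * n) = 1) sequentially"
      using h1_eventually_pos by eventually_elim (use C in \<open>simp add: c_def\<close>)
    then show "(\<lambda>n. c (Suc (2 * n)) / c (2 * n)) \<longlonglongrightarrow> 1" by (rule tendsto_eventually)
    have "c (Suc (2 * n + 1)) / c (2 * n + 1) = h1 (real (Suc n)) / h1 (real n)" for n
      using C by (simp add: c_def)
    then show "(\<lambda>n. c (Suc (2 * n + 1)) / c (2 * n + 1)) \<longlonglongrightarrow> 1" using h1_Suc_ratio by simp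
  qed
  have pos: "eventually (\<lambda>w. c w > 0) sequentially"
    using eventually_gt_at_top[of 1] by eventually_elim (use C h1_pos in \<open>simp add: c_def\<close>)
  have le: "eventually (\<lambda>w. d w \<le> c w) sequentially"
  proof (rule sequentially_even_odd)
    show "eventually (\<lambda>m. d (2 * m) \<le> c (2 * m)) sequentially"
      using eventually_gt_at_top[of 0]
    proof eventually_elim
      case (elim m)
      have "d (2 * m) \<le> H1 m * exp (\<nu> / 2 * real (2 * m))"
        unfolding d_def using p_even_le[OF elim] by (intro mult_right_mono) auto
      also have "\<dots> = h1 (real m) * (exp (- \<nu> * real m) * exp (\<nu> / 2 * real (2 * m)))"
        by (simp add: H1_def)
      also have "exp (- \<nu> * real m) * exp (\<nu> / 2 * real (2 * m)) = 1"
        by (simp add: exp_add[symmetric])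
      also have "h1 (real m) * 1 \<le> C * h1 (real m)"
        using C elim h1_pos mult_right_mono[of 1 C "h1 (real m)"] by (simp add: less_imp_le)
      finally show ?case by (simp add: c_def)
    qed
    have "eventually (\<lambda>x. h2 x / h1 x < c1 + 1) at_top" by (rule order_tendstoD(2)[OF h2_h1]) simp
    then have "eventually (\<lambda>m. h2 (real m) / h1 (real m) < c1 + 1) sequentially"
      by (rule eventually_compose_filterlim[OF _ filterlim_real_sequentially])
    then show "eventually (\<lambda>m. d (2 * m + 1) \<le> c (2 * m + 1)) sequentially"
      using eventually_gt_at_top[of 0]
    proof eventually_elim
      case (elim m)
      have h: "h1 (real m) > 0" using elim h1_pos by simp
      have h2: "h2 (real m) \<le> (c1 + 1) * h1 (real m)" using elim h by (simp add: field_simps)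
      have "d (2 * m + 1) \<le> H2 m * exp (\<nu> / 2 * real (2 * m + 1))"
        unfolding d_def using p_odd_le[OF elim(2)] by (intro mult_right_mono) auto
      also have "\<dots> = h2 (real m) * (exp (- \<nu> * real m) * exp (\<nu> / 2 * real (2 * m + 1)))"
        by (simp add: H2_def)
      also have "exp (- \<nu> * real m) * exp (\<nu> / 2 * real (2 * m + 1)) = exp (\<nu> / 2)"
        by (simp only: exp_add[symmetric]) (simp add: algebra_simps)
      also have "h2 (real m) * exp (\<nu> / 2) \<le> ((c1 + 1) * h1 (real m)) * exp (\<nu> / 2)"
        using h2 by (intro mult_right_mono) auto
      also have "\<dots> = (exp (\<nu> / 2) * (c1 + 1)) * h1 (real m)" by simp
      also have "\<dots> \<le> C * h1 (real m)" using C h by (intro mult_right_mono) auto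
      finally show ?case by (simp add: c_def)
    qed
  qed
  obtain K n0 where K: "K > 0" "\<And>w N. N \<ge> n0 \<Longrightarrow> d w \<le> K * c N * exp (e * \<bar>real w - real N\<bar>)"
    using slowly_varying_sequence_bound[OF ratio pos le e] by blast
  have "eventually (\<lambda>N. real (k N) * H1 N < 2) sequentially" by (rule order_tendstoD(2)[OF k_H1]) simp
  then have "eventually (\<lambda>N. \<forall>w. real (k N) * p w \<le>
      2 * K * C * exp (- (\<nu> / 2) * (real w - 2 * real N) + e * \<bar>real w - 2 * real N\<bar>)) sequentially"
    using eventually_gt_at_top[of n0]
  proof eventually_elim
    case (elim N)
    show ?case
    proof
      fix w
      let ?i = "real w - 2 * real N"
      have "p w = d w * exp (- (\<nu> / 2) * real w)" by (simp add: d_def exp_minus)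
      also have "\<dots> \<le> (K * c (2 * N) * exp (e * \<bar>real w - real (2 * N)\<bar>)) * exp (- (\<nu> / 2) * real w)"
        using elim by (intro mult_right_mono K) auto
      also have "\<dots> = K * C * h1 (real N) * (exp (e * \<bar>?i\<bar>) * exp (- (\<nu> / 2) * real w))"
        by (simp add: c_def)
      also have "exp (e * \<bar>?i\<bar>) * exp (- (\<nu> / 2) * real w) = exp (- \<nu> * real N) * exp (- (\<nu> / 2) * ?i + e * \<bar>?i\<bar>)"
        by (simp only: exp_add[symmetric]) (simp add: algebra_simps)
      finally have "p w \<le> H1 N * (K * C * exp (- (\<nu> / 2) * ?i + e * \<bar>?i\<bar>))" by (simp add: H1_def ac_simps)
      then have "real (k N) * p w \<le> real (k N) * (H1 N * (K * C * exp (- (\<nu> / 2) * ?i + e * \<bar>?i\<bar>)))"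
        by (intro mult_left_mono) auto
      also have "\<dots> = (real (k N) * H1 N) * (K * C * exp (- (\<nu> / 2) * ?i + e * \<bar>?i\<bar>))" by simp
      also have "\<dots> \<le> 2 * (K * C * exp (- (\<nu> / 2) * ?i + e * \<bar>?i\<bar>))"
        using elim K C by (intro mult_right_mono) auto
      finally show "real (k N) * p w \<le> 2 * K * C * exp (- (\<nu> / 2) * ?i + e * \<bar>?i\<bar>)" by (simp add: ac_simps)
    qed
  qed
  with K C show ?thesis by (intro exI[of _ "2 * K * C"]) auto
qed

definition X :: "nat \<Rightarrow> real" where
  "X w = L (exp (real w)) * exp (\<beta> * real w) * (-1) ^ w"

definition A :: "nat \<Rightarrow> real" where
  "A N = L (exp (2 * real N)) * exp (2 * \<beta> * real N)"

lemma L_Suc_ratio: "(\<lambda>n. L (exp (real (Suc n))) / L (exp (real n))) \<longlonglongrightarrow> 1"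
proof -
  have "((\<lambda>x. L (exp 1 * x) / L x) \<longlongrightarrow> 1) at_top" using L_slow by (simp add: slowly_varying_def)
  from filterlim_compose[OF this filterlim_compose[OF exp_at_top filterlim_real_sequentially]]
  show ?thesis by (simp add: exp_add[symmetric] add.commute)
qed

lemma L_eventually_pos: "eventually (\<lambda>n. L (exp (real n)) > 0) sequentially"
proof -
  obtain a where "\<forall>x\<ge>a. L x > 0" using L_slow by (auto simp: slowly_varying_def)
  then have "eventually (\<lambda>x. L x > 0) at_top" by (auto simp: eventually_at_top_linorder)
  then show ?thesis
    by (rule eventually_compose_filterlim[OF _ filterlim_compose[OF exp_at_top filterlim_real_sequentially]])
qed

lemma A_eventually_pos: "eventually (\<lambda>N. A N > 0) sequentially"
proof -
  have "filterlim (\<lambda>N::nat. 2 * N) at_top sequentially" by (rule filterlim_at_top_mono[OF filterlim_ident]) auto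
  from eventually_compose_filterlim[OF L_eventually_pos this] show ?thesis
    by eventually_elim (simp add: A_def)
qed

lemma value_bound:
  assumes e: "e > 0"
  shows "\<exists>K\<ge>0. eventually (\<lambda>N. \<forall>w. \<bar>X w / A N\<bar> \<le>
      K * exp (\<beta> * (real w - 2 * real N) + e * \<bar>real w - 2 * real N\<bar>)) sequentially"
proof -
  have le: "eventually (\<lambda>n. \<bar>L (exp (real n))\<bar> \<le> L (exp (real n))) sequentially"
    using L_eventually_pos by eventually_elim simp
  obtain K n0 where K: "K > 0" "\<And>w N. N \<ge> n0 \<Longrightarrow> \<bar>L (exp (real w))\<bar> \<le> K * L (exp (real N)) * exp (e * \<bar>real w - real N\<bar>)"
    using slowly_varying_sequence_bound[where c="\<lambda>n. L (exp (real n))", OF L_Suc_ratio L_eventually_pos le e]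
    by blast
  have "eventually (\<lambda>N. \<forall>w. \<bar>X w / A N\<bar> \<le>
      K * exp (\<beta> * (real w - 2 * real N) + e * \<bar>real w - 2 * real N\<bar>)) sequentially"
    using A_eventually_pos eventually_gt_at_top[of n0]
  proof eventually_elim
    case (elim N)
    show ?case
    proof
      fix w
      let ?i = "real w - 2 * real N"
      have "\<bar>X w\<bar> = \<bar>L (exp (real w))\<bar> * exp (\<beta> * real w)" by (simp add: X_def abs_mult power_abs)
      also have "\<dots> \<le> (K * L (exp (real (2 * N))) * exp (e * \<bar>real w - real (2 * N)\<bar>)) * exp (\<beta> * real w)"
        using elim by (intro mult_right_mono K) auto
      also have "\<dots> = K * L (exp (2 * real N)) * (exp (e * \<bar>?i\<bar>) * exp (\<beta> * real w))" by simp
      also have "exp (e * \<bar>?i\<bar>) * exp (\<beta> * real w) = exp (2 * \<beta> * real N) * exp (\<beta> * ?i + e * \<bar>?i\<bar>)"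
        by (simp only: exp_add[symmetric]) (simp add: algebra_simps)
      finally have "\<bar>X w\<bar> \<le> (K * exp (\<beta> * ?i + e * \<bar>?i\<bar>)) * A N" by (simp add: A_def ac_simps)
      then show "\<bar>X w / A N\<bar> \<le> K * exp (\<beta> * ?i + e * \<bar>?i\<bar>)"
        using elim by (simp add: abs_divide pos_divide_le_eq)
    qed
  qed
  with K show ?thesis by (intro exI[of _ K]) auto
qed

definition z :: "int \<Rightarrow> real" where
  "z i = (if even i then 1 else - 1) * exp (\<beta> * of_int i)"

lemma value_tendsto: "(\<lambda>N. X (nat (2 * int N + i)) / A N) \<longlonglongrightarrow> z i"
proof -
  have t: "filterlim (\<lambda>N::nat. 2 * N) at_top sequentially" by (rule filterlim_at_top_mono[OF filterlim_ident]) auto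
  have "(\<lambda>n. L (exp (real (nat (int n + i)))) / L (exp (real n))) \<longlonglongrightarrow> 1"
    by (rule tendsto_ratio_shift[where c="\<lambda>n. L (exp (real n))", OF L_Suc_ratio L_eventually_pos])
  from tendsto_mult[OF filterlim_compose[OF this t] tendsto_const[of "z i"]]
  have "(\<lambda>N. L (exp (real (nat (int (2 * N) + i)))) / L (exp (real (2 * N))) * z i) \<longlonglongrightarrow> z i" by simp
  moreover have "eventually (\<lambda>N. L (exp (real (nat (int (2 * N) + i)))) / L (exp (real (2 * N))) * z i = X (nat (2 * int N + i)) / A N) sequentially"
    using eventually_gt_at_top[of "nat \<bar>i\<bar>"]
  proof eventually_elim
    case (elim N)
    define w where "w = nat (2 * int N + i)"
    have w: "int w = 2 * int N + i" using elim by (simp add: w_def)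
    have rw: "real w = 2 * real N + of_int i" using arg_cong[OF w, of real_of_int] by simp
    have par: "even w \<longleftrightarrow> even i" using arg_cong[OF w, of even] by simp
    have "exp (\<beta> * real w) = exp (2 * \<beta> * real N) * exp (\<beta> * of_int i)"
      unfolding rw by (simp only: exp_add[symmetric]) (simp add: algebra_simps)
    then have "X w / A N = L (exp (real w)) / L (exp (2 * real N)) * z i"
      unfolding X_def A_def z_def using par by (cases "even w") simp_all
    then show ?case by (simp add: w_def)
  qed
  ultimately show ?thesis by (rule Lim_transform_eventually)
qed

end

section \<open>Rescaling, and passage from the parity tails to the integer array\<close>

lemma (in prob_space) char_distr_affine:
  assumes [measurable]: "Y \<in> borel_measurable M"
  shows "char (distr M borel (\<lambda>\<omega>. (Y \<omega> - B) / a)) t = char (distr M borel Y) (t / a) * iexp (- (t * (B / a)))"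
proof -
  have "char (distr M borel (\<lambda>\<omega>. (Y \<omega> - B) / a)) t = (CLINT \<omega>|M. iexp (t * ((Y \<omega> - B) / a)))"
    unfolding char_def by (subst integral_distr) auto
  also have "\<dots> = (CLINT \<omega>|M. iexp (t / a * Y \<omega>) * iexp (- (t * (B / a))))"
  proof (rule Bochner_Integration.integral_cong[OF refl])
    fix \<omega>
    have "t * ((Y \<omega> - B) / a) = t / a * Y \<omega> + - (t * (B / a))" by (simp add: diff_divide_distrib right_diff_distrib)
    then show "iexp (t * ((Y \<omega> - B) / a)) = iexp (t / a * Y \<omega>) * iexp (- (t * (B / a)))"
      by (simp only: of_real_add distrib_left exp_add)
  qed
  also have "\<dots> = (CLINT \<omega>|M. iexp (t / a * Y \<omega>)) * iexp (- (t * (B / a)))"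
    by (rule integral_mult_left_zero)
  also have "(CLINT \<omega>|M. iexp (t / a * Y \<omega>)) = char (distr M borel Y) (t / a)"
    unfolding char_def by (subst integral_distr) auto
  finally show ?thesis .
qed

text \<open>Both sides have the same upper bounds by \<open>quantile_le_iff\<close>, hence they are
  equal.\<close>

lemma (in prob_space) quantile_distr_divide:
  assumes [measurable]: "Y \<in> borel_measurable M" and a: "a > 0" and s: "0 < s" "s < 1"
  shows "Inf {y. s \<le> cdf (distr M borel (\<lambda>\<omega>. Y \<omega> / a)) y} = Inf {y. s \<le> cdf (distr M borel Y) y} / a"
proof -
  let ?\<mu> = "distr M borel Y" and ?\<mu>' = "distr M borel (\<lambda>\<omega>. Y \<omega> / a)"
  interpret \<mu>: real_distribution ?\<mu> by (rule real_distribution_distr) simp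
  interpret \<mu>': real_distribution ?\<mu>' by (rule real_distribution_distr) simp
  have "(\<lambda>\<omega>. Y \<omega> / a) -` {..x} \<inter> space M = Y -` {..x * a} \<inter> space M" for x
    using a by (auto simp: field_simps)
  then have cdf: "cdf ?\<mu>' x = cdf ?\<mu> (x * a)" for x by (simp add: cdf_def measure_distr)
  have "quantile ?\<mu>' s \<le> x \<longleftrightarrow> quantile ?\<mu> s / a \<le> x" for x
    using \<mu>.quantile_le_iff[OF s, of "x * a"] \<mu>'.quantile_le_iff[OF s, of x] cdf a by (simp add: field_simps)
  then have "quantile ?\<mu>' s = quantile ?\<mu> s / a" by (meson order_antisym order_refl)
  then show ?thesis using s by (simp add: quantile_def)
qed

context parity_tails
begin

definition J :: "nat \<Rightarrow> 'a \<Rightarrow> int" where "J N \<omega> = int (W \<omega>) - 2 * int N"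

lemma J_meas [measurable]: "J N \<in> measurable M (count_space UNIV)"
  unfolding J_def by measurable

lemma prob_J: "prob {\<omega> \<in> space M. J N \<omega> = i} = (if 2 * int N + i \<ge> 0 then p (nat (2 * int N + i)) else 0)"
proof -
  have "{\<omega> \<in> space M. J N \<omega> = i} = (if 2 * int N + i \<ge> 0 then {\<omega> \<in> space M. W \<omega> = nat (2 * int N + i)} else {})"
    by (auto simp: J_def)
  then show ?thesis by (simp add: p_def)
qed

lemma exists_int_array:
  "\<exists>r C d. int_array M J k (\<lambda>N i. X (nat (2 * int N + i)) / A N) b z r C d"
proof -
  \<comment> \<open>The midpoint between max(1, \<alpha>) and 2.\<close>
  define r where "r = (max 1 (\<nu> / (2 * \<beta>)) + 2) / 2"
  have r: "1 \<le> r" "r < 2" "\<nu> / (2 * \<beta>) < r" using index by (auto simp: r_def max_def)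
  have r\<beta>: "r * \<beta> - \<nu> / 2 > 0" using r(3) \<beta> by (simp add: field_simps)
  \<comment> \<open>Half of the smaller of the two decay rates. With \<open>e = d / 3\<close> the
    losses \<open>e\<close> and \<open>3 * e\<close> are at most \<open>d\<close>, so rate
    \<open>d\<close> is left on both sides.\<close>
  define d where "d = min (\<nu> / 2) (r * \<beta> - \<nu> / 2) / 2"
  define e where "e = d / 3"
  have d: "d > 0" using \<nu> r\<beta> by (simp add: d_def)
  have e: "e > 0" "d \<le> \<nu> / 2 - e" "d \<le> r * \<beta> - \<nu> / 2 - 3 * e"
  proof -
    have "2 * d = min (\<nu> / 2) (r * \<beta> - \<nu> / 2)" by (simp add: d_def)
    then have "2 * d \<le> \<nu> / 2" "2 * d \<le> r * \<beta> - \<nu> / 2" by linarith+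
    then show "e > 0" "d \<le> \<nu> / 2 - e" "d \<le> r * \<beta> - \<nu> / 2 - 3 * e" using d by (auto simp: e_def)
  qed
  obtain K1 where K1: "K1 \<ge> 0" "eventually (\<lambda>N. \<forall>w. real (k N) * p w \<le>
      K1 * exp (- (\<nu> / 2) * (real w - 2 * real N) + e * \<bar>real w - 2 * real N\<bar>)) sequentially"
    using weight_bound[OF e(1)] by blast
  obtain K2 where K2: "K2 \<ge> 0" "eventually (\<lambda>N. \<forall>w. \<bar>X w / A N\<bar> \<le>
      K2 * exp (\<beta> * (real w - 2 * real N) + e * \<bar>real w - 2 * real N\<bar>)) sequentially"
    using value_bound[OF e(1)] by blast
  define C where "C = K1 * (1 + K2 powr r)"
  have C: "C \<ge> 0" using K1 by (simp add: C_def)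
  have "int_array M J k (\<lambda>N i. X (nat (2 * int N + i)) / A N) b z r C d"
  proof
    show "(\<lambda>N. real (k N) * prob {\<omega> \<in> space M. J N \<omega> = i}) \<longlonglongrightarrow> b i" for i
    proof (rule Lim_transform_eventually[OF weight_tendsto])
      show "eventually (\<lambda>N. real (k N) * p (nat (2 * int N + i)) = real (k N) * prob {\<omega> \<in> space M. J N \<omega> = i}) sequentially"
        using eventually_gt_at_top[of "nat \<bar>i\<bar>"] by eventually_elim (simp add: prob_J)
    qed
    show "eventually (\<lambda>N. \<forall>i. real (k N) * prob {\<omega> \<in> space M. J N \<omega> = i} * min 1 \<bar>X (nat (2 * int N + i)) / A N\<bar> powr r
        \<le> C * exp (- d * \<bar>real_of_int i\<bar>)) sequentially"
      using K1(2) K2(2)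
    proof eventually_elim
      case (elim N)
      show ?case
      proof
        fix i
        show "real (k N) * prob {\<omega> \<in> space M. J N \<omega> = i} * min 1 \<bar>X (nat (2 * int N + i)) / A N\<bar> powr r
          \<le> C * exp (- d * \<bar>real_of_int i\<bar>)"
        proof (cases "2 * int N + i \<ge> 0")
          case True
          define w where "w = nat (2 * int N + i)"
          have w: "int w = 2 * int N + i" using True by (simp add: w_def)
          have i: "real w - 2 * real N = of_int i" using arg_cong[OF w, of real_of_int] by simp
          have "real (k N) * p w * min 1 \<bar>X w / A N\<bar> powr r \<le> C * exp (- d * \<bar>real_of_int i\<bar>)"
            unfolding C_def
            by (rule weighted_min_powr_bound[where \<nu>=\<nu> and \<beta>=\<beta> and e=e])
               (use elim[THEN spec, of w] i K1(1) K2(1) r e p_nonneg[of w] in auto)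
          then show ?thesis using True by (simp add: prob_J w_def)
        next
          case False
          then show ?thesis using C by (simp add: prob_J)
        qed
      qed
    qed
  qed (use r d k_at_top value_tendsto in auto)
  then show ?thesis by blast
qed

theorem exists_semi_stable_limit:
  assumes indep: "indep_vars (\<lambda>_. borel) Xs UNIV"
    and distr_Xs: "\<And>j. distr M borel (Xs j) = distr M borel (\<lambda>\<omega>. X (W \<omega>))"
  shows "\<exists>m. semi_stable_law (\<nu> / (2 * \<beta>)) (M_left c1 \<nu> \<beta>) (M_right \<nu> \<beta>) m \<and>
    weak_conv_m (\<lambda>N. distr M borel (\<lambda>\<omega>. ((\<Sum>j\<in>{1..k N}. Xs j \<omega>) -
      real (k N) * (LBINT s:{1 / real (k N)..1 - 1 / real (k N)}. Inf {y. cdf (distr M borel (\<lambda>\<omega>. X (W \<omega>))) y \<ge> s})) / A N)) m"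
proof -
  obtain r C d where "int_array M J k (\<lambda>N i. X (nat (2 * int N + i)) / A N) b z r C d"
    using exists_int_array by blast
  then interpret a: int_array M J k "\<lambda>N i. X (nat (2 * int N + i)) / A N" b z r C d .
  let ?D = "distr M borel (\<lambda>\<omega>. X (W \<omega>))"
  define B where "B N = real (k N) * (LBINT s:{1 / real (k N)..1 - 1 / real (k N)}. Inf {y. cdf ?D y \<ge> s})" for N
  have XW [measurable]: "(\<lambda>\<omega>. X (W \<omega>)) \<in> borel_measurable M"
    by (rule measurable_compose[OF W_meas]) simp
  have Xs [measurable]: "Xs j \<in> borel_measurable M" for j
    using indep by (auto simp: indep_vars_def)
  have \<mu>: "a.\<mu> N = distr M borel (\<lambda>\<omega>. X (W \<omega>) / A N)" for N
    by (simp add: a.\<mu>_def J_def)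
  have k2: "eventually (\<lambda>N. k N > 2) sequentially"
    by (rule eventually_compose_filterlim[OF eventually_gt_at_top k_at_top])
  have kr: "filterlim (\<lambda>N. real (k N)) at_top sequentially"
    using filterlim_compose[OF filterlim_real_sequentially k_at_top] .
  \<comment> \<open>Beyond \<open>m0\<close> the sign of X is given by the parity of W. The events
    with W at least 2m and even, or at least 2m + 1 and odd, have fixed positive probabilities
    \<open>H1 m\<close> and \<open>H2 m\<close>, also when \<open>c1 = 0\<close>. As
    \<open>k N\<close> tends to infinity, this gives \<open>left\<close> and
    \<open>right\<close>.\<close>
  obtain m0 where m0: "\<And>n. n \<ge> m0 \<Longrightarrow> L (exp (real n)) > 0"
    using L_eventually_pos unfolding eventually_sequentially by blast
  define m where "m = Suc m0"
  have m: "m > 0" by (simp add: m_def)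
  have left: "eventually (\<lambda>N. real (k N) * cdf (a.\<mu> N) 0 \<ge> 1) sequentially"
  proof -
    have "eventually (\<lambda>N. real (k N) > 1 / H2 m) sequentially"
      using kr by (auto simp: filterlim_at_top_dense)
    then show ?thesis using A_eventually_pos
    proof eventually_elim
      case (elim N)
      have "H2 m = prob {\<omega> \<in> space M. 2 * m + 1 \<le> W \<omega> \<and> odd (W \<omega>)}" using prob_odd_ge[OF m] by simp
      also have "\<dots> \<le> prob ((\<lambda>\<omega>. X (W \<omega>) / A N) -` {..0} \<inter> space M)"
      proof (rule finite_measure_mono)
        show "{\<omega> \<in> space M. 2 * m + 1 \<le> W \<omega> \<and> odd (W \<omega>)} \<subseteq> (\<lambda>\<omega>. X (W \<omega>) / A N) -` {..0} \<inter> space M"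
        proof
          fix \<omega> assume \<omega>: "\<omega> \<in> {\<omega> \<in> space M. 2 * m + 1 \<le> W \<omega> \<and> odd (W \<omega>)}"
          then have "X (W \<omega>) \<le> 0" using m0[of "W \<omega>"] by (simp add: X_def m_def less_imp_le)
          then have "X (W \<omega>) / A N \<le> 0" using elim by (simp add: divide_le_0_iff)
          then show "\<omega> \<in> (\<lambda>\<omega>. X (W \<omega>) / A N) -` {..0} \<inter> space M" using \<omega> by simp
        qed
      qed simp
      also have "\<dots> = cdf (a.\<mu> N) 0" by (simp add: \<mu> cdf_def measure_distr)
      finally have "real (k N) * H2 m \<le> real (k N) * cdf (a.\<mu> N) 0" by (intro mult_left_mono) auto
      moreover have "1 \<le> real (k N) * H2 m" using elim(1) H2_pos[OF m] by (simp add: field_simps)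
      ultimately show ?case by linarith
    qed
  qed
  have right: "eventually (\<lambda>N. real (k N) * measure (a.\<mu> N) {0..} \<ge> 1) sequentially"
  proof -
    have "eventually (\<lambda>N. real (k N) > 1 / H1 m) sequentially"
      using kr by (auto simp: filterlim_at_top_dense)
    then show ?thesis using A_eventually_pos
    proof eventually_elim
      case (elim N)
      have "H1 m = prob {\<omega> \<in> space M. 2 * m \<le> W \<omega> \<and> even (W \<omega>)}" using prob_even_ge[OF m] by simp
      also have "\<dots> \<le> prob ((\<lambda>\<omega>. X (W \<omega>) / A N) -` {0..} \<inter> space M)"
      proof (rule finite_measure_mono)
        show "{\<omega> \<in> space M. 2 * m \<le> W \<omega> \<and> even (W \<omega>)} \<subseteq> (\<lambda>\<omega>. X (W \<omega>) / A N) -` {0..} \<inter> space M"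
        proof
          fix \<omega> assume \<omega>: "\<omega> \<in> {\<omega> \<in> space M. 2 * m \<le> W \<omega> \<and> even (W \<omega>)}"
          then have "X (W \<omega>) \<ge> 0" using m0[of "W \<omega>"] by (simp add: X_def m_def less_imp_le)
          then have "X (W \<omega>) / A N \<ge> 0" using elim by simp
          then show "\<omega> \<in> (\<lambda>\<omega>. X (W \<omega>) / A N) -` {0..} \<inter> space M" using \<omega> by simp
        qed
      qed simp
      also have "\<dots> = measure (a.\<mu> N) {0..}" by (simp add: \<mu> measure_distr)
      finally have "real (k N) * H1 m \<le> real (k N) * measure (a.\<mu> N) {0..}" by (intro mult_left_mono) auto
      moreover have "1 \<le> real (k N) * H1 m" using elim(1) H1_pos[OF m] by (simp add: field_simps)
      ultimately show ?case by linarith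
    qed
  qed
  have char_S: "eventually (\<lambda>N. \<forall>t. char (distr M borel (\<lambda>\<omega>. ((\<Sum>j\<in>{1..k N}. Xs j \<omega>) - B N) / A N)) t =
      char (a.\<mu> N) t ^ k N *
      iexp (- (t * (real (k N) * (LBINT s:{1 / real (k N)..1 - 1 / real (k N)}. Inf {y. s \<le> cdf (a.\<mu> N) y}))))) sequentially"
    using k2 A_eventually_pos
  proof eventually_elim
    case (elim N)
    have k1: "0 < 1 / real (k N)" using elim by simp
    have "(LBINT s:{1 / real (k N)..1 - 1 / real (k N)}. Inf {y. s \<le> cdf (a.\<mu> N) y}) =
        (LBINT s:{1 / real (k N)..1 - 1 / real (k N)}. Inf {y. s \<le> cdf ?D y} / A N)"
    proof (intro set_lebesgue_integral_cong allI impI)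
      fix s assume "s \<in> {1 / real (k N)..1 - 1 / real (k N)}"
      then have "1 / real (k N) \<le> s" "s \<le> 1 - 1 / real (k N)" by auto
      then have "0 < s" "s < 1" using k1 by linarith+
      then show "Inf {y. s \<le> cdf (a.\<mu> N) y} = Inf {y. s \<le> cdf ?D y} / A N"
        unfolding \<mu> by (rule quantile_distr_divide[OF XW elim(2)])
    qed simp
    then have B: "real (k N) * (LBINT s:{1 / real (k N)..1 - 1 / real (k N)}. Inf {y. s \<le> cdf (a.\<mu> N) y}) = B N / A N"
      by (simp add: B_def)
    show ?case
    proof
      fix t
      have "char (distr M borel (\<lambda>\<omega>. \<Sum>j\<in>{1..k N}. Xs j \<omega>)) (t / A N) = (\<Prod>j\<in>{1..k N}. char (distr M borel (Xs j)) (t / A N))"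
        by (rule char_distr_sum[OF indep_vars_subset[OF indep]]) simp
      also have "\<dots> = char ?D (t / A N) ^ k N" by (simp add: distr_Xs)
      also have "char ?D (t / A N) = char (a.\<mu> N) t"
        using char_distr_affine[OF XW, of 0 "A N" t] by (simp add: \<mu>)
      finally show "char (distr M borel (\<lambda>\<omega>. ((\<Sum>j\<in>{1..k N}. Xs j \<omega>) - B N) / A N)) t = char (a.\<mu> N) t ^ k N *
        iexp (- (t * (real (k N) * (LBINT s:{1 / real (k N)..1 - 1 / real (k N)}. Inf {y. s \<le> cdf (a.\<mu> N) y}))))"
        unfolding B by (subst char_distr_affine) auto
    qed
  qed
  have "\<exists>m. semi_stable_law (\<nu> / (2 * \<beta>)) (M_left c1 \<nu> \<beta>) (M_right \<nu> \<beta>) m \<and>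
      weak_conv_m (\<lambda>N. distr M borel (\<lambda>\<omega>. ((\<Sum>j\<in>{1..k N}. Xs j \<omega>) - B N) / A N)) m"
    by (rule a.exists_semi_stable_limit[OF c1 \<nu> \<beta> _ _ _ _ left right _ char_S])
       (auto simp: b_def z_def intro!: real_distribution_distr)
  then show ?thesis unfolding B_def .
qed

end

theorem theorem3p1:
  fixes M :: "'a measure" and W :: "'a \<Rightarrow> nat" and Xs :: "nat \<Rightarrow> 'a \<Rightarrow> real"
    and \<nu> \<beta> c1 :: real and h1 h2 L :: "real \<Rightarrow> real"
  assumes "prob_space M"
    and "W \<in> measurable M (count_space UNIV)"
    and "\<nu> > 0" and "\<beta> > 0" and "c1 \<ge> 0"
    and "\<forall>x>0. h1 x > 0" and "\<forall>x>0. h2 x > 0"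
    and "((\<lambda>x. h2 x / h1 x) \<longlongrightarrow> c1) at_top"
    and "((\<lambda>(a, x). h1 (a * x) / h1 x) \<longlongrightarrow> 1) (at 1 \<times>\<^sub>F at_top)"
    and "\<forall>x>0. measure M {\<omega>\<in>space M. real (W \<omega>) / 2 \<ge> x \<and> even (W \<omega>)}
              = h1 (of_int \<lceil>x\<rceil>) * exp (- \<nu> * of_int \<lceil>x\<rceil>)"
    and "\<forall>x>0. measure M {\<omega>\<in>space M. (real (W \<omega>) - 1) / 2 \<ge> x \<and> odd (W \<omega>)}
              = h2 (of_int \<lceil>x\<rceil>) * exp (- \<nu> * of_int \<lceil>x\<rceil>)"
    and "slowly_varying L"
    and "eventually (\<lambda>n::nat. L (exp (real n)) \<le> L (exp (real (Suc n)))) sequentially"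
    and "\<nu> / (2 * \<beta>) < 2"
    and "prob_space.indep_vars M (\<lambda>_. borel) Xs UNIV"
    and "\<forall>j. distr M borel (Xs j) =
           distr M borel (\<lambda>\<omega>. L (exp (real (W \<omega>))) * exp (\<beta> * real (W \<omega>)) * (-1) ^ W \<omega>)"
  shows "let X = (\<lambda>\<omega>. L (exp (real (W \<omega>))) * exp (\<beta> * real (W \<omega>)) * (-1) ^ W \<omega>);
             F = cdf (distr M borel X);
             Q = (\<lambda>s. Inf {y. F y \<ge> s});
             k = (\<lambda>n::nat. nat \<lceil>exp ((real n - 1) * \<nu>) / h1 (real n - 1)\<rceil>);
             A = (\<lambda>n::nat. L (exp (2 * real n - 2)) * exp (2 * \<beta> * (real n - 1)));
             B = (\<lambda>n::nat. real (k n) * (LBINT s:{1 / real (k n) .. 1 - 1 / real (k n)}. Q s))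
         in \<exists>\<mu>. semi_stable_law (\<nu> / (2 * \<beta>)) (M_left c1 \<nu> \<beta>) (M_right \<nu> \<beta>) \<mu> \<and>
               weak_conv_m
                 (\<lambda>n. distr M borel (\<lambda>\<omega>. ((\<Sum>j\<in>{1..k n}. Xs j \<omega>) - B n) / A n)) \<mu>"
proof -
  interpret prob_space M by fact
  interpret parity_tails M W \<nu> \<beta> c1 h1 h2 L by standard fact+
  define X' where "X' \<omega> = L (exp (real (W \<omega>))) * exp (\<beta> * real (W \<omega>)) * (-1) ^ W \<omega>" for \<omega>
  define k' where "k' n = nat \<lceil>exp ((real n - 1) * \<nu>) / h1 (real n - 1)\<rceil>" for n :: nat
  define A' where "A' n = L (exp (2 * real n - 2)) * exp (2 * \<beta> * (real n - 1))" for n :: nat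
  define B' where "B' n = real (k' n) * (LBINT s:{1 / real (k' n) .. 1 - 1 / real (k' n)}. Inf {y. cdf (distr M borel X') y \<ge> s})" for n
  \<comment> \<open>The locale indexes by \<open>N = n - 1\<close>, which also keeps \<open>n = 0\<close> out of the way.\<close>
  define S where "S n = distr M borel (\<lambda>\<omega>. ((\<Sum>j\<in>{1..k' n}. Xs j \<omega>) - B' n) / A' n)" for n
  have X': "X' = (\<lambda>\<omega>. X (W \<omega>))" by (simp add: fun_eq_iff X'_def X_def)
  have k': "k' (Suc N) = k N" and A': "A' (Suc N) = A N" for N
    by (simp_all add: k'_def k_def A'_def A_def)
  have d: "distr M borel (Xs j) = distr M borel (\<lambda>\<omega>. X (W \<omega>))" for j
    using assms(16) unfolding X_def by blast
  obtain m where m: "semi_stable_law (\<nu> / (2 * \<beta>)) (M_left c1 \<nu> \<beta>) (M_right \<nu> \<beta>) m"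
    "weak_conv_m (\<lambda>N. S (Suc N)) m"
    using exists_semi_stable_limit[OF assms(15) d] unfolding S_def B'_def k' A' X' by blast
  have "weak_conv_m S m"
    using m(2) unfolding weak_conv_m_def weak_conv_def by (auto intro: LIMSEQ_imp_Suc)
  with m(1) show ?thesis
    unfolding Let_def S_def[abs_def] B'_def A'_def k'_def X'_def[abs_def] by blast
qed

end
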